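(* Let $\alpha\ge 2$ be a countable ordinal, and let $(\mathcal{P}_z)_{z\in\mathbb{N}}$ be a Gödel numbering of the real-time 4-blind-counter Büchi automata. Then each of the following sets is $\Pi^1_2$-hard: (1) $\{z\in\mathbb{N}\mid \mathrm{L}(\mathcal{P}_z)\in\mathbf{\Sigma}^0_\alpha\}$; (2) $\{z\in\mathbb{N}\mid \mathrm{L}(\mathcal{P}_z)\in\mathbf{\Pi}^0_\alpha\}$; (3) $\{z\in\mathbb{N}\mid \mathrm{L}(\mathcal{P}_z)\text{ is a Borel set}\}$.
   Context: A real-time 4-blind-counter Büchi automaton (model of Petri nets) is a finite-state automaton over a finite alphabet reading one letter per step, whose transitions add $-1,0,+1$ to each of four non-negative integer counters (runs block if a counter would go negative) but can never test counters for zero; runs start with all counters $0$ and an $\omega$-word is accepted if some run visits an accepting state infinitely often. Such automata have finite descriptions and are effectively enumerated as $\mathcal{P}_z$. $\mathbf{\Sigma}^0_\alpha,\mathbf{\Pi}^0_\alpha$ are the Borel classes of the Cantor topology; $\Pi^1_2$-hardness refers to the analytical hierarchy of subsets of $\mathbb{N}$ (many-one reductions by recursive functions). *)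

theory Defs
  imports "HOL-Analysis.Analysis" "HOL-Library.Nat_Bijection"
begin

datatype recf = RZ | RS | RP nat | RC recf "recf list" | RPr recf recf | RMn recf

inductive reval :: "recf \<Rightarrow> nat list \<Rightarrow> nat \<Rightarrow> bool" where
  zero: "reval RZ xs 0"
| succ: "reval RS (x # xs) (Suc x)"
| proj: "i < length xs \<Longrightarrow> reval (RP i) xs (xs ! i)"
| comp: "length ys = length gs \<Longrightarrow> (\<forall>i<length gs. reval (gs ! i) xs (ys ! i))
          \<Longrightarrow> reval f ys z \<Longrightarrow> reval (RC f gs) xs z"
| pr0: "reval f xs y \<Longrightarrow> reval (RPr f g) (0 # xs) y"
| prS: "reval (RPr f g) (n # xs) y \<Longrightarrow> reval g (n # y # xs) z
          \<Longrightarrow> reval (RPr f g) (Suc n # xs) z"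
| mn: "reval f (n # xs) 0 \<Longrightarrow> (\<forall>m<n. \<exists>y. 0 < y \<and> reval f (m # xs) y)
          \<Longrightarrow> reval (RMn f) xs n"

definition total_recursive :: "(nat \<Rightarrow> nat) \<Rightarrow> bool" where
  "total_recursive f \<longleftrightarrow> (\<exists>c. \<forall>n. reval c [n] (f n))"

text \<open>Number variables are de Bruijn indices; function variables come in two blocks:
  universally quantified ones (FA i) and existentially quantified ones (FE i).\<close>

datatype aterm = TVar nat | TZero | TSuc aterm | TAdd aterm aterm | TMul aterm aterm
  | TFA nat aterm | TFE nat aterm

datatype aform = FEq aterm aterm | FLt aterm aterm | FNot aform | FConj aform aform
  | FDisj aform aform | FEx aform | FAll aform

fun teval :: "(nat \<Rightarrow> nat) \<Rightarrow> (nat \<Rightarrow> nat \<Rightarrow> nat) \<Rightarrow> (nat \<Rightarrow> nat \<Rightarrow> nat) \<Rightarrow> aterm \<Rightarrow> nat" where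
  "teval e F G (TVar i) = e i"
| "teval e F G TZero = 0"
| "teval e F G (TSuc t) = Suc (teval e F G t)"
| "teval e F G (TAdd s t) = teval e F G s + teval e F G t"
| "teval e F G (TMul s t) = teval e F G s * teval e F G t"
| "teval e F G (TFA i t) = F i (teval e F G t)"
| "teval e F G (TFE i t) = G i (teval e F G t)"

definition shift_env :: "nat \<Rightarrow> (nat \<Rightarrow> nat) \<Rightarrow> nat \<Rightarrow> nat" where
  "shift_env m e = (\<lambda>i. if i = 0 then m else e (i - 1))"

fun fsat :: "(nat \<Rightarrow> nat) \<Rightarrow> (nat \<Rightarrow> nat \<Rightarrow> nat) \<Rightarrow> (nat \<Rightarrow> nat \<Rightarrow> nat) \<Rightarrow> aform \<Rightarrow> bool" where
  "fsat e F G (FEq s t) = (teval e F G s = teval e F G t)"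
| "fsat e F G (FLt s t) = (teval e F G s < teval e F G t)"
| "fsat e F G (FNot p) = (\<not> fsat e F G p)"
| "fsat e F G (FConj p q) = (fsat e F G p \<and> fsat e F G q)"
| "fsat e F G (FDisj p q) = (fsat e F G p \<or> fsat e F G q)"
| "fsat e F G (FEx p) = (\<exists>m. fsat (shift_env m e) F G p)"
| "fsat e F G (FAll p) = (\<forall>m. fsat (shift_env m e) F G p)"

definition Pi12 :: "nat set \<Rightarrow> bool" where
  "Pi12 B \<longleftrightarrow> (\<exists>\<phi>. \<forall>n. n \<in> B \<longleftrightarrow>
      (\<forall>F. \<exists>G. fsat (\<lambda>i. if i = 0 then n else 0) F G \<phi>))"

definition many_one_reducible :: "nat set \<Rightarrow> nat set \<Rightarrow> bool" where
  "many_one_reducible B A \<longleftrightarrow> (\<exists>f. total_recursive f \<and> (\<forall>n. n \<in> B \<longleftrightarrow> f n \<in> A))"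

definition Pi12_hard :: "nat set \<Rightarrow> bool" where
  "Pi12_hard A \<longleftrightarrow> (\<forall>B. Pi12 B \<longrightarrow> many_one_reducible B A)"

definition cantor :: "nat \<Rightarrow> (nat \<Rightarrow> nat) topology" where
  "cantor k = product_topology (\<lambda>_::nat. discrete_topology {..<k}) UNIV"

text \<open>Countable ordinals are represented as positions in well-orders on subsets of nat:
  the ordinal of an element a of Field r is the order type of its strict predecessors.\<close>

definition spred :: "(nat \<times> nat) set \<Rightarrow> nat \<Rightarrow> nat set" where
  "spred r a = {b. (b, a) \<in> r \<and> b \<noteq> a}"

text \<open>bsig r k a U: U is in Sigma^0_alpha of the Cantor space over {0..<k}, where alpha >= 1
  is the ordinal of a in r. Sigma^0_1 = open sets; for alpha >= 2 Sigma^0_alpha is the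
  class of countable unions of sets from Pi^0_beta with 1 <= beta < alpha.\<close>

inductive bsig :: "(nat \<times> nat) set \<Rightarrow> nat \<Rightarrow> nat \<Rightarrow> (nat \<Rightarrow> nat) set \<Rightarrow> bool"
  for r :: "(nat \<times> nat) set" and k :: nat where
  base: "a \<in> Field r \<Longrightarrow> spred r a \<noteq> {} \<Longrightarrow> (\<forall>b\<in>spred r a. spred r b = {})
          \<Longrightarrow> openin (cantor k) U \<Longrightarrow> bsig r k a U"
| union: "a \<in> Field r \<Longrightarrow> (\<exists>b\<in>spred r a. spred r b \<noteq> {})
          \<Longrightarrow> (\<forall>n::nat. \<exists>b\<in>spred r a. spred r b \<noteq> {} \<and> A n \<subseteq> topspace (cantor k)
                      \<and> bsig r k b (topspace (cantor k) - A n))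
          \<Longrightarrow> bsig r k a (\<Union>n. A n)"

definition bpi :: "(nat \<times> nat) set \<Rightarrow> nat \<Rightarrow> nat \<Rightarrow> (nat \<Rightarrow> nat) set \<Rightarrow> bool" where
  "bpi r k a U \<longleftrightarrow> U \<subseteq> topspace (cantor k) \<and> bsig r k a (topspace (cantor k) - U)"

definition borel_cantor :: "nat \<Rightarrow> (nat \<Rightarrow> nat) set set" where
  "borel_cantor k = sigma_sets (topspace (cantor k)) {U. openin (cantor k) U}"

text \<open>An automaton: (alphabet size k, initial state, accepting states, transitions).
  Letters are 0..<k, states are natural numbers; a transition (q, b, q', u) reads letter b
  and adds upd u i \<in> {-1,0,1} to counter i (i < 4).\<close>

type_synonym bca = "nat \<times> nat \<times> nat list \<times> (nat \<times> nat \<times> nat \<times> nat) list"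

definition upd :: "nat \<Rightarrow> nat \<Rightarrow> int" where
  "upd u i = int ((u div 3 ^ i) mod 3) - 1"

definition bca_alph :: "bca \<Rightarrow> nat" where
  "bca_alph A = fst A"

definition bca_lang :: "bca \<Rightarrow> (nat \<Rightarrow> nat) set" where
  "bca_lang A = (case A of (k, q0, acc, tr) \<Rightarrow>
     {x \<in> topspace (cantor k). \<exists>(s :: nat \<Rightarrow> nat) (c :: nat \<Rightarrow> nat \<Rightarrow> nat).
        s 0 = q0 \<and> (\<forall>i. c 0 i = 0) \<and>
        (\<forall>n. \<exists>u. (s n, x n, s (Suc n), u) \<in> set tr \<and>
                 (\<forall>i<4. int (c (Suc n) i) = int (c n i) + upd u i)) \<and>
        (\<exists>\<^sub>\<infinity>n. s n \<in> set acc)})"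

definition decode_trans :: "nat \<Rightarrow> nat \<times> nat \<times> nat \<times> nat" where
  "decode_trans t = (case prod_decode t of (q, r) \<Rightarrow> (case prod_decode r of (b, r') \<Rightarrow>
     (case prod_decode r' of (q', u) \<Rightarrow> (q, b, q', u))))"

definition P :: "nat \<Rightarrow> bca" where
  "P z = (case prod_decode z of (k, r1) \<Rightarrow> (case prod_decode r1 of (q0, r2) \<Rightarrow>
     (case prod_decode r2 of (a, r3) \<Rightarrow>
       (k, q0, list_decode a, map decode_trans (list_decode r3)))))"

end

theory Submission
  imports Defs
begin

text \<open>Fix a \<open>\<Pi>\<^sup>1\<^sub>2\<close> set \<open>B\<close>. Tarski's truth conditions and Skolem functions turn the matrix of its definition into
  a finite list of rules, so that \<open>n \<in> B\<close> iff for every \<open>F\<close> the tree of finite sequences has a branch \<open>g\<close> with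
  \<open>g 0 = 1\<close> along which no rule applies. Sequences are numbered so that \<open>t = \<langle>parent of t, last entry of t\<rangle>\<close>.

  The automaton for \<open>n\<close> reads an infinite sequence of records, one per node \<open>t\<close>. A record is a tag followed by \<open>K\<close>
  blocks of length \<open>n + 1 + t\<close> over \<open>{0, 1}\<close>; the number of ones in a block is the value of a field: the parent
  of \<open>t\<close>, its last entry, its level, \<open>t\<close> itself, and a valuation of the variables of a rule. The tag holds a bit, which
  says whether \<open>t\<close> codes an element of the graph of \<open>F\<close>, and either declares \<open>t\<close> alive or names the rule which kills
  \<open>t\<close> under that valuation. One kind of run follows a branch through alive nodes; as it has both
  \<open>c\<close> and \<open>N - c\<close> in its counters it notices when a block has the wrong length, although there is no zero test.
  A block which is too short and all other errors are accepted outright: each of them is a bounded system of inequalities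
  between block contents, which four blind counters can certify.

  Hence an error-free word is accepted iff it is geometrically exact and has an infinite branch of alive nodes. If
  \<open>n \<in> B\<close>, every error-free word has such a branch, and the language is the union of an open and a closed set. If
  \<open>n \<notin> B\<close>, take the graph of a counterexample \<open>F\<close>: below the child \<open>1\<close> of the root all branches can be killed, while below the
  children \<open>\<ge> 2\<close> the word may kill whichever nodes it likes. There an arbitrary tree is embedded, which
  reduces a diagonal analytic set continuously to the language; so the language is not Borel.\<close>

section \<open>Recursive functions\<close>

text \<open>One reduction serves every \<alpha> \<ge> 2 and all three classes, because its outcome
  is a dichotomy: open union closed, hence inside both classes of level 2, or not even Borel. The
  obstacle is that blind counters certify inequalities only. These suffice because only errors have
  to be certified: an equation fails through a strict inequality, and comparing ones bounds a later
  value from above while comparing zeros bounds it from below. The surplus \<open>n + 1\<close> in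
  the block lengths brings in the parameter: it is the number of zeros in the block that holds
  \<open>t\<close>. Since node numbers are pairs, the records double as a table of the pairing
  function, and a rule decodes a pair by pointing to a record; sums and products are answers given
  by the branch. Rules use the bits only positively, so a word whose bits describe a partial
  function is no harder to satisfy than one for a total extension. The children \<ge> 2 of the root
  serve the negative case: below \<open>1\<close> there need not be any branch left, so the
  complexity must come from a part over which the word has full control.\<close>

definition recursive_fn :: "nat \<Rightarrow> (nat list \<Rightarrow> nat) \<Rightarrow> bool" where
  "recursive_fn k f \<longleftrightarrow> (\<exists>c. \<forall>xs. length xs = k \<longrightarrow> reval c xs (f xs))"

lemma total_recursive_iff: "total_recursive f \<longleftrightarrow> recursive_fn 1 (\<lambda>xs. f (xs ! 0))"
proof -
  have "(\<forall>xs. length xs = 1 \<longrightarrow> reval c xs (f (xs ! 0))) \<longleftrightarrow> (\<forall>n. reval c [n] (f n))" for c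
    by (auto simp: length_Suc_conv)
  then show ?thesis by (simp add: total_recursive_def recursive_fn_def)
qed

lemma recursive_fn_proj: "i < k \<Longrightarrow> recursive_fn k (\<lambda>xs. xs ! i)"
  unfolding recursive_fn_def by (rule exI[of _ "RP i"]) (auto intro: reval.proj)

lemma recursive_fn_comp1:
  assumes f: "recursive_fn 1 f" and g: "recursive_fn k g"
  shows "recursive_fn k (\<lambda>xs. f [g xs])"
proof -
  obtain c d where c: "\<forall>xs. length xs = 1 \<longrightarrow> reval c xs (f xs)"
    and d: "\<forall>xs. length xs = k \<longrightarrow> reval d xs (g xs)"
    using f g unfolding recursive_fn_def by auto
  have "reval (RC c [d]) xs (f [g xs])" if "length xs = k" for xs
    by (rule reval.comp[where ys = "[g xs]"]) (use c d that in auto)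
  then show ?thesis unfolding recursive_fn_def by blast
qed

lemma recursive_fn_comp2:
  assumes f: "recursive_fn 2 f" and g: "recursive_fn k g" and h: "recursive_fn k h"
  shows "recursive_fn k (\<lambda>xs. f [g xs, h xs])"
proof -
  obtain c d e where c: "\<forall>xs. length xs = 2 \<longrightarrow> reval c xs (f xs)"
    and d: "\<forall>xs. length xs = k \<longrightarrow> reval d xs (g xs)"
    and e: "\<forall>xs. length xs = k \<longrightarrow> reval e xs (h xs)"
    using f g h unfolding recursive_fn_def by auto
  have "reval (RC c [d, e]) xs (f [g xs, h xs])" if "length xs = k" for xs
    by (rule reval.comp[where ys = "[g xs, h xs]"]) (use c d e that in \<open>auto simp: less_Suc_eq\<close>)
  then show ?thesis unfolding recursive_fn_def by blast
qed

lemma recursive_fn_Suc: "recursive_fn k f \<Longrightarrow> recursive_fn k (\<lambda>xs. Suc (f xs))"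
proof -
  assume f: "recursive_fn k f"
  have "recursive_fn 1 (\<lambda>xs. Suc (xs ! 0))"
    unfolding recursive_fn_def
    by (rule exI[of _ RS]) (auto simp: length_Suc_conv intro: reval.succ)
  from recursive_fn_comp1[OF this f] show ?thesis by simp
qed

lemma recursive_fn_const: "recursive_fn k (\<lambda>xs. m)"
proof (induction m)
  case 0
  show ?case unfolding recursive_fn_def by (rule exI[of _ RZ]) (auto intro: reval.zero)
next
  case (Suc m)
  then show ?case by (rule recursive_fn_Suc)
qed

lemma recursive_fn_primrec:
  assumes f: "recursive_fn k f" and g: "recursive_fn (Suc (Suc k)) g"
    and h0: "\<And>xs. length xs = k \<Longrightarrow> h (0 # xs) = f xs"
    and hS: "\<And>n xs. length xs = k \<Longrightarrow> h (Suc n # xs) = g (n # h (n # xs) # xs)"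
  shows "recursive_fn (Suc k) h"
proof -
  obtain c d where c: "\<forall>xs. length xs = k \<longrightarrow> reval c xs (f xs)"
    and d: "\<forall>xs. length xs = Suc (Suc k) \<longrightarrow> reval d xs (g xs)"
    using f g unfolding recursive_fn_def by auto
  have "reval (RPr c d) (n # xs) (h (n # xs))" if "length xs = k" for n xs
  proof (induction n)
    case 0
    show ?case using c that by (auto intro: reval.pr0 simp: h0)
  next
    case (Suc n)
    show ?case unfolding hS[OF that] by (rule reval.prS[OF Suc]) (use d that in auto)
  qed
  then have "\<forall>xs. length xs = Suc k \<longrightarrow> reval (RPr c d) xs (h xs)"
    by (auto simp: length_Suc_conv)
  then show ?thesis unfolding recursive_fn_def by blast
qed

lemma recursive_fn_add: "recursive_fn k f \<Longrightarrow> recursive_fn k g \<Longrightarrow> recursive_fn k (\<lambda>xs. f xs + g xs)"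
proof -
  have "recursive_fn (Suc 1) (\<lambda>xs. xs ! 0 + xs ! 1)"
    by (rule recursive_fn_primrec[where f = "\<lambda>xs. xs ! 0" and g = "\<lambda>xs. Suc (xs ! 1)"])
      (auto intro: recursive_fn_proj recursive_fn_Suc)
  then have a: "recursive_fn 2 (\<lambda>xs. xs ! 0 + xs ! 1)" by (simp add: numeral_2_eq_2)
  assume f: "recursive_fn k f" and g: "recursive_fn k g"
  from recursive_fn_comp2[OF a f g] show ?thesis by simp
qed

lemma recursive_fn_triangle: "recursive_fn k f \<Longrightarrow> recursive_fn k (\<lambda>xs. triangle (f xs))"
proof -
  have a: "recursive_fn (Suc 0) (\<lambda>xs. triangle (xs ! 0))"
    by (rule recursive_fn_primrec[where f = "\<lambda>xs. 0" and g = "\<lambda>xs. xs ! 1 + Suc (xs ! 0)"])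
      (auto intro!: recursive_fn_const recursive_fn_proj recursive_fn_Suc recursive_fn_add)
  assume f: "recursive_fn k f"
  from recursive_fn_comp1[OF a[folded One_nat_def] f] show ?thesis by simp
qed

lemma recursive_fn_prod_encode:
  "recursive_fn k f \<Longrightarrow> recursive_fn k g \<Longrightarrow> recursive_fn k (\<lambda>xs. prod_encode (f xs, g xs))"
  unfolding prod_encode_def prod.case
  by (intro recursive_fn_add recursive_fn_triangle)

text \<open>Serves the one loop in the code of the automaton: a parameter-free iteration that
  prepends a transition to a coded list in each round.\<close>

lemma recursive_fn_rec_nat:
  assumes "recursive_fn 2 (\<lambda>xs. g (xs ! 0) (xs ! 1))" and "recursive_fn k f"
  shows "recursive_fn k (\<lambda>xs. rec_nat a g (f xs))"
proof -
  have "recursive_fn (Suc 0) (\<lambda>xs. rec_nat a g (xs ! 0))"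
    by (rule recursive_fn_primrec[where f = "\<lambda>xs. a" and g = "\<lambda>xs. g (xs ! 0) (xs ! 1)"])
      (use assms in \<open>auto intro!: recursive_fn_const simp: numeral_2_eq_2\<close>)
  from recursive_fn_comp1[OF this[folded One_nat_def] assms(2)] show ?thesis by simp
qed

lemmas recursive_fn_intros = recursive_fn_proj recursive_fn_const recursive_fn_Suc recursive_fn_add
  recursive_fn_prod_encode recursive_fn_rec_nat

section \<open>Borel and analytic sets of infinite words\<close>

lemma topspace_cantor: "topspace (cantor k) = {x. \<forall>i. x i < k}"
  by (auto simp: cantor_def PiE_def)

lemma openin_cylinder:
  assumes "x \<in> topspace (cantor k)"
  shows "openin (cantor k) {y \<in> topspace (cantor k). \<forall>i<p. y i = x i}"
proof -
  let ?X = "\<lambda>i. if i < p then {x i} else {..<k}"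
  have "openin (cantor k) (PiE UNIV ?X)"
    unfolding cantor_def
  proof (rule product_topology_basis)
    show "openin (discrete_topology {..<k}) (?X i)" for i
      using assms by (auto simp: topspace_cantor)
    have "{i. ?X i \<noteq> topspace (discrete_topology {..<k})} \<subseteq> {..<p}" by auto
    then show "finite {i. ?X i \<noteq> topspace (discrete_topology {..<k})}"
      using finite_subset by blast
  qed
  also have "PiE UNIV ?X = {y \<in> topspace (cantor k). \<forall>i<p. y i = x i}"
    using assms by (auto simp: topspace_cantor PiE_def Pi_def split: if_splits)
  finally show ?thesis .
qed

text \<open>Openness in terms of finite prefixes, the form in which open sets are handled from here
  on.\<close>

lemma openin_cantor_iff:
  "openin (cantor k) U \<longleftrightarrow> U \<subseteq> topspace (cantor k) \<and>
     (\<forall>x\<in>U. \<exists>p. \<forall>y\<in>topspace (cantor k). (\<forall>i<p. y i = x i) \<longrightarrow> y \<in> U)"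
proof (intro iffI conjI ballI)
  assume U: "openin (cantor k) U"
  then show "U \<subseteq> topspace (cantor k)" by (rule openin_subset)
  fix x assume x: "x \<in> U"
  obtain X where X: "x \<in> PiE UNIV X" "finite {i. X i \<noteq> topspace (discrete_topology {..<k})}"
      "PiE UNIV X \<subseteq> U"
    using product_topology_open_contains_basis[OF U[unfolded cantor_def] x] by auto
  obtain p where p: "\<forall>i\<in>{i. X i \<noteq> topspace (discrete_topology {..<k})}. i < p"
    using X(2) finite_nat_set_iff_bounded by blast
  have "y \<in> U" if y: "y \<in> topspace (cantor k)" and a: "\<forall>i<p. y i = x i" for y
  proof -
    have "y i \<in> X i" for i
    proof (cases "i < p")
      case True
      then show ?thesis using a X(1) by (simp add: PiE_def Pi_def)
    next
      case False
      then have "X i = {..<k}" using p by auto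
      then show ?thesis using y by (simp add: topspace_cantor)
    qed
    then show ?thesis using X(3) by (auto simp: PiE_def Pi_def)
  qed
  then show "\<exists>p. \<forall>y\<in>topspace (cantor k). (\<forall>i<p. y i = x i) \<longrightarrow> y \<in> U" by blast
next
  assume U: "U \<subseteq> topspace (cantor k) \<and>
     (\<forall>x\<in>U. \<exists>p. \<forall>y\<in>topspace (cantor k). (\<forall>i<p. y i = x i) \<longrightarrow> y \<in> U)"
  show "openin (cantor k) U"
  proof (subst openin_subopen, intro ballI)
    fix x assume x: "x \<in> U"
    with U obtain p where p: "\<forall>y\<in>topspace (cantor k). (\<forall>i<p. y i = x i) \<longrightarrow> y \<in> U" by blast
    have "x \<in> topspace (cantor k)" using U x by blast
    then show "\<exists>T. openin (cantor k) T \<and> x \<in> T \<and> T \<subseteq> U"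
      by (intro exI[of _ "{y \<in> topspace (cantor k). \<forall>i<p. y i = x i}"])
        (use p openin_cylinder in auto)
  qed
qed

text \<open>Open sets sit at the ordinal 1, and the union rule admits complements from every smaller
  ordinal that is at least 1; so a countable union of closed sets is reached in one step, for all
  \<alpha> \<ge> 2 alike.\<close>

lemma bsig_Fsigma:
  assumes "Well_order r" "a \<in> Field r" "\<exists>b\<in>spred r a. spred r b \<noteq> {}"
    and A: "\<And>n::nat. A n \<subseteq> topspace (cantor k)" "\<And>n. openin (cantor k) (topspace (cantor k) - A n)"
  shows "bsig r k a (\<Union>n. A n)"
proof -
  have wf: "wf (r - Id)" and tr: "trans r"
    using assms(1) by (auto simp: order_on_defs)
  have anti: "antisym r" using assms(1) by (auto simp: order_on_defs)
  define S where "S = {b. b \<in> spred r a \<and> spred r b \<noteq> {}}"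
  have S: "b \<in> S \<longleftrightarrow> b \<in> spred r a \<and> spred r b \<noteq> {}" for b by (simp add: S_def)
  obtain b0 where b0: "b0 \<in> S" using assms(3) S by blast
  \<comment> \<open>The least predecessor of \<open>a\<close> that has predecessors itself is the
    ordinal 1: anything below it has none.\<close>
  from wf[unfolded wf_eq_minimal, THEN spec, THEN spec, THEN mp, OF b0]
  obtain b where "b \<in> S" and min': "\<forall>c. (c, b) \<in> r - Id \<longrightarrow> c \<notin> S" by (elim bexE)
  then have b: "b \<in> spred r a \<and> spred r b \<noteq> {}" using S by blast
  have min: "c \<notin> spred r a \<or> spred r c = {}" if "(c, b) \<in> r - Id" for c
    using min' that S by blast
  have one: "spred r c = {}" if c: "c \<in> spred r b" for c
  proof -
    have "c \<in> spred r a"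
    proof -
      have cb: "(c, b) \<in> r" "c \<noteq> b" and ba: "(b, a) \<in> r"
        using c b by (simp_all add: spred_def)
      have "c \<noteq> a" using antisymD[OF anti cb(1)] cb(2) ba by blast
      then show ?thesis using transD[OF tr cb(1) ba] by (simp add: spred_def)
    qed
    moreover have "(c, b) \<in> r - Id" using c by (simp add: spred_def)
    ultimately show ?thesis using min by blast
  qed
  have "b \<in> Field r" using b by (auto simp: spred_def Field_def)
  then have "bsig r k b (topspace (cantor k) - A n)" for n
    using b one A(2) by (intro bsig.base) blast+
  then show ?thesis
    using assms(2,3) b A(1) by (intro bsig.union) blast+
qed

lemma bsig_imp_borel: "bsig r k a U \<Longrightarrow> U \<in> borel_cantor k"
proof (induction rule: bsig.induct)
  case (base a U)
  then show ?case by (auto simp: borel_cantor_def)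
next
  case (union a A)
  have "A n \<in> borel_cantor k" for n
  proof -
    have "A n \<subseteq> topspace (cantor k)" "topspace (cantor k) - A n \<in> borel_cantor k"
      using union by blast+
    moreover from this(2) have "topspace (cantor k) - (topspace (cantor k) - A n) \<in> borel_cantor k"
      unfolding borel_cantor_def by (rule sigma_sets.Compl)
    ultimately show ?thesis by (simp add: double_diff)
  qed
  then show ?case unfolding borel_cantor_def by (rule sigma_sets.Union)
qed

lemma bpi_imp_borel:
  assumes "bpi r k a U" shows "U \<in> borel_cantor k"
proof -
  have "U \<subseteq> topspace (cantor k)" "topspace (cantor k) - U \<in> borel_cantor k"
    using assms by (auto simp: bpi_def intro: bsig_imp_borel)
  moreover from this(2) have "topspace (cantor k) - (topspace (cantor k) - U) \<in> borel_cantor k"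
    unfolding borel_cantor_def by (rule sigma_sets.Compl)
  ultimately show ?thesis by (simp add: double_diff)
qed

section \<open>Analytic sets as projections of trees, and a diagonal set that is not Borel\<close>

definition analytic :: "(nat \<Rightarrow> nat) set \<Rightarrow> bool" where
  "analytic A \<longleftrightarrow> (\<exists>Q. A = {x \<in> topspace (cantor 2).
     \<exists>g. \<forall>k. Q (map x [0..<k]) (map (g :: nat \<Rightarrow> nat) [0..<k])})"

lemma analyticI:
  assumes "A \<subseteq> topspace (cantor 2)"
    and "\<And>x. x \<in> topspace (cantor 2) \<Longrightarrow>
      x \<in> A \<longleftrightarrow> (\<exists>g. \<forall>k. Q (map x [0..<k]) (map (g :: nat \<Rightarrow> nat) [0..<k]))"
  shows "analytic A"
  unfolding analytic_def by (rule exI[of _ Q]) (use assms in blast)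

lemma all_nat_iff_all_Suc: "Q 0 \<Longrightarrow> (\<forall>k. Q k) \<longleftrightarrow> (\<forall>k. Q (Suc k))"
  by (metis not0_implies_Suc)

text \<open>The first entry of the witness names the index and its tail is a witness for that set.
  The prefix of \<open>x\<close> loses its last letter so that both prefixes have the same length
  again.\<close>

lemma analytic_UN:
  assumes "\<And>i::nat. analytic (A i)"
  shows "analytic (\<Union>i. A i)"
proof -
  have "\<forall>i. \<exists>Q. A i = {x \<in> topspace (cantor 2).
     \<exists>g. \<forall>k. Q (map x [0..<k]) (map (g :: nat \<Rightarrow> nat) [0..<k])}"
    using assms unfolding analytic_def by blast
  from choice[OF this] obtain Q where Q: "\<And>i. A i = {x \<in> topspace (cantor 2).
     \<exists>g. \<forall>k. Q i (map x [0..<k]) (map (g :: nat \<Rightarrow> nat) [0..<k])}"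
    by blast
  let ?R = "\<lambda>xs gs. gs = [] \<or> Q (hd gs) (butlast xs) (tl gs)"
  have R: "(\<forall>k. ?R (map x [0..<k]) (map g [0..<k])) \<longleftrightarrow>
      (\<forall>k. Q (g 0) (map x [0..<k]) (map (g \<circ> Suc) [0..<k]))" (is "?L \<longleftrightarrow> ?R'") for x g
  proof -
    have "?L \<longleftrightarrow> (\<forall>k. ?R (map x [0..<Suc k]) (map g [0..<Suc k]))"
      by (rule all_nat_iff_all_Suc) simp
    also have "\<dots> \<longleftrightarrow> ?R'"
    proof -
      have "map g [0..<Suc k] = g 0 # map (g \<circ> Suc) [0..<k]" for k
        by (simp only: map_upt_Suc) (simp add: comp_def)
      moreover have "butlast (map x [0..<Suc k]) = map x [0..<k]" for k by simp
      ultimately show ?thesis by (simp only: list.sel list.distinct simp_thms)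
    qed
    finally show ?thesis .
  qed
  show ?thesis
  proof (rule analyticI[where Q = ?R])
    show "(\<Union>i. A i) \<subseteq> topspace (cantor 2)" using Q by auto
    fix x assume x: "x \<in> topspace (cantor 2)"
    show "x \<in> (\<Union>i. A i) \<longleftrightarrow> (\<exists>g. \<forall>k. ?R (map x [0..<k]) (map g [0..<k]))"
      unfolding R
    proof
      assume "x \<in> (\<Union>i. A i)"
      then obtain i g where g: "\<forall>k. Q i (map x [0..<k]) (map g [0..<k])" using Q by auto
      show "\<exists>g. \<forall>k. Q (g 0) (map x [0..<k]) (map (g \<circ> Suc) [0..<k])"
        by (rule exI[of _ "case_nat i g"]) (use g in \<open>simp add: comp_def\<close>)
    next
      assume "\<exists>g. \<forall>k. Q (g 0) (map x [0..<k]) (map (g \<circ> Suc) [0..<k])"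
      then show "x \<in> (\<Union>i. A i)" using Q x by blast
    qed
  qed
qed

text \<open>Countably many witnesses are interleaved through the pairing function. At a finite stage
  only those conditions are imposed for which all required entries are already present.\<close>

lemma analytic_INT:
  assumes "\<And>i::nat. analytic (A i)"
  shows "analytic (\<Inter>i. A i)"
proof -
  have "\<forall>i. \<exists>Q. A i = {x \<in> topspace (cantor 2).
     \<exists>g. \<forall>k. Q (map x [0..<k]) (map (g :: nat \<Rightarrow> nat) [0..<k])}"
    using assms unfolding analytic_def by blast
  from choice[OF this] obtain Q where Q: "\<And>i. A i = {x \<in> topspace (cantor 2).
     \<exists>g. \<forall>k. Q i (map x [0..<k]) (map (g :: nat \<Rightarrow> nat) [0..<k])}"
    by blast
  let ?R = "\<lambda>xs gs. \<forall>i k. k \<le> length xs \<and> (\<forall>j<k. prod_encode (i, j) < length gs) \<longrightarrow>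
     Q i (take k xs) (map (\<lambda>j. gs ! prod_encode (i, j)) [0..<k])"
  have R: "(\<forall>k. ?R (map x [0..<k]) (map g [0..<k])) \<longleftrightarrow>
      (\<forall>i k. Q i (map x [0..<k]) (map (\<lambda>j. g (prod_encode (i, j))) [0..<k]))"
    (is "?L \<longleftrightarrow> ?R'") for x g
  proof
    assume L: ?L
    show ?R'
    proof (intro allI)
      fix i k
      \<comment> \<open>A stage late enough for the condition on \<open>i\<close> and
        \<open>k\<close>: the sum dominates every position it consults.\<close>
      define m where "m = k + Suc (\<Sum>j<k. prod_encode (i, j))"
      have m: "prod_encode (i, j) < m" if "j < k" for j
        using member_le_sum[of j "{..<k}" "\<lambda>j. prod_encode (i, j)"] that by (simp add: m_def)
      have km: "k \<le> m" by (simp add: m_def)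
      have "Q i (take k (map x [0..<m])) (map (\<lambda>j. map g [0..<m] ! prod_encode (i, j)) [0..<k])"
        using L[THEN spec[of _ m], THEN spec[of _ i], THEN spec[of _ k]] m km by simp
      moreover have "take k (map x [0..<m]) = map x [0..<k]" using km by (simp add: take_map)
      moreover have "map (\<lambda>j. map g [0..<m] ! prod_encode (i, j)) [0..<k]
          = map (\<lambda>j. g (prod_encode (i, j))) [0..<k]" using m by simp
      ultimately show "Q i (map x [0..<k]) (map (\<lambda>j. g (prod_encode (i, j))) [0..<k])" by simp
    qed
  next
    assume R: ?R'
    show ?L
    proof (intro allI impI)
      fix m i k
      assume a: "k \<le> length (map x [0..<m]) \<and> (\<forall>j<k. prod_encode (i, j) < length (map g [0..<m]))"
      then have "take k (map x [0..<m]) = map x [0..<k]" by (simp add: take_map)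
      moreover have "map (\<lambda>j. map g [0..<m] ! prod_encode (i, j)) [0..<k]
          = map (\<lambda>j. g (prod_encode (i, j))) [0..<k]" using a by simp
      ultimately show "Q i (take k (map x [0..<m])) (map (\<lambda>j. map g [0..<m] ! prod_encode (i, j)) [0..<k])"
        by (simp only: R)
    qed
  qed
  show ?thesis
  proof (rule analyticI[where Q = ?R])
    show "(\<Inter>i. A i) \<subseteq> topspace (cantor 2)" using Q by auto
    fix x assume x: "x \<in> topspace (cantor 2)"
    show "x \<in> (\<Inter>i. A i) \<longleftrightarrow> (\<exists>g. \<forall>k. ?R (map x [0..<k]) (map g [0..<k]))"
      unfolding R
    proof
      assume "x \<in> (\<Inter>i. A i)"
      then have "\<forall>i. \<exists>g. \<forall>k. Q i (map x [0..<k]) (map g [0..<k])" using Q by auto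
      from choice[OF this] obtain g where g: "\<And>i k. Q i (map x [0..<k]) (map (g i) [0..<k])"
        by blast
      show "\<exists>g. \<forall>i k. Q i (map x [0..<k]) (map (\<lambda>j. g (prod_encode (i, j))) [0..<k])"
        by (rule exI[of _ "\<lambda>z. g (fst (prod_decode z)) (snd (prod_decode z))"]) (use g in simp)
    next
      assume "\<exists>g. \<forall>i k. Q i (map x [0..<k]) (map (\<lambda>j. g (prod_encode (i, j))) [0..<k])"
      then show "x \<in> (\<Inter>i. A i)" using Q x by blast
    qed
  qed
qed

text \<open>For the open set the witness guesses the length of a cylinder contained in it, and
  shorter prefixes impose nothing. For the complement the tree alone decides: no prefix may force
  membership in \<open>U\<close>.\<close>

lemma analytic_open:
  assumes "openin (cantor 2) U"
  shows "analytic U" "analytic (topspace (cantor 2) - U)"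
proof -
  let ?X = "topspace (cantor 2)"
  let ?C = "\<lambda>p xs. \<forall>y\<in>?X. map y [0..<p] = take p xs \<longrightarrow> y \<in> U"
  have C: "?C p (map x [0..<k]) \<longleftrightarrow> (\<forall>y\<in>?X. (\<forall>i<p. y i = x i) \<longrightarrow> y \<in> U)"
    if "p \<le> k" for p x k
    using that by (simp add: take_map Ball_def)
  have U: "U \<subseteq> ?X" "\<And>x. x \<in> U \<Longrightarrow> \<exists>p. \<forall>y\<in>?X. (\<forall>i<p. y i = x i) \<longrightarrow> y \<in> U"
    using assms unfolding openin_cantor_iff by blast+
  show "analytic U"
  proof (rule analyticI[where Q = "\<lambda>xs gs. gs = [] \<or> length xs < hd gs \<or> ?C (hd gs) xs"])
    fix x assume x: "x \<in> ?X"
    show "x \<in> U \<longleftrightarrow> (\<exists>g. \<forall>k. map g [0..<k] = [] \<or> length (map x [0..<k]) < hd (map g [0..<k])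
        \<or> ?C (hd (map g [0..<k])) (map x [0..<k]))"
    proof
      assume "x \<in> U"
      then obtain p where p: "\<forall>y\<in>?X. (\<forall>i<p. y i = x i) \<longrightarrow> y \<in> U" using U by blast
      show "\<exists>g. \<forall>k. map g [0..<k] = [] \<or> length (map x [0..<k]) < hd (map g [0..<k])
        \<or> ?C (hd (map g [0..<k])) (map x [0..<k])"
      proof (rule exI[of _ "\<lambda>_. p"], rule allI)
        fix k
        have "hd (map (\<lambda>_. p) [0..<k]) = p" if "k \<noteq> 0" using that by (simp add: hd_map)
        then show "map (\<lambda>_. p) [0..<k] = [] \<or> length (map x [0..<k]) < hd (map (\<lambda>_. p) [0..<k])
           \<or> ?C (hd (map (\<lambda>_. p) [0..<k])) (map x [0..<k])"
          using C[of p k x] p by (cases "k = 0"; cases "k < p") auto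
      qed
    next
      assume "\<exists>g. \<forall>k. map g [0..<k] = [] \<or> length (map x [0..<k]) < hd (map g [0..<k])
        \<or> ?C (hd (map g [0..<k])) (map x [0..<k])"
      then obtain g where g: "\<And>k. map g [0..<k] = [] \<or> length (map x [0..<k]) < hd (map g [0..<k])
        \<or> ?C (hd (map g [0..<k])) (map x [0..<k])" by blast
      have h: "hd (map g [0..<Suc (g 0)]) = g 0" by (simp add: hd_map upt_rec)
      have "?C (g 0) (map x [0..<Suc (g 0)])" using g[of "Suc (g 0)"] unfolding h by auto
      then show "x \<in> U" using C[of "g 0" "Suc (g 0)" x] x by simp
    qed
  qed (fact U(1))
  show "analytic (?X - U)"
  proof (rule analyticI[where Q = "\<lambda>xs gs. \<not> ?C (length xs) xs"])
    fix x assume x: "x \<in> ?X"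
    have "x \<in> U \<longleftrightarrow> (\<exists>k. ?C (length (map x [0..<k])) (map x [0..<k]))"
      using C[of k k x for k] U(2)[of x] x by auto
    then show "x \<in> ?X - U \<longleftrightarrow> (\<exists>g::nat \<Rightarrow> nat. \<forall>k. \<not> ?C (length (map x [0..<k])) (map x [0..<k]))"
      using x by blast
  qed auto
qed

text \<open>Carrying a set and its complement together makes complementation trivial and turns the
  complement of a union into an intersection.\<close>

lemma borel_imp_analytic:
  assumes "A \<in> borel_cantor 2"
  shows "analytic A \<and> analytic (topspace (cantor 2) - A)"
  using assms unfolding borel_cantor_def
proof (induction rule: sigma_sets.induct)
  case (Basic a)
  then show ?case using analytic_open by blast
next
  case Empty
  then show ?case using analytic_open[of "{}"] by simp
next
  case (Compl a)
  have "a \<subseteq> topspace (cantor 2)" using Compl by (auto simp: analytic_def)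
  then show ?case using Compl by (simp add: double_diff)
next
  case (Union a)
  have "topspace (cantor 2) - \<Union> (range a) = (\<Inter>i. topspace (cantor 2) - a i)" by auto
  then show ?case using Union analytic_UN[of a] analytic_INT[of "\<lambda>i. topspace (cantor 2) - a i"] by simp
qed

text \<open>\<open>x\<close> is read as the code of a tree on pairs of finite sequences and is
  tested against the very set that this tree projects to.\<close>

definition diagonal_analytic :: "(nat \<Rightarrow> nat) set" where
  "diagonal_analytic = {x \<in> topspace (cantor 2).
     \<exists>g. \<forall>k. x (prod_encode (list_encode (map x [0..<k]), list_encode (map g [0..<k]))) = 1}"

text \<open>Cantor's diagonal argument: if the complement were analytic through \<open>Q\<close>,
  the point coding \<open>Q\<close> would lie in the set iff it lies in the complement.\<close>

lemma diagonal_analytic_not_borel: "diagonal_analytic \<notin> borel_cantor 2"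
proof
  assume "diagonal_analytic \<in> borel_cantor 2"
  then have "analytic (topspace (cantor 2) - diagonal_analytic)"
    using borel_imp_analytic by blast
  then obtain Q where Q: "topspace (cantor 2) - diagonal_analytic = {x \<in> topspace (cantor 2).
     \<exists>g. \<forall>k. Q (map x [0..<k]) (map (g :: nat \<Rightarrow> nat) [0..<k])}"
    unfolding analytic_def by blast
  define x :: "nat \<Rightarrow> nat" where "x z = (case prod_decode z of (a, b) \<Rightarrow>
      if Q (list_decode a) (list_decode b) then 1 else 0)" for z
  have x: "x \<in> topspace (cantor 2)" by (auto simp: topspace_cantor x_def split: prod.split)
  have "x (prod_encode (list_encode xs, list_encode gs)) = 1 \<longleftrightarrow> Q xs gs" for xs gs
    by (simp add: x_def)
  then have "x \<in> diagonal_analytic \<longleftrightarrow> x \<in> topspace (cantor 2) - diagonal_analytic"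
    unfolding Q using x by (simp add: diagonal_analytic_def)
  then show False using x by blast
qed

text \<open>Continuous preimages of Borel sets are Borel. Continuity is asked letter by letter, each
  letter of the image depending on a finite prefix of the argument.\<close>

lemma not_borel_if_diagonal_reducible:
  assumes val: "\<And>x. x \<in> topspace (cantor 2) \<Longrightarrow> \<Phi> x \<in> topspace (cantor k)"
    and cont: "\<And>x p. x \<in> topspace (cantor 2) \<Longrightarrow>
      \<exists>q. \<forall>y\<in>topspace (cantor 2). (\<forall>i<q. y i = x i) \<longrightarrow> \<Phi> y p = \<Phi> x p"
    and red: "\<And>x. x \<in> topspace (cantor 2) \<Longrightarrow> \<Phi> x \<in> L \<longleftrightarrow> x \<in> diagonal_analytic"
  shows "L \<notin> borel_cantor k"
proof
  assume L: "L \<in> borel_cantor k"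
  have "continuous_map (cantor 2) (discrete_topology {..<k}) (\<lambda>x. \<Phi> x p)" for p
    unfolding continuous_map_def
  proof (intro conjI allI impI)
    show "(\<lambda>x. \<Phi> x p) \<in> topspace (cantor 2) \<rightarrow> topspace (discrete_topology {..<k})"
      using val by (auto simp: topspace_cantor)
    fix U
    show "openin (cantor 2) {x \<in> topspace (cantor 2). \<Phi> x p \<in> U}"
      unfolding openin_cantor_iff
    proof (intro conjI ballI)
      fix x assume x: "x \<in> {x \<in> topspace (cantor 2). \<Phi> x p \<in> U}"
      then obtain q where q: "\<And>y. y \<in> topspace (cantor 2) \<Longrightarrow> (\<forall>i<q. y i = x i) \<Longrightarrow> \<Phi> y p = \<Phi> x p"
        using cont[of x p] by blast
      have "\<Phi> x p \<in> U" using x by blast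
      then show "\<exists>q. \<forall>y\<in>topspace (cantor 2). (\<forall>i<q. y i = x i) \<longrightarrow>
          y \<in> {x \<in> topspace (cantor 2). \<Phi> x p \<in> U}"
        using q by (intro exI[of _ q] ballI impI CollectI conjI) metis+
    qed auto
  qed
  then have c: "continuous_map (cantor 2) (cantor k) \<Phi>"
    unfolding cantor_def[of k] by (auto simp: continuous_map_componentwise_UNIV)
  have pre: "{x \<in> topspace (cantor 2). \<Phi> x \<in> B} \<in> borel_cantor 2" if "B \<in> borel_cantor k" for B
    using that unfolding borel_cantor_def
  proof (induction rule: sigma_sets.induct)
    case (Basic a)
    then show ?case using openin_continuous_map_preimage[OF c] by (auto intro: sigma_sets.Basic)
  next
    case Empty
    then show ?case by (simp add: sigma_sets.Empty)
  next
    case (Compl a)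
    have "{x \<in> topspace (cantor 2). \<Phi> x \<in> topspace (cantor k) - a}
        = topspace (cantor 2) - {x \<in> topspace (cantor 2). \<Phi> x \<in> a}" using val by auto
    then show ?case using sigma_sets.Compl[OF Compl.IH] by simp
  next
    case (Union a)
    have "{x \<in> topspace (cantor 2). \<Phi> x \<in> \<Union> (range a)}
        = (\<Union>i. {x \<in> topspace (cantor 2). \<Phi> x \<in> a i})" by auto
    then show ?case using sigma_sets.Union[OF Union.IH] by simp
  qed
  have "{x \<in> topspace (cantor 2). \<Phi> x \<in> L} = diagonal_analytic"
    using red by (auto simp: diagonal_analytic_def)
  then show False using pre[OF L] diagonal_analytic_not_borel by simp
qed

section \<open>Branches and rules\<close>

definition ptl :: "nat \<Rightarrow> nat" where "ptl t = fst (prod_decode t)"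
definition phd :: "nat \<Rightarrow> nat" where "phd t = snd (prod_decode t)"

lemma ptl_prod_encode [simp]: "ptl (prod_encode (a, b)) = a" by (simp add: ptl_def)
lemma phd_prod_encode [simp]: "phd (prod_encode (a, b)) = b" by (simp add: phd_def)
lemma prod_encode_ptl_phd [simp]: "prod_encode (ptl t, phd t) = t" by (simp add: ptl_def phd_def)
lemma prod_encode_0_0 [simp]: "prod_encode (0, 0) = 0" by (simp add: prod_encode_def)
lemma ptl_0 [simp]: "ptl 0 = 0" and phd_0 [simp]: "phd 0 = 0"
  by (metis prod_encode_0_0 ptl_prod_encode, metis prod_encode_0_0 phd_prod_encode)

lemma prod_encode_eq_0_iff [simp]: "prod_encode (a, b) = 0 \<longleftrightarrow> a = 0 \<and> b = 0"
  by (metis prod_encode_0_0 ptl_0 phd_0 ptl_prod_encode phd_prod_encode)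

lemma less_prod_encode_1: "0 < prod_encode (a, b) \<Longrightarrow> a < prod_encode (a, b)"
proof -
  assume "0 < prod_encode (a, b)"
  then have "0 < a + b" by (cases "a = 0 \<and> b = 0") auto
  then have "0 < triangle (a + b)" by (cases "a + b") auto
  then show ?thesis by (simp add: prod_encode_def)
qed

text \<open>Records are ordered by node number, so a parent is recorded before its children. Only
  the root, the pair of \<open>0\<close> and \<open>0\<close>, is its own parent.\<close>

lemma ptl_less: "0 < t \<Longrightarrow> ptl t < t"
  using less_prod_encode_1[of "ptl t" "phd t"] by simp

lemma phd_le: "phd t \<le> t"
  using le_prod_encode_2[of "phd t" "ptl t"] by simp

function lev :: "nat \<Rightarrow> nat" where
  "lev t = (if t = 0 then 0 else Suc (lev (ptl t)))"
  by auto
termination by (relation less_than) (auto simp: ptl_less)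
declare lev.simps [simp del]

lemma lev_0 [simp]: "lev 0 = 0" by (simp add: lev.simps)
lemma lev_pos: "0 < t \<Longrightarrow> lev t = Suc (lev (ptl t))" by (subst lev.simps) simp
lemma lev_le: "lev t \<le> t"
proof (induction t rule: less_induct)
  case (less t)
  then show ?case using ptl_less[of t] by (cases "t = 0") (fastforce simp: lev_pos)+
qed

function anc :: "nat \<Rightarrow> nat set" where
  "anc t = (if t = 0 then {} else insert (ptl t) (anc (ptl t)))"
  by auto
termination by (relation less_than) (auto simp: ptl_less)
declare anc.simps [simp del]

lemma anc_0 [simp]: "anc 0 = {}" by (simp add: anc.simps)
lemma anc_pos: "0 < t \<Longrightarrow> anc t = insert (ptl t) (anc (ptl t))" by (subst anc.simps) simp

lemma anc_less: "s \<in> anc t \<Longrightarrow> s < t"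
proof (induction t rule: less_induct)
  case (less t)
  then have "0 < t" by (cases "t = 0") auto
  then show ?case using less ptl_less[of t] by (fastforce simp: anc_pos)
qed

text \<open>A first entry \<open>0\<close> would lead from the root back to the root. Hence the
  recurring condition \<open>0 < g 0\<close>, under which \<open>code g\<close> is strictly
  increasing and levels identify the nodes of a branch.\<close>

primrec code :: "(nat \<Rightarrow> nat) \<Rightarrow> nat \<Rightarrow> nat" where
  "code g 0 = 0"
| "code g (Suc k) = prod_encode (code g k, g k)"

lemma code_Suc_pos: "0 < g 0 \<Longrightarrow> 0 < code g (Suc k)"
  by (induction k) (auto simp: neq0_conv[symmetric] simp del: neq0_conv)

lemma strict_mono_code: "0 < g 0 \<Longrightarrow> strict_mono (code g)"
  by (rule strict_mono_Suc_iff[THEN iffD2])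
    (use code_Suc_pos less_prod_encode_1 in fastforce)

lemma lev_code: "0 < g 0 \<Longrightarrow> lev (code g k) = k"
proof (induction k)
  case (Suc k)
  then show ?case using code_Suc_pos[of g k] by (simp add: lev_pos)
qed simp

lemma anc_code: "0 < g 0 \<Longrightarrow> anc (code g k) = code g ` {..<k}"
proof (induction k)
  case (Suc k)
  then show ?case using code_Suc_pos[of g k] by (simp add: anc_pos lessThan_Suc)
qed simp

lemma ptl_code [simp]: "ptl (code g (Suc k)) = code g k"
  and phd_code [simp]: "phd (code g (Suc k)) = g k"
  by simp_all

declare code.simps(2) [simp del]

definition fld :: "nat \<Rightarrow> nat \<Rightarrow> nat" where
  "fld j t = (if j = 0 then ptl t else if j = 1 then phd t else lev t)"

section \<open>Atoms: the primitive conditions that a record can claim\<close>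

datatype atom = AZero nat | ASuc nat nat | ALt nat nat | AN nat | AFld nat nat nat | ABit nat | AAnc nat

text \<open>The pointers dereferenced by an atom must lie in \<open>Q\<close>; \<open>A\<close> is the set of
  nodes on the branch.\<close>

primrec holds :: "nat \<Rightarrow> nat set \<Rightarrow> nat set \<Rightarrow> nat set \<Rightarrow> (nat \<Rightarrow> nat) \<Rightarrow> atom \<Rightarrow> bool" where
  "holds n R Q A v (AZero a) = (v a = 0)"
| "holds n R Q A v (ASuc a b) = (v b = Suc (v a))"
| "holds n R Q A v (ALt a b) = (v a < v b)"
| "holds n R Q A v (AN a) = (v a = Suc n)"
| "holds n R Q A v (AFld j a b) = (v a \<in> Q \<and> fld j (v a) = v b)"
| "holds n R Q A v (ABit a) = (v a \<in> Q \<and> v a \<in> R)"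
| "holds n R Q A v (AAnc a) = (v a \<in> A)"

primrec avars :: "atom \<Rightarrow> nat set" where
  "avars (AZero a) = {a}"
| "avars (ASuc a b) = {a, b}"
| "avars (ALt a b) = {a, b}"
| "avars (AN a) = {a}"
| "avars (AFld j a b) = {a, b}"
| "avars (ABit a) = {a}"
| "avars (AAnc a) = {a}"

lemma finite_avars: "finite (avars x)" by (cases x) auto

lemma holds_cong: "(\<And>a. a \<in> avars x \<Longrightarrow> v a = v' a) \<Longrightarrow> holds n R Q A v x = holds n R Q A v' x"
  by (cases x) auto

text \<open>The parameters \<open>Q\<close> and \<open>A\<close> allow two readings of a rule: at a
  single record \<open>t\<close>, with earlier records and proper ancestors, and in the limit along
  an infinite branch, with all nodes and the whole branch.\<close>

definition matches :: "atom list list \<Rightarrow> nat \<Rightarrow> nat set \<Rightarrow> nat set \<Rightarrow> nat set \<Rightarrow> bool" where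
  "matches rs n R Q A \<longleftrightarrow> (\<exists>r\<in>set rs. \<exists>v. \<forall>a\<in>set r. holds n R Q A v a)"

section \<open>Compilation of patterns with pairs into atoms\<close>

datatype pat = V nat | Zp | Sp pat | Cp pat pat

primrec peval :: "(nat \<Rightarrow> nat) \<Rightarrow> pat \<Rightarrow> nat" where
  "peval u (V x) = u x"
| "peval u Zp = 0"
| "peval u (Sp p) = Suc (peval u p)"
| "peval u (Cp p q) = prod_encode (peval u p, peval u q)"

primrec pvars :: "pat \<Rightarrow> nat set" where
  "pvars (V x) = {x}"
| "pvars Zp = {}"
| "pvars (Sp p) = pvars p"
| "pvars (Cp p q) = pvars p \<union> pvars q"

lemma peval_cong: "(\<And>x. x \<in> pvars p \<Longrightarrow> u x = u' x) \<Longrightarrow> peval u p = peval u' p"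
  by (induction p) auto

text \<open>\<open>flat p k\<close> yields atoms with fresh variables from \<open>k\<close> on, the variable holding the
  value of \<open>p\<close>, and the next fresh variable.\<close>

primrec flat :: "pat \<Rightarrow> nat \<Rightarrow> atom list \<times> nat \<times> nat" where
  "flat (V x) k = ([], x, k)"
| "flat Zp k = ([AZero k], k, Suc k)"
| "flat (Sp p) k = (case flat p k of (as, r, k') \<Rightarrow> (ASuc r k' # as, k', Suc k'))"
| "flat (Cp p q) k = (case flat p k of (as, r, k1) \<Rightarrow> case flat q k1 of (bs, s, k2) \<Rightarrow>
     (AFld 0 k2 r # AFld 1 k2 s # as @ bs, k2, Suc k2))"

text \<open>A pair pattern becomes a pointer to the node whose number is that pair; its parent and
  its last entry are the two components.\<close>

lemma flat_sound:
  "flat p k = (as, r, k') \<Longrightarrow> \<forall>a\<in>set as. holds n R UNIV A v a \<Longrightarrow> v r = peval v p"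
proof (induction p arbitrary: k as r k')
  case (Sp p)
  then show ?case by (force split: prod.splits)
next
  case (Cp p q)
  obtain as1 r1 k1 where p: "flat p k = (as1, r1, k1)" by (cases "flat p k")
  obtain bs s k2 where q: "flat q k1 = (bs, s, k2)" by (cases "flat q k1")
  have eq: "as = AFld 0 k2 r1 # AFld 1 k2 s # as1 @ bs" "r = k2" using Cp.prems(1) p q by auto
  have "v r1 = peval v p" "v s = peval v q"
    using Cp.IH(1)[OF p] Cp.IH(2)[OF q] Cp.prems(2) eq by auto
  moreover have "ptl (v r) = v r1" "phd (v r) = v s" using Cp.prems(2) eq by (auto simp: fld_def)
  ultimately show ?case by (metis peval.simps(4) prod_encode_ptl_phd)
qed auto

text \<open>The bounds on fresh variables belong to the induction: a value assigned later cannot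
  disturb atoms already satisfied, as these mention only variables below the counter.\<close>

lemma flat_complete:
  "flat p k = (as, r, k') \<Longrightarrow> pvars p \<subseteq> {..<k} \<Longrightarrow>
    k \<le> k' \<and> r < k' \<and> (\<forall>a\<in>set as. avars a \<subseteq> {..<k'}) \<and>
    (\<forall>v. \<exists>v'. (\<forall>i<k. v' i = v i) \<and> (\<forall>a\<in>set as. holds n R UNIV A v' a) \<and> v' r = peval v p)"
proof (induction p arbitrary: k as r k')
  case (V x)
  then show ?case by auto
next
  case Zp
  have "\<exists>v'. (\<forall>i<k. v' i = v i) \<and> v' k = 0" for v :: "nat \<Rightarrow> nat"
    by (rule exI[of _ "v(k := 0)"]) simp
  then show ?case using Zp by auto
next
  case (Sp p)
  obtain as1 r1 k1 where p: "flat p k = (as1, r1, k1)" by (cases "flat p k")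
  have eq: "as = ASuc r1 k1 # as1" "r = k1" "k' = Suc k1" using Sp.prems(1) p by auto
  have "pvars p \<subseteq> {..<k}" using Sp.prems(2) by simp
  note IH = Sp.IH[OF p this]
  have "\<exists>v'. (\<forall>i<k. v' i = v i) \<and> (\<forall>a\<in>set as. holds n R UNIV A v' a) \<and> v' r = peval v (Sp p)" for v
  proof -
    obtain v1 where v1: "\<forall>i<k. v1 i = v i" "\<forall>a\<in>set as1. holds n R UNIV A v1 a" "v1 r1 = peval v p"
      using IH by blast
    let ?v = "v1(k1 := Suc (v1 r1))"
    have "holds n R UNIV A ?v a" if a: "a \<in> set as1" for a
    proof -
      have "avars a \<subseteq> {..<k1}" using IH a by blast
      then have "v1 x = ?v x" if "x \<in> avars a" for x using that by auto
      then show ?thesis using v1(2) a holds_cong[of a v1 ?v] by blast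
    qed
    then show ?thesis using v1 eq IH by (intro exI[of _ ?v]) auto
  qed
  then show ?case using IH eq by fastforce
next
  case (Cp p q)
  obtain as1 r1 k1 where p: "flat p k = (as1, r1, k1)" by (cases "flat p k")
  obtain bs s k2 where q: "flat q k1 = (bs, s, k2)" by (cases "flat q k1")
  have eq: "as = AFld 0 k2 r1 # AFld 1 k2 s # as1 @ bs" "r = k2" "k' = Suc k2"
    using Cp.prems(1) p q by auto
  have "pvars p \<subseteq> {..<k}" using Cp.prems(2) by simp
  note IH1 = Cp.IH(1)[OF p this]
  have "pvars q \<subseteq> {..<k1}" using Cp.prems(2) IH1 by auto
  note IH2 = Cp.IH(2)[OF q this]
  have "\<exists>v'. (\<forall>i<k. v' i = v i) \<and> (\<forall>a\<in>set as. holds n R UNIV A v' a) \<and> v' r = peval v (Cp p q)" for v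
  proof -
    obtain v1 where v1: "\<forall>i<k. v1 i = v i" "\<forall>a\<in>set as1. holds n R UNIV A v1 a" "v1 r1 = peval v p"
      using IH1 by blast
    obtain v2 where v2: "\<forall>i<k1. v2 i = v1 i" "\<forall>a\<in>set bs. holds n R UNIV A v2 a" "v2 s = peval v1 q"
      using IH2 by blast
    let ?v = "v2(k2 := prod_encode (v2 r1, v2 s))"
    have k12: "k1 \<le> k2" "r1 < k1" "s < k2" using IH1 IH2 by blast+
    have "holds n R UNIV A ?v a" if a: "a \<in> set as1" for a
    proof -
      have "avars a \<subseteq> {..<k1}" using IH1 a by blast
      then have "v1 x = ?v x" if "x \<in> avars a" for x using that v2(1) k12 by auto
      then show ?thesis using v1(2) a holds_cong[of a v1 ?v] by blast
    qed
    moreover have "holds n R UNIV A ?v a" if a: "a \<in> set bs" for a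
    proof -
      have "avars a \<subseteq> {..<k2}" using IH2 a by blast
      then have "v2 x = ?v x" if "x \<in> avars a" for x using that by auto
      then show ?thesis using v2(2) a holds_cong[of a v2 ?v] by blast
    qed
    moreover have "peval v1 q = peval v q"
      using Cp.prems(2) v1(1) by (intro peval_cong) auto
    moreover have "v2 r1 = peval v p" using v2(1) v1(3) k12 by simp
    moreover have "\<forall>i<k. ?v i = v i" using v1(1) v2(1) IH1 k12 by auto
    ultimately show ?thesis using v2(3) eq k12
      by (intro exI[of _ ?v] conjI) (auto simp: fld_def)
  qed
  moreover have "k \<le> k'" "r < k'" using IH1 IH2 eq by auto
  moreover have "avars a \<subseteq> {..<k'}" if a: "a \<in> set as" for a
  proof -
    have k12: "k1 \<le> k2" "r1 < k1" "s < k2" using IH1 IH2 by blast+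
    have "\<forall>a\<in>set as1. avars a \<subseteq> {..<k1}" "\<forall>a\<in>set bs. avars a \<subseteq> {..<k2}" using IH1 IH2 by blast+
    then show ?thesis using a eq k12 by fastforce
  qed
  ultimately show ?case by blast
qed

section \<open>Literals about a branch and their translation into atoms\<close>

datatype lit = LG pat pat | LB pat | LLt pat pat | LN pat

primrec lsem :: "(nat \<Rightarrow> nat) \<Rightarrow> nat \<Rightarrow> nat set \<Rightarrow> (nat \<Rightarrow> nat) \<Rightarrow> lit \<Rightarrow> bool" where
  "lsem g n R u (LG p q) = (g (peval u p) = peval u q)"
| "lsem g n R u (LB p) = (peval u p \<in> R)"
| "lsem g n R u (LLt p q) = (peval u p < peval u q)"
| "lsem g n R u (LN p) = (peval u p = Suc n)"

primrec lvars :: "lit \<Rightarrow> nat set" where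
  "lvars (LG p q) = pvars p \<union> pvars q"
| "lvars (LB p) = pvars p"
| "lvars (LLt p q) = pvars p \<union> pvars q"
| "lvars (LN p) = pvars p"

lemma lsem_cong: "(\<And>x. x \<in> lvars l \<Longrightarrow> u x = u' x) \<Longrightarrow> lsem g n R u l = lsem g n R u' l"
  by (cases l) (auto simp: peval_cong[of _ u u'])

text \<open>The value \<open>g p\<close> is the last entry of the node at level \<open>p + 1\<close>
  on the branch. The first literal therefore asks for an ancestor at the level given by
  \<open>Sp p\<close>.\<close>

primrec flat_lit :: "lit \<Rightarrow> nat \<Rightarrow> atom list \<times> nat" where
  "flat_lit (LG p q) k = (case flat (Sp p) k of (bs, s, k2) \<Rightarrow>
     case flat q k2 of (cs, t, k3) \<Rightarrow>
     (AAnc k3 # AFld 2 k3 s # AFld 1 k3 t # bs @ cs, Suc k3))"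
| "flat_lit (LB p) k = (case flat p k of (as, r, k') \<Rightarrow> (ABit r # as, k'))"
| "flat_lit (LLt p q) k = (case flat p k of (as, r, k1) \<Rightarrow> case flat q k1 of (bs, s, k2) \<Rightarrow>
     (ALt r s # as @ bs, k2))"
| "flat_lit (LN p) k = (case flat p k of (as, r, k') \<Rightarrow> (AN r # as, k'))"

lemma ancestor_lit:
  assumes "0 < g 0"
  shows "s \<in> range (code g) \<and> lev s = Suc q \<and> phd s = y \<longleftrightarrow> s = code g (Suc q) \<and> g q = y"
  using assms by (auto simp: lev_code)

lemma flat_lit_sound:
  assumes "flat_lit l k = (as, k')" "0 < g 0"
    and "\<forall>a\<in>set as. holds n R UNIV (range (code g)) v a"
  shows "lsem g n R v l"
proof (cases l)
  case (LG p q)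
  obtain bs s k2 where p: "flat (Sp p) k = (bs, s, k2)" by (cases "flat (Sp p) k")
  obtain cs t k3 where q: "flat q k2 = (cs, t, k3)" by (cases "flat q k2")
  have eq: "as = AAnc k3 # AFld 2 k3 s # AFld 1 k3 t # bs @ cs"
    using assms(1) p q unfolding LG by (simp del: flat.simps)
  have "v s = peval v (Sp p)" "v t = peval v q"
    using flat_sound[OF p, of n R "range (code g)" v] flat_sound[OF q, of n R "range (code g)" v]
      assms(3) eq by auto
  moreover have "v k3 \<in> range (code g)" "lev (v k3) = v s" "phd (v k3) = v t"
    using assms(3) eq by (auto simp: fld_def)
  ultimately have "v k3 \<in> range (code g) \<and> lev (v k3) = Suc (peval v p) \<and> phd (v k3) = peval v q"
    by simp
  then show ?thesis unfolding ancestor_lit[where g = g, OF assms(2)] LG by simp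
next
  case (LB p)
  obtain bs s k2 where p: "flat p k = (bs, s, k2)" by (cases "flat p k")
  show ?thesis using assms(1,3) p flat_sound[OF p, of n R "range (code g)" v] unfolding LB by auto
next
  case (LLt p q)
  obtain bs s k2 where p: "flat p k = (bs, s, k2)" by (cases "flat p k")
  obtain cs t k3 where q: "flat q k2 = (cs, t, k3)" by (cases "flat q k2")
  show ?thesis using assms(1,3) p q flat_sound[OF p, of n R "range (code g)" v]
      flat_sound[OF q, of n R "range (code g)" v] unfolding LLt by auto
next
  case (LN p)
  obtain bs s k2 where p: "flat p k = (bs, s, k2)" by (cases "flat p k")
  show ?thesis using assms(1,3) p flat_sound[OF p, of n R "range (code g)" v] unfolding LN by auto
qed

text \<open>Obtained from the completeness of the pair pattern \<open>Cp p q\<close>: its atoms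
  include those of both components, and its pointer \<open>k2\<close> reveals the two
  values.\<close>

lemma flat2_complete:
  assumes p: "flat p k = (as, r, k1)" and q: "flat q k1 = (bs, s, k2)"
    and pv: "pvars p \<subseteq> {..<k}" "pvars q \<subseteq> {..<k}"
  shows "k \<le> k2 \<and> r < k2 \<and> s < k2 \<and> (\<forall>a\<in>set (as @ bs). avars a \<subseteq> {..<k2}) \<and>
    (\<forall>v. \<exists>v'. (\<forall>i<k. v' i = v i) \<and> (\<forall>a\<in>set (as @ bs). holds n R UNIV A v' a) \<and>
       v' r = peval v p \<and> v' s = peval v q)"
proof -
  have c: "flat (Cp p q) k = (AFld 0 k2 r # AFld 1 k2 s # as @ bs, k2, Suc k2)"
    using p q by simp
  note fc = flat_complete[OF p pv(1), of n R A]
  have "pvars q \<subseteq> {..<k1}" using pv fc by auto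
  note fd = flat_complete[OF q this, of n R A]
  have k: "k \<le> k1" "k1 \<le> k2" "r < k1" "s < k2" using fc fd by blast+
  have "\<forall>a\<in>set as. avars a \<subseteq> {..<k1}" "\<forall>a\<in>set bs. avars a \<subseteq> {..<k2}" using fc fd by blast+
  then have av: "\<forall>a\<in>set (as @ bs). avars a \<subseteq> {..<k2}" using k by fastforce
  have "\<exists>v'. (\<forall>i<k. v' i = v i) \<and> (\<forall>a\<in>set (as @ bs). holds n R UNIV A v' a) \<and>
       v' r = peval v p \<and> v' s = peval v q" for v
  proof -
    have "pvars (Cp p q) \<subseteq> {..<k}" using pv by simp
    from flat_complete[OF c this, of n R A] obtain v' where v': "\<forall>i<k. v' i = v i"
      "\<forall>a\<in>set (AFld 0 k2 r # AFld 1 k2 s # as @ bs). holds n R UNIV A v' a"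
      "v' k2 = peval v (Cp p q)" by blast
    then have "ptl (v' k2) = v' r" "phd (v' k2) = v' s" by (auto simp: fld_def)
    then have "v' r = peval v p" "v' s = peval v q" using v'(3) by auto
    then show ?thesis using v' by (intro exI[of _ v']) auto
  qed
  then show ?thesis using av k by auto
qed

lemma flat_lit_complete:
  assumes "flat_lit l k = (as, k')" "0 < g 0" "lvars l \<subseteq> {..<k}"
  shows "k \<le> k' \<and> (\<forall>a\<in>set as. avars a \<subseteq> {..<k'}) \<and>
    (\<forall>v. lsem g n R v l \<longrightarrow>
      (\<exists>v'. (\<forall>i<k. v' i = v i) \<and> (\<forall>a\<in>set as. holds n R UNIV (range (code g)) v' a)))"
proof (cases l)
  case (LG p q)
  obtain bs s k2 where p: "flat (Sp p) k = (bs, s, k2)" by (cases "flat (Sp p) k")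
  obtain cs t k3 where q: "flat q k2 = (cs, t, k3)" by (cases "flat q k2")
  have eq: "as = AAnc k3 # AFld 2 k3 s # AFld 1 k3 t # bs @ cs" "k' = Suc k3"
    using assms(1) p q unfolding LG by (simp_all del: flat.simps)
  have "pvars (Sp p) \<subseteq> {..<k}" "pvars q \<subseteq> {..<k}" using assms(3) LG by auto
  note fc = flat2_complete[OF p q this, of n R "range (code g)"]
  have k: "k \<le> k3" "s < k3" "t < k3" using fc by blast+
  have "\<exists>v'. (\<forall>i<k. v' i = v i) \<and> (\<forall>a\<in>set as. holds n R UNIV (range (code g)) v' a)"
    if l: "lsem g n R v l" for v
  proof -
    obtain v1 where v1: "\<forall>i<k. v1 i = v i"
      "\<forall>a\<in>set (bs @ cs). holds n R UNIV (range (code g)) v1 a"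
      "v1 s = peval v (Sp p)" "v1 t = peval v q" using fc by blast
    let ?v = "v1(k3 := code g (Suc (peval v p)))"
    have "holds n R UNIV (range (code g)) ?v a" if a: "a \<in> set (bs @ cs)" for a
    proof -
      have "avars a \<subseteq> {..<k3}" using fc a by blast
      then have "v1 x = ?v x" if "x \<in> avars a" for x using that by auto
      then show ?thesis using v1(2) a holds_cong[of a v1 ?v] by blast
    qed
    moreover have "holds n R UNIV (range (code g)) ?v a"
      if "a \<in> {AAnc k3, AFld 2 k3 s, AFld 1 k3 t}" for a
      using that l k v1(3,4) assms(2) by (auto simp: LG fld_def lev_code)
    moreover have "\<forall>i<k. ?v i = v i" using v1(1) k by auto
    ultimately show ?thesis unfolding eq by (intro exI[of _ ?v] conjI ballI) fastforce+
  qed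
  then show ?thesis using fc k eq by fastforce
next
  case (LB p)
  obtain bs s k2 where p: "flat p k = (bs, s, k2)" by (cases "flat p k")
  have "pvars p \<subseteq> {..<k}" using assms(3) LB by auto
  note fc = flat_complete[OF p this, of n R "range (code g)"]
  have eq: "as = ABit s # bs" "k' = k2" using assms(1) p unfolding LB by simp_all
  have "\<exists>v'. (\<forall>i<k. v' i = v i) \<and> (\<forall>a\<in>set as. holds n R UNIV (range (code g)) v' a)"
    if l: "lsem g n R v l" for v
  proof -
    obtain v' where "\<forall>i<k. v' i = v i" "\<forall>a\<in>set bs. holds n R UNIV (range (code g)) v' a"
      "v' s = peval v p" using fc by blast
    then show ?thesis using l by (intro exI[of _ v']) (auto simp: LB eq)
  qed
  then show ?thesis using fc eq by auto
next
  case (LN p)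
  obtain bs s k2 where p: "flat p k = (bs, s, k2)" by (cases "flat p k")
  have "pvars p \<subseteq> {..<k}" using assms(3) LN by auto
  note fc = flat_complete[OF p this, of n R "range (code g)"]
  have eq: "as = AN s # bs" "k' = k2" using assms(1) p unfolding LN by simp_all
  have "\<exists>v'. (\<forall>i<k. v' i = v i) \<and> (\<forall>a\<in>set as. holds n R UNIV (range (code g)) v' a)"
    if l: "lsem g n R v l" for v
  proof -
    obtain v' where "\<forall>i<k. v' i = v i" "\<forall>a\<in>set bs. holds n R UNIV (range (code g)) v' a"
      "v' s = peval v p" using fc by blast
    then show ?thesis using l by (intro exI[of _ v']) (auto simp: LN eq)
  qed
  then show ?thesis using fc eq by auto
next
  case (LLt p q)
  obtain bs s k2 where p: "flat p k = (bs, s, k2)" by (cases "flat p k")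
  obtain cs t k3 where q: "flat q k2 = (cs, t, k3)" by (cases "flat q k2")
  have eq: "as = ALt s t # bs @ cs" "k' = k3" using assms(1) p q unfolding LLt by simp_all
  have "pvars p \<subseteq> {..<k}" "pvars q \<subseteq> {..<k}" using assms(3) LLt by auto
  note fc = flat2_complete[OF p q this, of n R "range (code g)"]
  have "\<exists>v'. (\<forall>i<k. v' i = v i) \<and> (\<forall>a\<in>set as. holds n R UNIV (range (code g)) v' a)"
    if l: "lsem g n R v l" for v
  proof -
    obtain v1 where v1: "\<forall>i<k. v1 i = v i"
      "\<forall>a\<in>set (bs @ cs). holds n R UNIV (range (code g)) v1 a"
      "v1 s = peval v p" "v1 t = peval v q" using fc by blast
    then show ?thesis using l by (intro exI[of _ v1]) (auto simp: LLt eq)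
  qed
  then show ?thesis using fc eq by auto
qed

primrec flat_rule :: "lit list \<Rightarrow> nat \<Rightarrow> atom list" where
  "flat_rule [] k = []"
| "flat_rule (l # ls) k = (case flat_lit l k of (as, k') \<Rightarrow> as @ flat_rule ls k')"

lemma flat_rule_sound:
  assumes "0 < g 0" "\<forall>a\<in>set (flat_rule ls k). holds n R UNIV (range (code g)) v a"
  shows "\<forall>l\<in>set ls. lsem g n R v l"
  using assms(2)
proof (induction ls arbitrary: k)
  case (Cons l ls)
  obtain as k' where l: "flat_lit l k = (as, k')" by (cases "flat_lit l k")
  show ?case using Cons l flat_lit_sound[where g = g, OF l assms(1), of n R v] by auto
qed simp

text \<open>The literals of a rule share the variables below \<open>b\<close>, while each draws its
  auxiliary variables from above. A valuation is thus extended literal by literal without touching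
  the shared part.\<close>

lemma flat_rule_complete:
  assumes "0 < g 0" "\<forall>l\<in>set ls. lvars l \<subseteq> {..<b}" "b \<le> k" "\<forall>l\<in>set ls. lsem g n R v l"
  shows "\<exists>v'. (\<forall>i<k. v' i = v i) \<and> (\<forall>a\<in>set (flat_rule ls k). holds n R UNIV (range (code g)) v' a)"
  using assms(2-)
proof (induction ls arbitrary: k v)
  case Nil
  then show ?case by auto
next
  case (Cons l ls)
  obtain as k' where l: "flat_lit l k = (as, k')" by (cases "flat_lit l k")
  have "lvars l \<subseteq> {..<k}" using Cons.prems(1,2) by fastforce
  note fc = flat_lit_complete[where g = g, OF l assms(1) this, of n R]
  obtain v1 where v1: "\<forall>i<k. v1 i = v i" "\<forall>a\<in>set as. holds n R UNIV (range (code g)) v1 a"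
    using fc Cons.prems(3) by auto
  have "lsem g n R v1 l'" if l': "l' \<in> set ls" for l'
  proof -
    have "lvars l' \<subseteq> {..<b}" using Cons.prems(1) l' by simp
    then have "v1 x = v x" if "x \<in> lvars l'" for x using that v1(1) Cons.prems(2) by auto
    then show ?thesis using Cons.prems(3) l' lsem_cong[of l' v1 v] by auto
  qed
  then obtain v' where v': "\<forall>i<k'. v' i = v1 i"
      "\<forall>a\<in>set (flat_rule ls k'). holds n R UNIV (range (code g)) v' a"
    using Cons.IH[of k' v1] Cons.prems(1,2) fc by auto
  have "holds n R UNIV (range (code g)) v' a" if a: "a \<in> set as" for a
  proof -
    have "avars a \<subseteq> {..<k'}" using fc a by blast
    then have "v1 x = v' x" if "x \<in> avars a" for x using that v'(1) by auto
    then show ?thesis using v1(2) a holds_cong[of a v1 v'] by blast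
  qed
  then show ?case using v' v1(1) fc l by (intro exI[of _ v']) auto
qed

definition refutes :: "lit list list \<Rightarrow> (nat \<Rightarrow> nat) \<Rightarrow> nat \<Rightarrow> nat set \<Rightarrow> bool" where
  "refutes rs g n R \<longleftrightarrow> (\<exists>r\<in>set rs. \<exists>u. \<forall>l\<in>set r. lsem g n R u l)"

lemma matches_flat_rule:
  assumes "0 < g 0" "\<forall>r\<in>set rs. \<forall>l\<in>set r. lvars l \<subseteq> {..<b}"
  shows "matches (map (\<lambda>r. flat_rule r b) rs) n R UNIV (range (code g)) \<longleftrightarrow> refutes rs g n R"
proof -
  have "(\<exists>v. \<forall>a\<in>set (flat_rule r b). holds n R UNIV (range (code g)) v a) \<longleftrightarrow>
      (\<exists>u. \<forall>l\<in>set r. lsem g n R u l)" if "r \<in> set rs" for r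
    using flat_rule_sound[where g = g, OF assms(1), of r b n R]
      flat_rule_complete[where g = g, OF assms(1), of r b b n R] assms(2) that by blast
  then show ?thesis by (simp add: matches_def refutes_def)
qed

section \<open>Truth of second-order sentences along branches\<close>

instance aterm :: countable by countable_datatype
instance aform :: countable by countable_datatype

text \<open>A branch \<open>g\<close> answers queries: \<open>LT s\<close> asks for the value of the term \<open>s\<close> in a coded environment, \<open>LF p\<close> whether
  \<open>p\<close> holds there (\<open>0\<close> means that it fails), \<open>LW p\<close> for a witness if \<open>p\<close> is a true \<open>FEx\<close> or a false \<open>FAll\<close>,
  and \<open>LGf i\<close> for values of the \<open>i\<close>th existentially quantified function. A rule lists answers which must not occur together.\<close>

datatype lab = LT aterm | LF aform | LW aform | LGf nat | LAdd | LMul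
instance lab :: countable by countable_datatype

primrec num :: "nat \<Rightarrow> pat" where
  "num 0 = Zp"
| "num (Suc k) = Sp (num k)"

lemma peval_num [simp]: "peval u (num k) = k" by (induction k) auto
lemma pvars_num [simp]: "pvars (num k) = {}" by (induction k) auto

text \<open>The successor keeps every query different from \<open>0\<close>, so that the entry
  \<open>g 0\<close> stays free to select a subtree of the root.\<close>

definition query :: "lab \<Rightarrow> nat \<Rightarrow> nat" where
  "query l c = prod_encode (Suc (to_nat l), c)"

definition Qp :: "lab \<Rightarrow> pat \<Rightarrow> pat" where
  "Qp l p = Cp (num (Suc (to_nat l))) p"

lemma peval_Qp [simp]: "peval u (Qp l p) = query l (peval u p)"
  and pvars_Qp [simp]: "pvars (Qp l p) = pvars p"
  by (simp_all add: Qp_def query_def)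

text \<open>An inequation is split into the two strict orders, the comparison that literals
  offer.\<close>

definition neqr :: "lit list \<Rightarrow> pat \<Rightarrow> pat \<Rightarrow> lit list list" where
  "neqr ls p q = [LLt p q # ls, LLt q p # ls]"

text \<open>The recursion equations of addition and multiplication, listed through their violations;
  an unrefuted branch must answer sums and products correctly.\<close>

definition base_rules :: "lit list list" where
  "base_rules =
     neqr [LG (Qp LAdd (Cp (V 0) Zp)) (V 1)] (V 1) (V 0)
   @ neqr [LG (Qp LAdd (Cp (V 0) (Sp (V 1)))) (V 2), LG (Qp LAdd (Cp (V 0) (V 1))) (V 3)] (V 2) (Sp (V 3))
   @ neqr [LG (Qp LMul (Cp (V 0) Zp)) (V 1)] (V 1) Zp
   @ neqr [LG (Qp LMul (Cp (V 0) (Sp (V 1)))) (V 2), LG (Qp LMul (Cp (V 0) (V 1))) (V 3),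
           LG (Qp LAdd (Cp (V 3) (V 0))) (V 4)] (V 2) (V 4)"

text \<open>An environment is a nested pair with variable 0 as its last component. Reducing variable
  \<open>Suc i\<close> to variable \<open>i\<close> of the remaining environment keeps the number of
  rules finite.\<close>

primrec var_rules :: "nat \<Rightarrow> lit list list" where
  "var_rules 0 = neqr [LG (Qp (LT (TVar 0)) (Cp (V 0) (V 1))) (V 2)] (V 2) (V 1)"
| "var_rules (Suc i) =
     neqr [LG (Qp (LT (TVar (Suc i))) (Cp (V 0) (V 1))) (V 2), LG (Qp (LT (TVar i)) (V 0)) (V 3)] (V 2) (V 3)
   @ var_rules i"

primrec term_rules :: "aterm \<Rightarrow> lit list list" where
  "term_rules (TVar i) = var_rules i"
| "term_rules TZero = neqr [LG (Qp (LT TZero) (V 0)) (V 1)] (V 1) Zp"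
| "term_rules (TSuc s) =
     neqr [LG (Qp (LT (TSuc s)) (V 0)) (V 1), LG (Qp (LT s) (V 0)) (V 2)] (V 1) (Sp (V 2)) @ term_rules s"
| "term_rules (TAdd s t) =
     neqr [LG (Qp (LT (TAdd s t)) (V 0)) (V 1), LG (Qp (LT s) (V 0)) (V 2), LG (Qp (LT t) (V 0)) (V 3),
           LG (Qp LAdd (Cp (V 2) (V 3))) (V 4)] (V 1) (V 4) @ term_rules s @ term_rules t"
| "term_rules (TMul s t) =
     neqr [LG (Qp (LT (TMul s t)) (V 0)) (V 1), LG (Qp (LT s) (V 0)) (V 2), LG (Qp (LT t) (V 0)) (V 3),
           LG (Qp LMul (Cp (V 2) (V 3))) (V 4)] (V 1) (V 4) @ term_rules s @ term_rules t"
| "term_rules (TFA i s) =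
     neqr [LG (Qp (LT (TFA i s)) (V 0)) (V 1), LG (Qp (LT s) (V 0)) (V 2),
           LB (Cp (Cp (num i) (V 2)) (V 3))] (V 1) (V 3) @ term_rules s"
| "term_rules (TFE i s) =
     neqr [LG (Qp (LT (TFE i s)) (V 0)) (V 1), LG (Qp (LT s) (V 0)) (V 2),
           LG (Qp (LGf i) (V 2)) (V 3)] (V 1) (V 3) @ term_rules s"

text \<open>Any positive answer counts as true, hence the pattern \<open>Sp\<close>. Both directions
  of each truth clause are imposed, so that negation does not break the induction.\<close>

primrec form_rules :: "aform \<Rightarrow> lit list list" where
  "form_rules (FEq s t) =
     [[LG (Qp (LF (FEq s t)) (V 0)) (Sp (V 1)), LG (Qp (LT s) (V 0)) (V 2), LG (Qp (LT t) (V 0)) (V 3), LLt (V 2) (V 3)],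
      [LG (Qp (LF (FEq s t)) (V 0)) (Sp (V 1)), LG (Qp (LT s) (V 0)) (V 2), LG (Qp (LT t) (V 0)) (V 3), LLt (V 3) (V 2)],
      [LG (Qp (LF (FEq s t)) (V 0)) Zp, LG (Qp (LT s) (V 0)) (V 2), LG (Qp (LT t) (V 0)) (V 2)]]
     @ term_rules s @ term_rules t"
| "form_rules (FLt s t) =
     [[LG (Qp (LF (FLt s t)) (V 0)) (Sp (V 1)), LG (Qp (LT s) (V 0)) (V 2), LG (Qp (LT t) (V 0)) (V 3), LLt (V 3) (Sp (V 2))],
      [LG (Qp (LF (FLt s t)) (V 0)) Zp, LG (Qp (LT s) (V 0)) (V 2), LG (Qp (LT t) (V 0)) (V 3), LLt (V 2) (V 3)]]
     @ term_rules s @ term_rules t"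
| "form_rules (FNot p) =
     [[LG (Qp (LF (FNot p)) (V 0)) Zp, LG (Qp (LF p) (V 0)) Zp],
      [LG (Qp (LF (FNot p)) (V 0)) (Sp (V 1)), LG (Qp (LF p) (V 0)) (Sp (V 2))]] @ form_rules p"
| "form_rules (FConj p q) =
     [[LG (Qp (LF (FConj p q)) (V 0)) (Sp (V 1)), LG (Qp (LF p) (V 0)) Zp],
      [LG (Qp (LF (FConj p q)) (V 0)) (Sp (V 1)), LG (Qp (LF q) (V 0)) Zp],
      [LG (Qp (LF (FConj p q)) (V 0)) Zp, LG (Qp (LF p) (V 0)) (Sp (V 1)), LG (Qp (LF q) (V 0)) (Sp (V 2))]]
     @ form_rules p @ form_rules q"
| "form_rules (FDisj p q) =
     [[LG (Qp (LF (FDisj p q)) (V 0)) Zp, LG (Qp (LF p) (V 0)) (Sp (V 1))],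
      [LG (Qp (LF (FDisj p q)) (V 0)) Zp, LG (Qp (LF q) (V 0)) (Sp (V 1))],
      [LG (Qp (LF (FDisj p q)) (V 0)) (Sp (V 1)), LG (Qp (LF p) (V 0)) Zp, LG (Qp (LF q) (V 0)) Zp]]
     @ form_rules p @ form_rules q"
| "form_rules (FEx p) =
     [[LG (Qp (LF (FEx p)) (V 0)) (Sp (V 1)), LG (Qp (LW (FEx p)) (V 0)) (V 2), LG (Qp (LF p) (Cp (V 0) (V 2))) Zp],
      [LG (Qp (LF (FEx p)) (V 0)) Zp, LG (Qp (LF p) (Cp (V 0) (V 2))) (Sp (V 1))]] @ form_rules p"
| "form_rules (FAll p) =
     [[LG (Qp (LF (FAll p)) (V 0)) Zp, LG (Qp (LW (FAll p)) (V 0)) (V 2), LG (Qp (LF p) (Cp (V 0) (V 2))) (Sp (V 1))],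
      [LG (Qp (LF (FAll p)) (V 0)) (Sp (V 1)), LG (Qp (LF p) (Cp (V 0) (V 2))) Zp]] @ form_rules p"

text \<open>The literal \<open>LN (Sp (V 0))\<close> binds \<open>V 0\<close> to \<open>n\<close>;
  the pattern \<open>Cp Zp (V 0)\<close> is then the initial environment, in which the answer false
  is forbidden.\<close>

definition sentence_rules :: "aform \<Rightarrow> lit list list" where
  "sentence_rules p = [LN (Sp (V 0)), LG (Qp (LF p) (Cp Zp (V 0))) Zp] # base_rules @ form_rules p"

lemma lvars_sentence_rules: "\<forall>r\<in>set (sentence_rules p). \<forall>l\<in>set r. lvars l \<subseteq> {..<5}"
proof -
  have v: "\<forall>r\<in>set (var_rules i). \<forall>l\<in>set r. lvars l \<subseteq> {..<5}" for i
    by (induction i) (auto simp: neqr_def)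
  have t: "\<forall>r\<in>set (term_rules t). \<forall>l\<in>set r. lvars l \<subseteq> {..<5}" for t
    by (induction t) (use v in \<open>simp_all add: neqr_def ball_Un\<close>)
  have "\<forall>r\<in>set (form_rules p). \<forall>l\<in>set r. lvars l \<subseteq> {..<5}" for p
    by (induction p) (use t in \<open>simp_all add: ball_Un\<close>)
  then show ?thesis by (auto simp: sentence_rules_def base_rules_def neqr_def)
qed

lemma refutes_Nil [simp]: "\<not> refutes [] g n R" by (simp add: refutes_def)
lemma refutes_append [simp]: "refutes (rs @ ss) g n R \<longleftrightarrow> refutes rs g n R \<or> refutes ss g n R"
  by (auto simp: refutes_def)
lemma refutes_Cons [simp]:
  "refutes (r # rs) g n R \<longleftrightarrow> (\<exists>u. \<forall>l\<in>set r. lsem g n R u l) \<or> refutes rs g n R"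
  by (auto simp: refutes_def)
lemma refutes_neqr [simp]:
  "refutes (neqr ls p q) g n R \<longleftrightarrow> (\<exists>u. (\<forall>l\<in>set ls. lsem g n R u l) \<and> peval u p \<noteq> peval u q)"
  unfolding neqr_def refutes_Cons by (auto simp: nat_neq_iff)

definition env_of :: "nat \<Rightarrow> nat \<Rightarrow> nat" where
  "env_of c i = phd ((ptl ^^ i) c)"

lemma env_of_0: "env_of c 0 = phd c" by (simp add: env_of_def)
lemma env_of_Suc: "env_of c (Suc i) = env_of (ptl c) i"
  by (simp add: env_of_def funpow_swap1)

lemma env_of_prod_encode: "env_of (prod_encode (c, m)) = shift_env m (env_of c)"
proof
  fix i show "env_of (prod_encode (c, m)) i = shift_env m (env_of c) i"
    by (cases i) (simp_all add: env_of_0 env_of_Suc shift_env_def)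
qed

lemma env_of_initial: "env_of (prod_encode (0, n)) = (\<lambda>i. if i = 0 then n else 0)"
proof
  have "(ptl ^^ i) 0 = 0" for i by (induction i) auto
  then have "env_of 0 i = 0" for i by (simp add: env_of_def)
  then show "env_of (prod_encode (0, n)) i = (if i = 0 then n else 0)" for i
    by (cases i) (simp_all add: env_of_0 env_of_Suc)
qed

definition graph :: "(nat \<Rightarrow> nat \<Rightarrow> nat) \<Rightarrow> nat set" where
  "graph F = {prod_encode (prod_encode (i, a), F i a) | i a. True}"

lemma graph_iff [simp]: "prod_encode (prod_encode (i, a), b) \<in> graph F \<longleftrightarrow> b = F i a"
  by (auto simp: graph_def)

lemma unrefuted_base:
  assumes "\<not> refutes base_rules g n R"
  shows "g (query LAdd (prod_encode (a, b))) = a + b" "g (query LMul (prod_encode (a, b))) = a * b"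
proof -
  let ?A = "\<lambda>a b. g (query LAdd (prod_encode (a, b)))" and ?M = "\<lambda>a b. g (query LMul (prod_encode (a, b)))"
  \<comment> \<open>The absence of a refutation, read for all valuations. Each use below plugs in
    the list of answers that the branch actually gives.\<close>
  have h: "\<And>u :: nat \<Rightarrow> nat. ?A (u 0) 0 = u 1 \<longrightarrow> u 1 = u 0"
      "\<And>u :: nat \<Rightarrow> nat. ?A (u 0) (Suc (u 1)) = u 2 \<and> ?A (u 0) (u 1) = u 3 \<longrightarrow> u 2 = Suc (u 3)"
      "\<And>u :: nat \<Rightarrow> nat. ?M (u 0) 0 = u 1 \<longrightarrow> u 1 = 0"
      "\<And>u :: nat \<Rightarrow> nat. ?M (u 0) (Suc (u 1)) = u 2 \<and> ?M (u 0) (u 1) = u 3 \<and> ?A (u 3) (u 0) = u 4 \<longrightarrow> u 2 = u 4"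
    using assms unfolding base_rules_def by simp_all
  have A: "?A a b = a + b" for a b
  proof (induction b)
    case 0
    show ?case using h(1)[of "(!) [a, ?A a 0]"] by simp
  next
    case (Suc b)
    show ?case using Suc h(2)[of "(!) [a, b, ?A a (Suc b), ?A a b]"] by simp
  qed
  have M: "?M a b = a * b" for a b
  proof (induction b)
    case 0
    show ?case using h(3)[of "(!) [a, ?M a 0]"] by simp
  next
    case (Suc b)
    show ?case using Suc h(4)[of "(!) [a, b, ?M a (Suc b), ?M a b, ?A (?M a b) a]"]
      by (simp add: A)
  qed
  show "?A a b = a + b" "?M a b = a * b" by (fact A, fact M)
qed

text \<open>The function \<open>G\<close> is defined by the branch through its \<open>LGf\<close>
  answers, whereas \<open>F\<close> enters through the graph bits.\<close>

lemma unrefuted_term: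
  assumes "\<not> refutes base_rules g n (graph F)" "\<not> refutes (term_rules t) g n (graph F)"
  shows "g (query (LT t) c) = teval (env_of c) F (\<lambda>i a. g (query (LGf i) a)) t"
  using assms(2)
proof (induction t arbitrary: c)
  case (TVar i)
  have "\<not> refutes (var_rules i) g n (graph F) \<Longrightarrow> g (query (LT (TVar i)) c) = env_of c i" for c
  proof (induction i arbitrary: c)
    case 0
    then have h: "g (query (LT (TVar 0)) (prod_encode (u 0, u 1))) = u 2 \<longrightarrow> u 2 = u 1" for u :: "nat \<Rightarrow> nat" by simp
    show ?case
      using h[of "(!) [ptl c, phd c, g (query (LT (TVar 0)) c)]"] by (simp add: env_of_0)
  next
    case (Suc i)
    then have h: "g (query (LT (TVar (Suc i))) (prod_encode (u 0, u 1))) = u 2 \<and>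
        g (query (LT (TVar i)) (u 0)) = u 3 \<longrightarrow> u 2 = u 3" for u :: "nat \<Rightarrow> nat" by simp
    show ?case
      using h[of "(!) [ptl c, phd c, g (query (LT (TVar (Suc i))) c), g (query (LT (TVar i)) (ptl c))]"]
        Suc by (simp add: env_of_Suc)
  qed
  then show ?case using TVar by simp
next
  case TZero
  then have h: "g (query (LT TZero) (u 0)) = u 1 \<longrightarrow> u 1 = 0" for u :: "nat \<Rightarrow> nat" by simp
  show ?case using h[of "(!) [c, g (query (LT TZero) c)]"] by simp
next
  case (TSuc s)
  then have h: "g (query (LT (TSuc s)) (u 0)) = u 1 \<and> g (query (LT s) (u 0)) = u 2 \<longrightarrow> u 1 = Suc (u 2)" for u :: "nat \<Rightarrow> nat"
    by simp
  show ?case using TSuc h[of "(!) [c, g (query (LT (TSuc s)) c), g (query (LT s) c)]"] by simp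
next
  case (TAdd s t)
  then have h: "g (query (LT (TAdd s t)) (u 0)) = u 1 \<and> g (query (LT s) (u 0)) = u 2 \<and>
      g (query (LT t) (u 0)) = u 3 \<and> g (query LAdd (prod_encode (u 2, u 3))) = u 4 \<longrightarrow> u 1 = u 4" for u :: "nat \<Rightarrow> nat"
    by simp
  show ?case using TAdd h[of "(!) [c, g (query (LT (TAdd s t)) c), g (query (LT s) c), g (query (LT t) c),
      g (query LAdd (prod_encode (g (query (LT s) c), g (query (LT t) c))))]"] unrefuted_base[OF assms(1)]
    by simp
next
  case (TMul s t)
  then have h: "g (query (LT (TMul s t)) (u 0)) = u 1 \<and> g (query (LT s) (u 0)) = u 2 \<and>
      g (query (LT t) (u 0)) = u 3 \<and> g (query LMul (prod_encode (u 2, u 3))) = u 4 \<longrightarrow> u 1 = u 4" for u :: "nat \<Rightarrow> nat"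
    by simp
  show ?case using TMul h[of "(!) [c, g (query (LT (TMul s t)) c), g (query (LT s) c), g (query (LT t) c),
      g (query LMul (prod_encode (g (query (LT s) c), g (query (LT t) c))))]"] unrefuted_base[OF assms(1)]
    by simp
next
  case (TFA i s)
  then have h: "g (query (LT (TFA i s)) (u 0)) = u 1 \<and> g (query (LT s) (u 0)) = u 2 \<and>
      u 3 = F i (u 2) \<longrightarrow> u 1 = u 3" for u :: "nat \<Rightarrow> nat"
    by simp
  show ?case using TFA h[of "(!) [c, g (query (LT (TFA i s)) c), g (query (LT s) c), F i (g (query (LT s) c))]"]
    by simp
next
  case (TFE i s)
  then have h: "g (query (LT (TFE i s)) (u 0)) = u 1 \<and> g (query (LT s) (u 0)) = u 2 \<and>
      g (query (LGf i) (u 2)) = u 3 \<longrightarrow> u 1 = u 3" for u :: "nat \<Rightarrow> nat"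
    by simp
  show ?case using TFE h[of "(!) [c, g (query (LT (TFE i s)) c), g (query (LT s) c),
      g (query (LGf i) (g (query (LT s) c)))]"]
    by simp
qed

text \<open>In the quantifier cases an environment extended by \<open>m\<close> is again coded, by
  the pair of \<open>c\<close> and \<open>m\<close>. One rule consults the witness answer, the other
  may be instantiated with every \<open>m\<close>.\<close>

lemma unrefuted_form:
  assumes "\<not> refutes base_rules g n (graph F)" "\<not> refutes (form_rules p) g n (graph F)"
  shows "0 < g (query (LF p) c) \<longleftrightarrow> fsat (env_of c) F (\<lambda>i a. g (query (LGf i) a)) p"
  using assms(2)
proof (induction p arbitrary: c)
  case (FEq s t)
  let ?f = "g (query (LF (FEq s t)) c)" and ?s = "g (query (LT s) c)" and ?t = "g (query (LT t) c)"
  have h: "\<not> (g (query (LF (FEq s t)) (u 0)) = Suc (u 1) \<and> g (query (LT s) (u 0)) = u 2 \<and>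
      g (query (LT t) (u 0)) = u 3 \<and> u 2 < u 3)"
    "\<not> (g (query (LF (FEq s t)) (u 0)) = Suc (u 1) \<and> g (query (LT s) (u 0)) = u 2 \<and>
      g (query (LT t) (u 0)) = u 3 \<and> u 3 < u 2)"
    "\<not> (g (query (LF (FEq s t)) (u 0)) = 0 \<and> g (query (LT s) (u 0)) = u 2 \<and>
      g (query (LT t) (u 0)) = u 2)" for u :: "nat \<Rightarrow> nat"
    using FEq by auto
  have "0 < ?f \<longleftrightarrow> ?s = ?t"
    using h(1,2)[of "(!) [c, ?f - 1, ?s, ?t]"] h(3)[of "(!) [c, 0, ?s]"] by auto
  then show ?case
    using FEq unrefuted_term[OF assms(1), of s c] unrefuted_term[OF assms(1), of t c] by simp
next
  case (FLt s t)
  let ?f = "g (query (LF (FLt s t)) c)" and ?s = "g (query (LT s) c)" and ?t = "g (query (LT t) c)"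
  have h: "\<not> (g (query (LF (FLt s t)) (u 0)) = Suc (u 1) \<and> g (query (LT s) (u 0)) = u 2 \<and>
      g (query (LT t) (u 0)) = u 3 \<and> u 3 < Suc (u 2))"
    "\<not> (g (query (LF (FLt s t)) (u 0)) = 0 \<and> g (query (LT s) (u 0)) = u 2 \<and>
      g (query (LT t) (u 0)) = u 3 \<and> u 2 < u 3)" for u :: "nat \<Rightarrow> nat"
    using FLt by auto
  have "0 < ?f \<longleftrightarrow> ?s < ?t"
    using h[of "(!) [c, ?f - 1, ?s, ?t]"] by auto
  then show ?case
    using FLt unrefuted_term[OF assms(1), of s c] unrefuted_term[OF assms(1), of t c] by simp
next
  case (FNot p)
  let ?f = "g (query (LF (FNot p)) c)" and ?p = "g (query (LF p) c)"
  have h: "\<not> (g (query (LF (FNot p)) (u 0)) = 0 \<and> g (query (LF p) (u 0)) = 0)"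
    "\<not> (g (query (LF (FNot p)) (u 0)) = Suc (u 1) \<and> g (query (LF p) (u 0)) = Suc (u 2))" for u :: "nat \<Rightarrow> nat"
    using FNot by auto
  have "0 < ?f \<longleftrightarrow> \<not> 0 < ?p" using h[of "(!) [c, ?f - 1, ?p - 1]"] by auto
  moreover have "0 < ?p \<longleftrightarrow> fsat (env_of c) F (\<lambda>i a. g (query (LGf i) a)) p" using FNot by simp
  ultimately show ?case by simp
next
  case (FConj p q)
  let ?f = "g (query (LF (FConj p q)) c)" and ?p = "g (query (LF p) c)" and ?q = "g (query (LF q) c)"
  have h: "\<not> (g (query (LF (FConj p q)) (u 0)) = Suc (u 1) \<and> g (query (LF p) (u 0)) = 0)"
    "\<not> (g (query (LF (FConj p q)) (u 0)) = Suc (u 1) \<and> g (query (LF q) (u 0)) = 0)"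
    "\<not> (g (query (LF (FConj p q)) (u 0)) = 0 \<and> g (query (LF p) (u 0)) = Suc (u 1) \<and>
       g (query (LF q) (u 0)) = Suc (u 2))" for u :: "nat \<Rightarrow> nat"
    using FConj by auto
  have "0 < ?f \<longleftrightarrow> 0 < ?p \<and> 0 < ?q"
    using h(1,2)[of "(!) [c, ?f - 1]"] h(3)[of "(!) [c, ?p - 1, ?q - 1]"] by auto
  then show ?case using FConj by simp
next
  case (FDisj p q)
  let ?f = "g (query (LF (FDisj p q)) c)" and ?p = "g (query (LF p) c)" and ?q = "g (query (LF q) c)"
  have h: "\<not> (g (query (LF (FDisj p q)) (u 0)) = 0 \<and> g (query (LF p) (u 0)) = Suc (u 1))"
    "\<not> (g (query (LF (FDisj p q)) (u 0)) = 0 \<and> g (query (LF q) (u 0)) = Suc (u 1))"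
    "\<not> (g (query (LF (FDisj p q)) (u 0)) = Suc (u 1) \<and> g (query (LF p) (u 0)) = 0 \<and>
       g (query (LF q) (u 0)) = 0)" for u :: "nat \<Rightarrow> nat"
    using FDisj by auto
  have "0 < ?f \<longleftrightarrow> 0 < ?p \<or> 0 < ?q"
    using h(1)[of "(!) [c, ?p - 1]"] h(2)[of "(!) [c, ?q - 1]"] h(3)[of "(!) [c, ?f - 1]"] by auto
  then show ?case using FDisj by simp
next
  case (FEx p)
  let ?f = "g (query (LF (FEx p)) c)" and ?w = "g (query (LW (FEx p)) c)"
    and ?p = "\<lambda>m. g (query (LF p) (prod_encode (c, m)))"
  have h: "\<not> (g (query (LF (FEx p)) (u 0)) = Suc (u 1) \<and> g (query (LW (FEx p)) (u 0)) = u 2 \<and>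
      g (query (LF p) (prod_encode (u 0, u 2))) = 0)"
    "\<not> (g (query (LF (FEx p)) (u 0)) = 0 \<and> g (query (LF p) (prod_encode (u 0, u 2))) = Suc (u 1))" for u :: "nat \<Rightarrow> nat"
    using FEx by auto
  have "0 < ?f \<longleftrightarrow> (\<exists>m. 0 < ?p m)"
  proof -
    have "0 < ?p ?w" if "0 < ?f" using that h(1)[of "(!) [c, ?f - 1, ?w]"] by (cases ?f) auto
    moreover have "0 < ?f" if "0 < ?p m" for m
      using that h(2)[of "(!) [c, ?p m - 1, m]"] by (cases "?p m") auto
    ultimately show ?thesis by blast
  qed
  then show ?case using FEx by (simp add: env_of_prod_encode)
next
  case (FAll p)
  let ?f = "g (query (LF (FAll p)) c)" and ?w = "g (query (LW (FAll p)) c)"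
    and ?p = "\<lambda>m. g (query (LF p) (prod_encode (c, m)))"
  have h: "\<not> (g (query (LF (FAll p)) (u 0)) = 0 \<and> g (query (LW (FAll p)) (u 0)) = u 2 \<and>
      g (query (LF p) (prod_encode (u 0, u 2))) = Suc (u 1))"
    "\<not> (g (query (LF (FAll p)) (u 0)) = Suc (u 1) \<and> g (query (LF p) (prod_encode (u 0, u 2))) = 0)" for u :: "nat \<Rightarrow> nat"
    using FAll by auto
  have "0 < ?f \<longleftrightarrow> (\<forall>m. 0 < ?p m)"
    using h(1)[of "(!) [c, ?p ?w - 1, ?w]"] h(2)[of "(!) [c, ?f - 1, m]" for m] by auto
  then show ?case using FAll by (simp add: env_of_prod_encode)
qed

text \<open>The branch of a given interpretation, with Hilbert choices as Skolem witnesses. If there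
  is no witness the choice is some number, but the rules consult it only under the truth value that
  guarantees one.\<close>

fun intended :: "(nat \<Rightarrow> nat \<Rightarrow> nat) \<Rightarrow> (nat \<Rightarrow> nat \<Rightarrow> nat) \<Rightarrow> lab \<Rightarrow> nat \<Rightarrow> nat" where
  "intended F G (LT t) c = teval (env_of c) F G t"
| "intended F G (LF p) c = (if fsat (env_of c) F G p then 1 else 0)"
| "intended F G (LW (FEx p)) c = (SOME m. fsat (shift_env m (env_of c)) F G p)"
| "intended F G (LW (FAll p)) c = (SOME m. \<not> fsat (shift_env m (env_of c)) F G p)"
| "intended F G (LW p) c = 0"
| "intended F G (LGf i) a = G i a"
| "intended F G LAdd c = ptl c + phd c"
| "intended F G LMul c = ptl c * phd c"

lemma intended_unrefuted:
  assumes g: "\<And>l c. g (query l c) = intended F G l c"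
  shows "\<not> refutes base_rules g n (graph F)" "\<not> refutes (form_rules p) g n (graph F)"
proof -
  show "\<not> refutes base_rules g n (graph F)"
    unfolding base_rules_def by (auto simp: g algebra_simps)
  have v: "\<not> refutes (var_rules i) g n (graph F)" for i
    by (induction i) (auto simp: g env_of_0 env_of_Suc)
  have t: "\<not> refutes (term_rules t) g n (graph F)" for t
    by (induction t) (use v in \<open>auto simp: g\<close>)
  show "\<not> refutes (form_rules p) g n (graph F)"
  proof (induction p)
    case (FEx p)
    have w: "fsat (shift_env w e) F G p"
      if "fsat (shift_env m e) F G p" "(SOME m. fsat (shift_env m e) F G p) = w" for m e w
      using that someI[of "\<lambda>m. fsat (shift_env m e) F G p"] by blast
    show ?case using FEx by (auto simp: g env_of_prod_encode split: if_splits dest: w)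
  next
    case (FAll p)
    have w: "\<not> fsat (shift_env w e) F G p"
      if "\<not> fsat (shift_env m e) F G p" "(SOME m. \<not> fsat (shift_env m e) F G p) = w" for m e w
      using that someI[of "\<lambda>m. \<not> fsat (shift_env m e) F G p"] by blast
    show ?case using FAll by (auto simp: g env_of_prod_encode split: if_splits dest: w)
  qed (use t in \<open>auto simp: g split: if_splits\<close>)
qed

theorem normal_form:
  "(\<exists>G. fsat (\<lambda>i. if i = 0 then n else 0) F G p) \<longleftrightarrow>
   (\<exists>g. g 0 = 1 \<and> \<not> refutes (sentence_rules p) g n (graph F))"
proof
  assume "\<exists>G. fsat (\<lambda>i. if i = 0 then n else 0) F G p"
  then obtain G where G: "fsat (\<lambda>i. if i = 0 then n else 0) F G p" ..
  \<comment> \<open>The subtraction undoes the successor in \<open>query\<close>; position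
    \<open>0\<close> is no query and receives the prescribed value.\<close>
  define g where "g q = (if q = 0 then 1 else intended F G (from_nat (ptl q - 1)) (phd q))" for q
  have g: "g (query l c) = intended F G l c" for l c by (simp add: g_def query_def)
  have "\<not> refutes (sentence_rules p) g n (graph F)"
    using intended_unrefuted(1)[where g = g and F = F and G = G and n = n, OF g]
      intended_unrefuted(2)[where g = g and F = F and G = G and n = n and p = p, OF g] G
    by (auto simp: sentence_rules_def g env_of_initial)
  then show "\<exists>g. g 0 = 1 \<and> \<not> refutes (sentence_rules p) g n (graph F)"
    by (intro exI[of _ g]) (simp add: g_def)
next
  assume "\<exists>g. g 0 = 1 \<and> \<not> refutes (sentence_rules p) g n (graph F)"
  then obtain g where g: "\<not> refutes (sentence_rules p) g n (graph F)" by blast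
  then have b: "\<not> refutes base_rules g n (graph F)" "\<not> refutes (form_rules p) g n (graph F)"
    by (simp_all add: sentence_rules_def)
  have h: "u 0 = n \<longrightarrow> g (query (LF p) (prod_encode (0, u 0))) \<noteq> 0" for u :: "nat \<Rightarrow> nat"
    using g by (auto simp: sentence_rules_def)
  have "0 < g (query (LF p) (prod_encode (0, n)))" using h[of "\<lambda>_. n"] by simp
  then show "\<exists>G. fsat (\<lambda>i. if i = 0 then n else 0) F G p"
    using unrefuted_form[OF b] by (auto simp: env_of_initial)
qed

section \<open>The automaton\<close>

text \<open>A specification describes a kind of error. Counter \<open>x\<close> is loaded in one record with the ones (\<open>c_l1\<close>) or
  zeros (\<open>c_l0\<close>) of block \<open>c_lp\<close>, gains \<open>1\<close> with every tag read after it if \<open>c_g\<close>, and is unloaded in a record with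
  the ones (\<open>c_u1\<close>) or zeros (\<open>c_u0\<close>) of block \<open>c_up\<close> and with \<open>c_c\<close> separators; a run can survive this iff
  the amount unloaded is at most the amount loaded. The gain makes up for the growth of the blocks when zeros are counted.
  The two records are the same unless \<open>two\<close>, consecutive unless \<open>skips\<close>; for a \<open>chain\<close> they are joined by a sequence
  of records, each of which has the index of its predecessor as parent.\<close>

datatype cspec = CSpec (c_lp: nat) (c_l1: bool) (c_l0: bool) (c_g: bool)
  (c_up: nat) (c_u1: bool) (c_u0: bool) (c_c: nat)

datatype spec = Spec (two: bool) (skips: bool) (chain: bool) (ltags: "nat set") (utags: "nat set")
  (cs: "nat \<Rightarrow> cspec")

datatype st = Ini | Ch nat | FC nat | Pa bool nat | DSkip | D nat nat nat | Sink

type_synonym config = "st \<times> (nat \<Rightarrow> nat)"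

lemma all_less_4: "(\<forall>x<4. Q x) \<longleftrightarrow> Q 0 \<and> Q 1 \<and> Q 2 \<and> Q (3::nat)"
  by (auto simp: numeral_eq_Suc less_Suc_eq)

text \<open>\<open>FC j\<close> checks that the first four fields of the first record are zero, \<open>Pa m j\<close> follows a branch, \<open>D e ph j\<close> verifies
  the \<open>e\<close>th specification (\<open>ph = 0\<close>: single record, \<open>1\<close>: first record, \<open>2\<close>: skipped record, \<open>3\<close>: link of a
  chain, \<open>4\<close>: last record); \<open>j\<close> is the current block.\<close>

definition e1 :: "nat \<Rightarrow> nat \<Rightarrow> int" where "e1 h x = (if x = h then 1 else 0)"

text \<open>The counters form two pairs, (0, 1) and (2, 3), each for a value and its complement.
  Every block moves the contents of one pair into the other, and the roles alternate.\<close>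

definition src :: "nat \<Rightarrow> nat" where "src j = (if even j then 0 else 2)"
definition dst :: "nat \<Rightarrow> nat" where "dst j = (if even j then 2 else 0)"

lemma src_Suc [simp]: "src (Suc j) = dst j" by (simp add: src_def dst_def)

text \<open>At a link of a chain only the counters 0 and 1 are renewed, since they hold the current
  link; counters 2 and 3 keep what the first record supplied.\<close>

definition loads :: "nat \<Rightarrow> nat \<Rightarrow> bool" where
  "loads ph x \<longleftrightarrow> ph = 0 \<or> ph = 1 \<or> ph = 3 \<and> x < 2"
definition unloads :: "nat \<Rightarrow> nat \<Rightarrow> bool" where
  "unloads ph x \<longleftrightarrow> ph = 0 \<or> ph = 4 \<or> ph = 3 \<and> x < 2"

definition bdelta :: "spec \<Rightarrow> nat \<Rightarrow> nat \<Rightarrow> nat \<Rightarrow> nat \<Rightarrow> int" where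
  "bdelta e ph j b x = (let c = cs e x in
     (if loads ph x \<and> j = c_lp c \<and> (if b = 1 then c_l1 c else c_l0 c) then 1 else 0)
   - (if unloads ph x \<and> j = c_up c \<and> (if b = 1 then c_u1 c else c_u0 c) then 1 else 0))"

text \<open>A step can subtract at most 1 from a counter, so the constant \<open>c_c\<close> is
  charged at as many successive separators behind the unloaded block.\<close>

definition sdelta :: "spec \<Rightarrow> nat \<Rightarrow> nat \<Rightarrow> nat \<Rightarrow> int" where
  "sdelta e ph j x = (let c = cs e x in
     (if unloads ph x \<and> c_up c < j \<and> j \<le> c_up c + c_c c then - 1 else 0))"

definition tdelta :: "spec \<Rightarrow> nat \<Rightarrow> int" where
  "tdelta e x = (if c_g (cs e x) then 1 else 0)"

text \<open>In mode \<open>True\<close> a path run tests the first field of the record against the node it holds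
  and then stores the index of the record; otherwise it keeps the node it holds.\<close>

definition padm :: "bool \<Rightarrow> nat \<Rightarrow> nat \<Rightarrow> nat \<Rightarrow> nat \<Rightarrow> bool" where
  "padm m j b h h' \<longleftrightarrow>
     (if m \<and> j = 0 then h = 1 - b \<and> h' = h else if m \<and> j = 3 then h' = 1 - b else h' = h)"

text \<open>All counting must be over when the last block starts, because a check may be concluded
  anywhere inside it. Within a single record loading has to precede unloading, or the run would get
  stuck.\<close>

definition wf_spec :: "nat \<Rightarrow> spec \<Rightarrow> bool" where
  "wf_spec K e \<longleftrightarrow>
     (\<forall>x<4. c_lp (cs e x) < K - 1 \<and> c_up (cs e x) < K - 1 \<and> c_up (cs e x) + c_c (cs e x) \<le> K - 1) \<and>
     (\<not> two e \<longrightarrow> (\<forall>x<4. c_lp (cs e x) < c_up (cs e x))) \<and>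
     (chain e \<longrightarrow> two e \<and> skips e \<and> cs e 0 = CSpec 3 True False False 0 True False 0 \<and>
        cs e 1 = CSpec 3 False True True 0 False True 0)"

locale automaton =
  fixes K nt :: nat and specs :: "spec list" and live :: "nat set"
  assumes even_K: "even K" and K6: "6 \<le> K"
    and wf_specs: "\<And>e. e \<in> set specs \<Longrightarrow> wf_spec K e"
begin

text \<open>Only the transitions into \<open>Ch\<close> states depend on \<open>n\<close>. Rule
  \<open>PaX\<close> accepts when a block ends while the source pair still holds a unit, so the
  block is too short. In a block that is too long the source pair runs empty and the path run is
  stuck.\<close>

inductive tr :: "nat \<Rightarrow> st \<Rightarrow> nat \<Rightarrow> st \<Rightarrow> (nat \<Rightarrow> int) \<Rightarrow> bool" for n where
  IniP: "tr n Ini 2 (Ch n) (\<lambda>_. 0)"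
| IniD: "tr n Ini 2 DSkip (\<lambda>_. 0)"
| Ch: "i < n \<Longrightarrow> tr n (Ch (Suc i)) 0 (Ch i) (e1 1)"
| ChFC: "3 \<le> b \<Longrightarrow> b < 3 + nt \<Longrightarrow> tr n (Ch 0) b (FC 0) (\<lambda>_. 0)"
| ChPa: "3 \<le> b \<Longrightarrow> b < 3 + nt \<Longrightarrow> tr n (Ch 0) b (Pa False 0) (e1 1)"
| FC0: "j < 4 \<Longrightarrow> tr n (FC j) 0 (FC j) (\<lambda>_. 0)"
| FC1: "j < 4 \<Longrightarrow> tr n (FC j) 1 Sink (\<lambda>_. 0)"
| FCs: "Suc j < 4 \<Longrightarrow> tr n (FC j) 2 (FC (Suc j)) (\<lambda>_. 0)"
| Pab: "j < K \<Longrightarrow> b < 2 \<Longrightarrow> h < 2 \<Longrightarrow> h' < 2 \<Longrightarrow> padm m j b h h' \<Longrightarrow>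
    tr n (Pa m j) b (Pa m j) (\<lambda>x. e1 (dst j + h') x - e1 (src j + h) x)"
| Pas: "Suc j < K \<Longrightarrow> tr n (Pa m j) 2 (Pa m (Suc j)) (\<lambda>_. 0)"
| Pat: "3 \<le> b \<Longrightarrow> b < 3 + nt \<Longrightarrow> m' \<longrightarrow> b - 3 \<in> live \<Longrightarrow> tr n (Pa m (K - 1)) b (Pa m' 0) (e1 1)"
| PaX: "j < K \<Longrightarrow> 2 \<le> b \<Longrightarrow> b < 3 + nt \<Longrightarrow> h < 2 \<Longrightarrow> tr n (Pa m j) b Sink (\<lambda>x. - e1 (src j + h) x)"
| DSk: "b < 3 + nt \<Longrightarrow> tr n DSkip b DSkip (\<lambda>_. 0)"
| D1: "e < length specs \<Longrightarrow> two (specs ! e) \<Longrightarrow> 3 \<le> b \<Longrightarrow> b < 3 + nt \<Longrightarrow> b - 3 \<in> ltags (specs ! e) \<Longrightarrow>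
    tr n DSkip b (D e 1 0) (\<lambda>_. 0)"
| D0: "e < length specs \<Longrightarrow> \<not> two (specs ! e) \<Longrightarrow> 3 \<le> b \<Longrightarrow> b < 3 + nt \<Longrightarrow> b - 3 \<in> utags (specs ! e) \<Longrightarrow>
    tr n DSkip b (D e 0 0) (\<lambda>_. 0)"
| Db: "e < length specs \<Longrightarrow> ph \<le> 4 \<Longrightarrow> j < K \<Longrightarrow> b < 2 \<Longrightarrow>
    tr n (D e ph j) b (D e ph j) (bdelta (specs ! e) ph j b)"
| Ds: "e < length specs \<Longrightarrow> ph \<le> 4 \<Longrightarrow> Suc j < K \<Longrightarrow>
    tr n (D e ph j) 2 (D e ph (Suc j)) (sdelta (specs ! e) ph (Suc j))"
| Dt: "e < length specs \<Longrightarrow> two (specs ! e) \<Longrightarrow> ph \<in> {1, 2, 3} \<Longrightarrow> ph' \<in> {2, 3, 4} \<Longrightarrow>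
    ph' = 2 \<longrightarrow> skips (specs ! e) \<Longrightarrow> ph' = 3 \<longrightarrow> chain (specs ! e) \<Longrightarrow>
    ph' = 4 \<longrightarrow> b - 3 \<in> utags (specs ! e) \<Longrightarrow> 3 \<le> b \<Longrightarrow> b < 3 + nt \<Longrightarrow>
    tr n (D e ph (K - 1)) b (D e ph' 0) (tdelta (specs ! e))"
| Dx: "e < length specs \<Longrightarrow> ph \<in> {0, 4} \<Longrightarrow> b < 3 + nt \<Longrightarrow> tr n (D e ph (K - 1)) b Sink (\<lambda>_. 0)"
| Sk: "b < 3 + nt \<Longrightarrow> tr n Sink b Sink (\<lambda>_. 0)"

inductive_cases tr_Ini: "tr n Ini b s' d"
inductive_cases tr_Ch: "tr n (Ch i) b s' d"
inductive_cases tr_FC: "tr n (FC j) b s' d"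
inductive_cases tr_Pa: "tr n (Pa m j) b s' d"
inductive_cases tr_DSkip: "tr n DSkip b s' d"
inductive_cases tr_D: "tr n (D e ph j) b s' d"

definition step :: "nat \<Rightarrow> (nat \<Rightarrow> nat) \<Rightarrow> nat \<Rightarrow> config \<Rightarrow> config \<Rightarrow> bool" where
  "step n w p \<gamma> \<gamma>' \<longleftrightarrow> (\<exists>d. tr n (fst \<gamma>) (w p) (fst \<gamma>') d \<and>
     (\<forall>x<4. int (snd \<gamma>' x) = int (snd \<gamma> x) + d x))"

section \<open>Finite runs and acceptance\<close>

inductive reach :: "nat \<Rightarrow> (nat \<Rightarrow> nat) \<Rightarrow> nat \<Rightarrow> config \<Rightarrow> nat \<Rightarrow> config \<Rightarrow> bool" for n w p \<gamma> where
  refl: "reach n w p \<gamma> p \<gamma>"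
| step: "reach n w p \<gamma> q \<gamma>' \<Longrightarrow> step n w q \<gamma>' \<gamma>'' \<Longrightarrow> reach n w p \<gamma> (Suc q) \<gamma>''"

lemma reach_trans: "reach n w p \<gamma> q \<gamma>' \<Longrightarrow> reach n w q \<gamma>' r \<gamma>'' \<Longrightarrow> reach n w p \<gamma> r \<gamma>''"
  by (rotate_tac, induction rule: reach.induct) (auto intro: reach.step)

lemma reach_le: "reach n w p \<gamma> q \<gamma>' \<Longrightarrow> p \<le> q"
  by (induction rule: reach.induct) auto

lemma reach_same: "reach n w p \<gamma> p \<gamma>' \<Longrightarrow> \<gamma>' = \<gamma>"
  by (erule reach.cases) (auto dest: reach_le)

lemma reach_1: "step n w p \<gamma> \<gamma>' \<Longrightarrow> reach n w p \<gamma> (Suc p) \<gamma>'"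
  by (rule reach.step[OF reach.refl])

lemma reach_head:
  "reach n w p \<gamma> q \<gamma>' \<Longrightarrow> p < q \<Longrightarrow> \<exists>\<gamma>1. step n w p \<gamma> \<gamma>1 \<and> reach n w (Suc p) \<gamma>1 q \<gamma>'"
proof (induction rule: reach.induct)
  case refl
  then show ?case by simp
next
  case (step q \<gamma>' \<gamma>'')
  show ?case
  proof (cases "p < q")
    case True
    then show ?thesis using step by (blast intro: reach.step)
  next
    case False
    then have "p = q" using reach_le[OF step.hyps(1)] by simp
    moreover from this have "\<gamma>' = \<gamma>" using step.hyps(1) reach_same by blast
    ultimately show ?thesis using step.hyps(2) by (blast intro: reach.refl)
  qed
qed

definition init :: config where "init = (Ini, \<lambda>_. 0)"

definition Acc :: "st set" where "Acc = {Sink, Pa True 0}"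

definition accepted :: "nat \<Rightarrow> (nat \<Rightarrow> nat) \<Rightarrow> bool" where
  "accepted n w \<longleftrightarrow> (\<exists>run. run 0 = init \<and> (\<forall>p. step n w p (run p) (run (Suc p))) \<and>
     (\<exists>\<^sub>\<infinity>p. fst (run p) \<in> Acc))"

definition lang :: "nat \<Rightarrow> (nat \<Rightarrow> nat) set" where
  "lang n = {w \<in> topspace (cantor (3 + nt)). accepted n w}"

text \<open>Glues finite segments between checkpoints \<open>J\<close> into one infinite run. Runs
  advance letter by letter, so the dependent choice carries the distance to the next checkpoint
  along with the configuration.\<close>

lemma acceptedI:
  assumes r: "reach n w 0 init p0 \<gamma>0" and J0: "J p0 \<gamma>0"
    and acc: "\<And>p \<gamma>. J p \<gamma> \<Longrightarrow> fst \<gamma> \<in> Acc"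
    and next_J: "\<And>p \<gamma>. J p \<gamma> \<Longrightarrow> \<exists>p'>p. \<exists>\<gamma>'. reach n w p \<gamma> p' \<gamma>' \<and> J p' \<gamma>'"
  shows "accepted n w"
proof -
  define Pr where "Pr q y \<longleftrightarrow> (\<exists>\<gamma>'. reach n w q (fst y) (q + snd y) \<gamma>' \<and> J (q + snd y) \<gamma>')"
    for q and y :: "config \<times> nat"
  define R where "R q y z \<longleftrightarrow> step n w q (fst y) (fst z) \<and> (0 < snd y \<longrightarrow> snd z = snd y - 1)"
    for q and y z :: "config \<times> nat"
  have nx: "\<exists>z. Pr (Suc q) z \<and> R q y z" if P: "Pr q y" for q y
  proof -
    obtain \<gamma> d where y: "y = (\<gamma>, d)" by (cases y)
    obtain \<gamma>' where g: "reach n w q \<gamma> (q + d) \<gamma>'" "J (q + d) \<gamma>'" using P y by (auto simp: Pr_def)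
    show ?thesis
    proof (cases d)
      case 0
      with g have J: "J q \<gamma>" by (auto dest: reach_same)
      from next_J[OF this] obtain p' \<gamma>' where p': "q < p'" "reach n w q \<gamma> p' \<gamma>'" "J p' \<gamma>'" by blast
      from reach_head[OF p'(2,1)] obtain \<gamma>1 where "step n w q \<gamma> \<gamma>1" "reach n w (Suc q) \<gamma>1 p' \<gamma>'" by blast
      then have "Pr (Suc q) (\<gamma>1, p' - Suc q) \<and> R q y (\<gamma>1, p' - Suc q)"
        using p' 0 y by (auto simp: Pr_def R_def simp del: split_paired_Ex)
      then show ?thesis by blast
    next
      case (Suc d')
      from reach_head[OF g(1)] Suc obtain \<gamma>1 where "step n w q \<gamma> \<gamma>1" "reach n w (Suc q) \<gamma>1 (q + d) \<gamma>'" by auto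
      then have "Pr (Suc q) (\<gamma>1, d') \<and> R q y (\<gamma>1, d')"
        using g Suc y by (auto simp: Pr_def R_def simp del: split_paired_Ex)
      then show ?thesis by blast
    qed
  qed
  have base: "\<exists>y. Pr 0 y \<and> ((0::nat) = 0 \<longrightarrow> fst y = init)"
    using r J0 by (intro exI[of _ "(init, p0)"]) (auto simp: Pr_def simp del: split_paired_Ex)
  have stp: "\<exists>z. (Pr (Suc q) z \<and> (Suc q = 0 \<longrightarrow> fst z = init)) \<and> R q y z"
    if "Pr q y \<and> (q = 0 \<longrightarrow> fst y = init)" for y q
    using nx[of q y] that by auto
  obtain f where f: "\<And>q. Pr q (f q)" "\<And>q. R q (f q) (f (Suc q))" "fst (f 0) = init"
    using dependent_nat_choice[of "\<lambda>q y. Pr q y \<and> (q = 0 \<longrightarrow> fst y = init)" R, OF base stp] by blast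
  have "\<exists>p\<ge>q. fst (fst (f p)) \<in> Acc" for q
  proof (induction "snd (f q)" arbitrary: q)
    case 0
    then have "J q (fst (f q))" using f(1)[of q] by (auto simp: Pr_def dest: reach_same)
    then show ?case using acc by blast
  next
    case (Suc d)
    have "snd (f (Suc q)) = d" using f(2)[of q] Suc(2) by (auto simp: R_def)
    from Suc(1)[OF this[symmetric]] show ?case using Suc_leD by blast
  qed
  then have "\<exists>\<^sub>\<infinity>p. fst (fst (f p)) \<in> Acc" by (simp add: INFM_nat_le)
  moreover have "step n w p (fst (f p)) (fst (f (Suc p)))" for p
    using f(2)[of p] by (simp add: R_def)
  ultimately show ?thesis unfolding accepted_def using f(3)
    by (intro exI[of _ "\<lambda>p. fst (f p)"]) auto
qed

lemma accepted_if_reach_Sink: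
  assumes w: "w \<in> topspace (cantor (3 + nt))" and r: "reach n w 0 init p \<gamma>" and s: "fst \<gamma> = Sink"
  shows "accepted n w"
proof (rule acceptedI[where J = "\<lambda>p \<gamma>. fst \<gamma> = Sink", OF r s])
  show "\<And>p \<gamma>. fst \<gamma> = Sink \<Longrightarrow> fst \<gamma> \<in> Acc" by (simp add: Acc_def)
  fix p and \<gamma> :: config assume "fst \<gamma> = Sink"
  moreover have "w p < 3 + nt" using w by (simp add: cantor_def PiE_def Pi_def)
  ultimately have "step n w p \<gamma> \<gamma>" unfolding step_def by (auto intro: tr.Sk)
  then show "\<exists>p'>p. \<exists>\<gamma>'. reach n w p \<gamma> p' \<gamma>' \<and> fst \<gamma>' = Sink"
    using \<open>fst \<gamma> = Sink\<close> reach_1 by blast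
qed

section \<open>The geometry of exact words\<close>

primrec bp :: "nat \<Rightarrow> nat \<Rightarrow> nat" where
  "bp n 0 = Suc n"
| "bp n (Suc b) = bp n b + Suc (Suc n + b div K)"

text \<open>Blocks are numbered through all records: block \<open>j\<close> of record
  \<open>t\<close> is number \<open>t * K + j\<close>. The letter at \<open>bp n b\<close> opens
  block \<open>b\<close>; for the first block of a record it is the tag.\<close>

definition NN :: "nat \<Rightarrow> nat \<Rightarrow> nat" where "NN n b = Suc n + b div K"

lemma bp_Suc: "bp n (Suc b) = bp n b + Suc (NN n b)" by (simp add: NN_def)
declare bp.simps(2) [simp del]

lemma NN_rec: "j < K \<Longrightarrow> NN n (t * K + j) = Suc n + t"
  using K6 by (simp add: NN_def div_mult_self3)

lemma bp_mono: "b \<le> b' \<Longrightarrow> bp n b \<le> bp n b'"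
  by (induction b' rule: dec_induct) (auto simp: bp_Suc)

lemma bp_less: "b < b' \<Longrightarrow> bp n b + NN n b < bp n b'"
  using bp_mono[of "Suc b" b' n] by (simp add: bp_Suc)

lemma bp_cover:
  assumes "n < p" shows "\<exists>b i. p = bp n b + i \<and> i \<le> NN n b"
  using assms
proof (induction p)
  case (Suc p)
  show ?case
  proof (cases "n < p")
    case True
    then obtain b i where b: "p = bp n b + i" "i \<le> NN n b" using Suc by blast
    show ?thesis
    proof (cases "i = NN n b")
      case True
      then show ?thesis using b by (intro exI[of _ "Suc b"] exI[of _ 0]) (simp add: bp_Suc)
    next
      case False
      then show ?thesis using b by (intro exI[of _ b] exI[of _ "Suc i"]) simp
    qed
  next
    case False
    then show ?thesis using Suc by (intro exI[of _ 0] exI[of _ 0]) simp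
  qed
qed simp

lemma bp_unique:
  assumes "bp n b + i = bp n b' + i'" "i \<le> NN n b" "i' \<le> NN n b'"
  shows "b = b' \<and> i = i'"
proof -
  have "\<not> b < b'" "\<not> b' < b" using bp_less[of b b' n] bp_less[of b' b n] assms by linarith+
  then show ?thesis using assms by auto
qed

definition sep_ok :: "nat \<Rightarrow> nat \<Rightarrow> bool" where
  "sep_ok b l \<longleftrightarrow> (if b mod K = 0 then 3 \<le> l \<and> l < 3 + nt else l = 2)"

text \<open>Each clause concerns a single letter at a position fixed in advance, which makes the set
  of exact words closed.\<close>

definition exact :: "nat \<Rightarrow> (nat \<Rightarrow> nat) \<Rightarrow> bool" where
  "exact n w \<longleftrightarrow> w 0 = 2 \<and> (\<forall>p. 0 < p \<and> p \<le> n \<longrightarrow> w p = 0) \<and>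
     (\<forall>b. sep_ok b (w (bp n b)) \<and> (\<forall>i<NN n b. w (bp n b + Suc i) < 2))"

definition ones :: "nat \<Rightarrow> (nat \<Rightarrow> nat) \<Rightarrow> nat \<Rightarrow> nat \<Rightarrow> nat" where
  "ones n w b i = (\<Sum>i'<i. w (bp n b + Suc i'))"

lemma ones_0 [simp]: "ones n w b 0 = 0"
  and ones_Suc: "ones n w b (Suc i) = ones n w b i + w (bp n b + Suc i)"
  by (simp_all add: ones_def)

text \<open>Fields 0 to 3 are meant to be parent, last entry, level and number of \<open>t\<close>;
  field \<open>4 + a\<close> is meant to be the value of variable \<open>a\<close>.\<close>

definition X :: "nat \<Rightarrow> (nat \<Rightarrow> nat) \<Rightarrow> nat \<Rightarrow> nat \<Rightarrow> nat" where
  "X n w t j = ones n w (t * K + j) (Suc n + t)"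

definition tag :: "nat \<Rightarrow> (nat \<Rightarrow> nat) \<Rightarrow> nat \<Rightarrow> nat" where
  "tag n w t = w (bp n (t * K)) - 3"

lemma exact_in_topspace:
  assumes "exact n w" "0 < nt" shows "w \<in> topspace (cantor (3 + nt))"
proof -
  have "w p < 3 + nt" for p
  proof (cases "n < p")
    case True
    then obtain b i where p: "p = bp n b + i" "i \<le> NN n b" using bp_cover by blast
    show ?thesis
    proof (cases i)
      case 0
      then have "sep_ok b (w p)" using assms p by (simp add: exact_def)
      then show ?thesis by (auto simp: sep_ok_def split: if_splits)
    next
      case (Suc i')
      then have "w p < 2" using assms p by (auto simp: exact_def)
      then show ?thesis by simp
    qed
  next
    case False
    then show ?thesis using assms by (cases "p = 0") (auto simp: exact_def)
  qed
  then show ?thesis by (simp add: cantor_def PiE_def)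
qed

lemma ones_le:
  assumes "exact n w" "i \<le> NN n b" shows "ones n w b i \<le> i"
  using assms(2)
proof (induction i)
  case (Suc i)
  have "w (bp n b + Suc i) < 2" using assms(1) Suc.prems by (auto simp: exact_def)
  then show ?case using Suc by (auto simp: ones_Suc)
qed simp

lemma X_le: "exact n w \<Longrightarrow> j < K \<Longrightarrow> X n w t j \<le> Suc n + t"
  using ones_le[of n w "Suc n + t" "t * K + j"] by (simp add: X_def NN_rec)

lemma Suc_mod_K: "Suc b mod K = (if Suc (b mod K) = K then 0 else Suc (b mod K))"
  by (simp add: mod_Suc)

lemma mod_K_less: "b mod K < K" using K6 by simp

lemma NN_Suc: "NN n (Suc b) = (if Suc (b mod K) = K then Suc (NN n b) else NN n b)"
  using K6 by (simp add: NN_def div_Suc Suc_mod_K)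

text \<open>Evenness of \<open>K\<close> enters here: after a whole record the value is back in the
  pair in which it started.\<close>

lemma dst_last: "dst (K - 1) = 0" "src 0 = 0"
  using even_K K6 by (auto simp: dst_def src_def)

lemma src_dst: "src j = 0 \<and> dst j = 2 \<or> src j = 2 \<and> dst j = 0"
  by (simp add: src_def dst_def)

section \<open>Accepting runs on words without errors follow a branch\<close>

definition dead :: "st \<Rightarrow> bool" where
  "dead s \<longleftrightarrow> s = DSkip \<or> (\<exists>e ph j. s = D e ph j) \<or> (\<exists>j. s = FC j)"

lemma dead_step: "tr n s b s' d \<Longrightarrow> dead s \<Longrightarrow> dead s' \<or> s' = Sink"
  by (erule tr.cases) (auto simp: dead_def)

lemma dead_not_Acc: "dead s \<Longrightarrow> s \<notin> Acc" by (auto simp: dead_def Acc_def)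

lemma tr_Pa_letter:
  "tr n (Pa m j) b s' d \<Longrightarrow> b < 2 \<Longrightarrow> \<exists>h h'. h < 2 \<and> h' < 2 \<and> padm m j b h h' \<and> s' = Pa m j \<and>
     d = (\<lambda>x. e1 (dst j + h') x - e1 (src j + h) x)"
  by (erule tr_Pa) auto

lemma tr_Pa_cases:
  "tr n (Pa m j) b s' d \<Longrightarrow> s' \<noteq> Sink \<Longrightarrow>
     (\<exists>h h'. h < 2 \<and> h' < 2 \<and> d = (\<lambda>x. e1 (dst j + h') x - e1 (src j + h) x)) \<or>
     (Suc j < K \<and> b = 2 \<and> s' = Pa m (Suc j) \<and> d = (\<lambda>_. 0)) \<or>
     (j = K - 1 \<and> 3 \<le> b \<and> b < 3 + nt \<and> d = e1 1 \<and>
          (\<exists>m'. s' = Pa m' 0 \<and> (m' \<longrightarrow> b - 3 \<in> live)))"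
  by (erule tr_Pa) auto

lemma transfer_counts:
  assumes "\<forall>x<4. int (c' x) = int (c x) + (e1 (dst j + h') x - e1 (src j + h) x)" "h < 2" "h' < 2"
  shows "c' (src j) = c (src j) - (1 - h)" "c' (Suc (src j)) = c (Suc (src j)) - h"
    "c' (dst j) = c (dst j) + (1 - h')" "c' (Suc (dst j)) = c (Suc (dst j)) + h'"
    "h = 0 \<longrightarrow> 0 < c (src j)" "h = 1 \<longrightarrow> 0 < c (Suc (src j))"
proof -
  have h: "h = 0 \<or> h = 1" "h' = 0 \<or> h' = 1" using assms(2,3) by auto
  note a = assms(1)[unfolded all_less_4]
  have "c' (src j) = c (src j) - (1 - h) \<and> c' (Suc (src j)) = c (Suc (src j)) - h \<and>
    c' (dst j) = c (dst j) + (1 - h') \<and> c' (Suc (dst j)) = c (Suc (dst j)) + h' \<and>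
    (h = 0 \<longrightarrow> 0 < c (src j)) \<and> (h = 1 \<longrightarrow> 0 < c (Suc (src j)))"
  proof (cases "even j")
    case True
    then show ?thesis using h a by (elim disjE) (auto simp: e1_def src_def dst_def)
  next
    case False
    then show ?thesis using h a by (elim disjE) (auto simp: e1_def src_def dst_def)
  qed
  then show "c' (src j) = c (src j) - (1 - h)" "c' (Suc (src j)) = c (Suc (src j)) - h"
    "c' (dst j) = c (dst j) + (1 - h')" "c' (Suc (dst j)) = c (Suc (dst j)) + h'"
    "h = 0 \<longrightarrow> 0 < c (src j)" "h = 1 \<longrightarrow> 0 < c (Suc (src j))" by blast+
qed

text \<open>\<open>m b\<close> is the mode of the run in block \<open>b\<close> and \<open>h b\<close> the node it holds there.\<close>

lemma path_run_sound_blocks: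
  assumes w: "w \<in> topspace (cantor (3 + nt))"
    and noSink: "\<And>p \<gamma>. reach n w 0 init p \<gamma> \<Longrightarrow> fst \<gamma> \<noteq> Sink"
    and acc: "accepted n w"
  shows "exact n w \<and> (\<exists>m h. h 0 = 0 \<and>
    (\<forall>b. (m b \<and> b mod K = 0 \<longrightarrow> h b = ones n w b (NN n b)) \<and>
         h (Suc b) = (if m b \<and> b mod K = 3 then ones n w b (NN n b) else h b) \<and>
         (Suc b mod K \<noteq> 0 \<longrightarrow> m (Suc b) = m b) \<and>
         (Suc b mod K = 0 \<and> m (Suc b) \<longrightarrow> w (bp n (Suc b)) - 3 \<in> live)) \<and>
    \<not> m 0 \<and> (\<exists>\<^sub>\<infinity>b. m b))"
proof -
  obtain run where r0: "run 0 = init" and rs: "\<And>p. step n w p (run p) (run (Suc p))"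
    and inf: "\<exists>\<^sub>\<infinity>p. fst (run p) \<in> Acc"
    using acc unfolding accepted_def by blast
  define s where "s p = fst (run p)" for p
  define c where "c p = snd (run p)" for p
  have wk: "w p < 3 + nt" for p using w by (simp add: cantor_def PiE_def Pi_def)
  have rr: "reach n w 0 init p (run p)" for p
    by (induction p) (auto simp: r0[symmetric] intro: reach.refl reach.step rs)
  have ns: "s p \<noteq> Sink" for p using noSink[OF rr] by (simp add: s_def)
  have t: "\<exists>d. tr n (s p) (w p) (s (Suc p)) d \<and> (\<forall>x<4. int (c (Suc p) x) = int (c p x) + d x)" for p
    using rs[of p] by (simp add: step_def s_def c_def)
  \<comment> \<open>Checking states can be left only towards \<open>Sink\<close>, which is excluded
    here, and they are not accepting. So an accepting run must be a path run.\<close>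
  have nd: "\<not> dead (s p)" for p
  proof
    assume d: "dead (s p)"
    have "dead (s (p + i))" for i
    proof (induction i)
      case (Suc i)
      obtain d where "tr n (s (p + i)) (w (p + i)) (s (Suc (p + i))) d" using t by blast
      from dead_step[OF this Suc] show ?case using ns[of "Suc (p + i)"] by simp
    qed (use d in simp)
    then have "s q \<notin> Acc" if "p \<le> q" for q using dead_not_Acc[of "s q"] \<open>\<And>i. dead (s (p + i))\<close>[of "q - p"] that by simp
    then show False using inf unfolding INFM_nat_le s_def by blast
  qed
  \<comment> \<open>If a separator came while the source pair is nonempty, \<open>PaX\<close> would
    offer another run that reaches \<open>Sink\<close>.\<close>
  have short: "False" if sp: "s p = Pa m j" and j: "j < K" and b: "2 \<le> w p" and pos: "0 < c p (src j + h)" "h < 2" for p m j h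
  proof -
    let ?c = "(c p)(src j + h := c p (src j + h) - 1)"
    have "tr n (Pa m j) (w p) Sink (\<lambda>x. - e1 (src j + h) x)"
      using j b wk[of p] pos by (intro tr.PaX) auto
    then have "step n w p (run p) (Sink, ?c)"
      unfolding step_def using sp pos by (auto simp: s_def c_def e1_def)
    then show False using noSink[of "Suc p" "(Sink, ?c)"] rr[of p] reach.step by fastforce
  qed
  have ini: "w 0 = 2 \<and> s 1 = Ch n \<and> (\<forall>x<4. c 1 x = 0)"
  proof -
    have s0: "s 0 = Ini" "c 0 = (\<lambda>_. 0)" using r0 by (simp_all add: s_def c_def init_def)
    obtain d where d: "tr n Ini (w 0) (s (Suc 0)) d" "\<forall>x<4. int (c (Suc 0) x) = int (c 0 x) + d x"
      using t[of 0] s0 by auto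
    from d(1) show ?thesis
      by (rule tr_Ini) (use d(2) s0 nd[of 1] in \<open>auto simp: dead_def\<close>)
  qed
  have ch: "i \<le> n \<Longrightarrow> s (Suc i) = Ch (n - i) \<and> c (Suc i) 1 = i \<and> c (Suc i) 0 = 0 \<and> c (Suc i) 2 = 0 \<and> c (Suc i) 3 = 0
      \<and> (\<forall>p. 0 < p \<and> p \<le> i \<longrightarrow> w p = 0)" for i
  proof (induction i)
    case 0
    then show ?case using ini by auto
  next
    case (Suc i)
    then have IH: "s (Suc i) = Ch (n - i)" "c (Suc i) 1 = i" "c (Suc i) 0 = 0" "c (Suc i) 2 = 0" "c (Suc i) 3 = 0"
      "\<forall>p. 0 < p \<and> p \<le> i \<longrightarrow> w p = 0" by auto
    obtain d where d: "tr n (Ch (n - i)) (w (Suc i)) (s (Suc (Suc i))) d"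
      "\<forall>x<4. int (c (Suc (Suc i)) x) = int (c (Suc i) x) + d x"
      using t[of "Suc i"] IH by auto
    have "n - i = Suc (n - Suc i)" using Suc.prems by simp
    with d(1) have "w (Suc i) = 0 \<and> s (Suc (Suc i)) = Ch (n - Suc i) \<and> d = e1 1"
      by (auto elim!: tr_Ch)
    then show ?case using IH d(2)[unfolded all_less_4] by (auto simp: e1_def le_Suc_eq)
  qed
  \<comment> \<open>The situation right after the letter that opens block \<open>b\<close>: the
    block length is split over the source pair and the target pair is empty.\<close>
  define BI where "BI b \<longleftrightarrow> (\<exists>m. s (Suc (bp n b)) = Pa m (b mod K)) \<and>
      c (Suc (bp n b)) (src (b mod K)) + c (Suc (bp n b)) (Suc (src (b mod K))) = NN n b \<and>
      c (Suc (bp n b)) (dst (b mod K)) = 0 \<and> c (Suc (bp n b)) (Suc (dst (b mod K))) = 0" for b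
  have bi0: "BI 0 \<and> s (Suc (bp n 0)) = Pa False 0 \<and> c (Suc (bp n 0)) 0 = 0 \<and> sep_ok 0 (w (bp n 0))"
  proof -
    have c1: "s (Suc n) = Ch 0" "c (Suc n) 1 = n" "c (Suc n) 0 = 0" "c (Suc n) 2 = 0" "c (Suc n) 3 = 0"
      using ch[of n] by auto
    obtain d where d: "tr n (Ch 0) (w (Suc n)) (s (Suc (Suc n))) d"
      "\<forall>x<4. int (c (Suc (Suc n)) x) = int (c (Suc n) x) + d x"
      using t[of "Suc n"] c1 by auto
    have "3 \<le> w (Suc n) \<and> w (Suc n) < 3 + nt \<and> s (Suc (Suc n)) = Pa False 0 \<and> d = e1 1"
      using d(1) nd[of "Suc (Suc n)"] by (auto elim!: tr_Ch simp: dead_def)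
    moreover from this have "c (Suc (Suc n)) 0 = 0" "c (Suc (Suc n)) 1 = Suc n"
      "c (Suc (Suc n)) 2 = 0" "c (Suc (Suc n)) 3 = 0"
      using d(2)[unfolded all_less_4] c1 by (auto simp: e1_def)
    ultimately show ?thesis
      by (auto simp add: BI_def NN_def src_def dst_def sep_ok_def numeral_3_eq_3 numeral_2_eq_2)
  qed
  have block: "(\<forall>i'<i. w (bp n b + Suc i') < 2) \<and> s (bp n b + Suc i) = Pa m (b mod K) \<and>
      c (bp n b + Suc i) (src (b mod K)) + c (bp n b + Suc i) (Suc (src (b mod K))) + i = NN n b \<and>
      c (bp n b + Suc i) (dst (b mod K)) + c (bp n b + Suc i) (Suc (dst (b mod K))) = i \<and>
      (\<not> (m \<and> b mod K = 3) \<longrightarrow> c (bp n b + Suc i) (src (b mod K)) + c (bp n b + Suc i) (dst (b mod K))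
         = c (Suc (bp n b)) (src (b mod K))) \<and>
      (m \<and> (b mod K = 0 \<or> b mod K = 3) \<longrightarrow> c (bp n b + Suc i) (dst (b mod K)) = ones n w b i)"
    if BI: "BI b" and m: "s (Suc (bp n b)) = Pa m (b mod K)" and i: "i \<le> NN n b" for b m i
    using i
  proof (induction i)
    case 0
    have "c (Suc (bp n b)) (src (b mod K)) + c (Suc (bp n b)) (Suc (src (b mod K))) = NN n b"
      "c (Suc (bp n b)) (dst (b mod K)) = 0" "c (Suc (bp n b)) (Suc (dst (b mod K))) = 0"
      using BI unfolding BI_def by blast+
    then show ?case using m by simp
  next
    case (Suc i)
    let ?p = "bp n b + Suc i" and ?j = "b mod K"
    have IH: "\<forall>i'<i. w (bp n b + Suc i') < 2" "s ?p = Pa m ?j"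
      "c ?p (src ?j) + c ?p (Suc (src ?j)) + i = NN n b"
      "c ?p (dst ?j) + c ?p (Suc (dst ?j)) = i"
      "\<not> (m \<and> ?j = 3) \<longrightarrow> c ?p (src ?j) + c ?p (dst ?j) = c (Suc (bp n b)) (src ?j)"
      "m \<and> (?j = 0 \<or> ?j = 3) \<longrightarrow> c ?p (dst ?j) = ones n w b i"
      using Suc.IH[OF Suc_leD[OF Suc.prems]] by - (elim conjE, assumption)+
    have lt: "w ?p < 2"
    proof (rule ccontr)
      assume "\<not> w ?p < 2"
      then have "2 \<le> w ?p" by simp
      moreover have "0 < c ?p (src ?j + 0) \<or> 0 < c ?p (src ?j + 1)" using IH(3) Suc.prems by auto
      ultimately show False using short[OF IH(2) mod_K_less, of 0] short[OF IH(2) mod_K_less, of 1] by auto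
    qed
    obtain d where d: "tr n (Pa m ?j) (w ?p) (s (Suc ?p)) d"
      "\<forall>x<4. int (c (Suc ?p) x) = int (c ?p x) + d x" using t[of ?p] IH(2) by auto
    obtain h h' where h: "h < 2" "h' < 2" "padm m ?j (w ?p) h h'" "s (Suc ?p) = Pa m ?j"
      "d = (\<lambda>x. e1 (dst ?j + h') x - e1 (src ?j + h) x)"
      using tr_Pa_letter[OF d(1) lt] by blast
    have hv: "h = 0 \<or> h = 1" "h' = 0 \<or> h' = 1" using h(1,2) by auto
    have wv: "w ?p = 0 \<or> w ?p = 1" using lt by auto
    note c4 = transfer_counts[OF d(2)[unfolded h(5)] h(1,2)]
    have "\<forall>i'<Suc i. w (bp n b + Suc i') < 2" using IH(1) lt by (auto simp: less_Suc_eq)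
    moreover have "c (Suc ?p) (src ?j) + c (Suc ?p) (Suc (src ?j)) + Suc i = NN n b"
      using IH(3) c4 hv by auto
    moreover have "c (Suc ?p) (dst ?j) + c (Suc ?p) (Suc (dst ?j)) = Suc i"
      using IH(4) c4 hv by auto
    moreover have "\<not> (m \<and> ?j = 3) \<longrightarrow> c (Suc ?p) (src ?j) + c (Suc ?p) (dst ?j) = c (Suc (bp n b)) (src ?j)"
    proof
      assume a: "\<not> (m \<and> ?j = 3)"
      then have "h' = h" using h(3) by (auto simp: padm_def split: if_splits)
      then show "c (Suc ?p) (src ?j) + c (Suc ?p) (dst ?j) = c (Suc (bp n b)) (src ?j)"
        using IH(5) a c4 hv by auto
    qed
    moreover have "m \<and> (?j = 0 \<or> ?j = 3) \<longrightarrow> c (Suc ?p) (dst ?j) = ones n w b (Suc i)"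
    proof
      assume a: "m \<and> (?j = 0 \<or> ?j = 3)"
      then have "h' = 1 - w ?p" using h(3) by (auto simp: padm_def split: if_splits)
      then show "c (Suc ?p) (dst ?j) = ones n w b (Suc i)"
        using IH(6) a c4 wv by (auto simp: ones_Suc)
    qed
    ultimately show ?case using h(4) by simp
  qed
  have nxt: "BI (Suc b) \<and> sep_ok (Suc b) (w (bp n (Suc b))) \<and>
      c (Suc (bp n (Suc b))) (src (Suc b mod K)) = c (bp n b + Suc (NN n b)) (dst (b mod K)) \<and>
      (Suc b mod K \<noteq> 0 \<longrightarrow> s (Suc (bp n (Suc b))) = Pa m (Suc b mod K)) \<and>
      (Suc b mod K = 0 \<and> s (Suc (bp n (Suc b))) = Pa True 0 \<longrightarrow> w (bp n (Suc b)) - 3 \<in> live)"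
    if BI: "BI b" and m: "s (Suc (bp n b)) = Pa m (b mod K)" for b m
  proof -
    let ?p = "bp n b + Suc (NN n b)" and ?j = "b mod K"
    have p: "bp n (Suc b) = ?p" by (simp add: bp_Suc)
    have e: "s ?p = Pa m ?j" "c ?p (src ?j) = 0" "c ?p (Suc (src ?j)) = 0"
      "c ?p (dst ?j) + c ?p (Suc (dst ?j)) = NN n b"
      using block[OF that, of "NN n b"] by auto
    obtain d where d: "tr n (Pa m ?j) (w ?p) (s (Suc ?p)) d"
      "\<forall>x<4. int (c (Suc ?p) x) = int (c ?p x) + d x" using t[of ?p] e(1) by auto
    \<comment> \<open>After \<open>NN n b\<close> letters the source pair is exhausted and no
      further transfer is possible, hence the block must end here.\<close>
    have nb: False if a: "h < 2" "d = (\<lambda>x. e1 (dst ?j + h') x - e1 (src ?j + h) x)" "h' < 2" for h h'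
      using transfer_counts(5,6)[OF d(2)[unfolded a(2)] a(1,3)] e(2,3) a(1) by auto
    have "(Suc ?j < K \<and> w ?p = 2 \<and> s (Suc ?p) = Pa m (Suc ?j) \<and> d = (\<lambda>_. 0)) \<or>
       (?j = K - 1 \<and> 3 \<le> w ?p \<and> w ?p < 3 + nt \<and> d = e1 1 \<and>
          (\<exists>m'. s (Suc ?p) = Pa m' 0 \<and> (m' \<longrightarrow> w ?p - 3 \<in> live)))"
      using tr_Pa_cases[OF d(1) ns] nb by blast
    then show ?thesis
    proof (elim disjE conjE)
      assume a: "Suc ?j < K" "w ?p = 2" "s (Suc ?p) = Pa m (Suc ?j)" "d = (\<lambda>_. 0)"
      have sm: "Suc b mod K = Suc ?j" using a by (simp add: Suc_mod_K)
      have "c (Suc ?p) x = c ?p x" if "x < 4" for x using d(2) a that by auto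
      moreover have "src ?j < 4" "Suc (src ?j) < 4" "dst ?j < 4" "Suc (dst ?j) < 4"
        using src_dst[of ?j] by auto
      ultimately have "c (Suc ?p) (src ?j) = c ?p (src ?j)" "c (Suc ?p) (Suc (src ?j)) = c ?p (Suc (src ?j))"
        "c (Suc ?p) (dst ?j) = c ?p (dst ?j)" "c (Suc ?p) (Suc (dst ?j)) = c ?p (Suc (dst ?j))"
        by blast+
      moreover have "dst (Suc ?j) = src ?j" by (simp add: src_def dst_def)
      ultimately show ?thesis using a e unfolding p sm BI_def
        by (auto simp: sep_ok_def sm NN_Suc)
    next
      assume a: "?j = K - 1" "3 \<le> w ?p" "w ?p < 3 + nt" "d = e1 1"
        "\<exists>m'. s (Suc ?p) = Pa m' 0 \<and> (m' \<longrightarrow> w ?p - 3 \<in> live)"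
      have sj: "Suc ?j = K" using a(1) K6 by simp
      have sm: "Suc b mod K = 0" using sj by (simp add: Suc_mod_K)
      have dj: "dst ?j = 0" "src ?j = 2" using a(1) dst_last src_dst[of ?j] by auto
      have "c (Suc ?p) 0 = c ?p 0" "c (Suc ?p) 2 = c ?p 2" "c (Suc ?p) 3 = c ?p 3"
        "c (Suc ?p) 1 = Suc (c ?p 1)"
        using d(2)[unfolded all_less_4 a(4)] by (auto simp: e1_def)
      then show ?thesis using a e sj unfolding p sm BI_def dj
        by (auto simp: sep_ok_def sm NN_Suc src_def dst_def numeral_3_eq_3 numeral_2_eq_2)
    qed
  qed
  have BI: "BI b" for b
  proof (induction b)
    case 0
    then show ?case using bi0 by blast
  next
    case (Suc b)
    then obtain m where "s (Suc (bp n b)) = Pa m (b mod K)" unfolding BI_def by blast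
    then show ?case using nxt[OF Suc] by blast
  qed
  define m where "m b \<longleftrightarrow> s (Suc (bp n b)) = Pa True (b mod K)" for b
  have m: "s (Suc (bp n b)) = Pa (m b) (b mod K)" for b
    using BI[of b] unfolding BI_def m_def by auto
  define h where "h b = c (Suc (bp n b)) (src (b mod K))" for b
  have so: "sep_ok b (w (bp n b))" for b
  proof (cases b)
    case 0
    then show ?thesis using bi0 by simp
  next
    case (Suc b')
    then show ?thesis using nxt[OF BI m, of b'] by simp
  qed
  have ex: "exact n w" unfolding exact_def
    using ini ch[of n] so block[OF BI m, of "NN n b" for b] by auto
  have h0: "h 0 = 0" using bi0 by (simp add: h_def src_def)
  have m0: "\<not> m 0" using bi0 by (simp add: m_def)
  have A: "(m b \<and> b mod K = 0 \<longrightarrow> h b = ones n w b (NN n b)) \<and>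
         h (Suc b) = (if m b \<and> b mod K = 3 then ones n w b (NN n b) else h b)" for b
  proof -
    have "h (Suc b) = c (bp n b + Suc (NN n b)) (dst (b mod K))"
      using nxt[OF BI m, of b] by (simp add: h_def)
    then show ?thesis using block[OF BI m, of "NN n b" b] by (auto simp: h_def)
  qed
  have B: "(Suc b mod K \<noteq> 0 \<longrightarrow> m (Suc b) = m b) \<and>
         (Suc b mod K = 0 \<and> m (Suc b) \<longrightarrow> w (bp n (Suc b)) - 3 \<in> live)" for b
    using nxt[OF BI m, of b] m[of "Suc b"] by (metis st.inject(3))
  have infm: "\<exists>\<^sub>\<infinity>b. m b"
  proof -
    have "\<exists>b\<ge>B. m b" for B
    proof -
      obtain p where p: "Suc (bp n B) \<le> p" "s p \<in> Acc"
        using inf[unfolded INFM_nat_le, THEN spec, of "Suc (bp n B)"] by (auto simp: s_def)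
      have "n < p - 1" using p(1) bp_mono[of 0 B n] by simp
      then obtain b i where b: "p - 1 = bp n b + i" "i \<le> NN n b" using bp_cover by blast
      then have pe: "p = bp n b + Suc i" using p(1) by simp
      have "s p = Pa (m b) (b mod K)" using block[OF BI m b(2)] pe by simp
      then have "m b" using p(2) ns by (auto simp: Acc_def)
      moreover have "B \<le> b" using p(1) pe b(2) bp_less[of b B n] by (cases "b < B") auto
      ultimately show ?thesis by blast
    qed
    then show ?thesis by (simp add: INFM_nat_le)
  qed
  show ?thesis
    by (intro conjI exI[of _ m] exI[of _ h] allI)
      (fact ex h0 A[THEN conjunct1] A[THEN conjunct2] B[THEN conjunct1] B[THEN conjunct2] m0 infm)+
qed

text \<open>Condenses blocks into records: \<open>H t\<close> is the node held on arrival at record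
  \<open>t\<close>, and \<open>m t\<close> says that the branch passes through \<open>t\<close>. The
  root is never taken since a path run starts in mode \<open>False\<close>.\<close>

lemma path_run_sound:
  assumes "w \<in> topspace (cantor (3 + nt))"
    and "\<And>p \<gamma>. reach n w 0 init p \<gamma> \<Longrightarrow> fst \<gamma> \<noteq> Sink"
    and "accepted n w"
  shows "exact n w \<and> (\<exists>m H. H 0 = 0 \<and> (\<exists>\<^sub>\<infinity>t. m t) \<and> \<not> m 0 \<and>
    (\<forall>t. if m t then X n w t 0 = H t \<and> H (Suc t) = X n w t 3 \<and> tag n w t \<in> live else H (Suc t) = H t))"
proof -
  have "exact n w \<and> (\<exists>m h. h 0 = 0 \<and>
    (\<forall>b. (m b \<and> b mod K = 0 \<longrightarrow> h b = ones n w b (NN n b)) \<and>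
         h (Suc b) = (if m b \<and> b mod K = 3 then ones n w b (NN n b) else h b) \<and>
         (Suc b mod K \<noteq> 0 \<longrightarrow> m (Suc b) = m b) \<and>
         (Suc b mod K = 0 \<and> m (Suc b) \<longrightarrow> w (bp n (Suc b)) - 3 \<in> live)) \<and>
    \<not> m 0 \<and> (\<exists>\<^sub>\<infinity>b. m b))"
    by (rule path_run_sound_blocks[OF assms(1) _ assms(3)]) (use assms(2) in blast)
  then obtain m h where mh: "exact n w" "h 0 = 0"
    "\<forall>b. (m b \<and> b mod K = 0 \<longrightarrow> h b = ones n w b (NN n b)) \<and>
         h (Suc b) = (if m b \<and> b mod K = 3 then ones n w b (NN n b) else h b) \<and>
         (Suc b mod K \<noteq> 0 \<longrightarrow> m (Suc b) = m b) \<and>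
         (Suc b mod K = 0 \<and> m (Suc b) \<longrightarrow> w (bp n (Suc b)) - 3 \<in> live)"
    "\<not> m 0" "\<exists>\<^sub>\<infinity>b. m b"
    by (elim conjE exE) (rule that)
  have ex: "exact n w" and h0: "h 0 = 0" and m0: "\<not> m 0" and inf: "\<exists>\<^sub>\<infinity>b. m b"
    using mh by blast+
  have test: "h b = ones n w b (NN n b)" if "m b" "b mod K = 0" for b
    using mh(3)[THEN spec, of b] that by blast
  have hS: "h (Suc b) = (if m b \<and> b mod K = 3 then ones n w b (NN n b) else h b)" for b
    using mh(3)[THEN spec, of b] by (elim conjE)
  have mS: "m (Suc b) = m b" if "Suc b mod K \<noteq> 0" for b
    using mh(3)[THEN spec, of b] that by blast
  have lv: "w (bp n (Suc b)) - 3 \<in> live" if "Suc b mod K = 0" "m (Suc b)" for b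
    using mh(3)[THEN spec, of b] that by blast
  have md: "(t * K + j) mod K = j" if "j < K" for t j using that by simp
  have m: "m (t * K + j) = m (t * K)" if "j < K" for t j
    using that
  proof (induction j)
    case (Suc j)
    then show ?case using mS[of "t * K + j"] md[of "Suc j" t] by simp
  qed simp
  have Xo: "ones n w (t * K + j) (NN n (t * K + j)) = X n w t j" if "j < K" for t j
    using that by (simp add: X_def NN_rec)
  have hh: "h (t * K + j) = (if m (t * K) \<and> 3 < j then X n w t 3 else h (t * K))" if "j \<le> K" for t j
    using that
  proof (induction j)
    case (Suc j)
    then have j: "j < K" by simp
    show ?case using Suc hS[of "t * K + j"] md[OF j, of t] m[OF j, of t] Xo[OF j, of t] by auto
  qed simp
  define M where "M t = m (t * K)" for t
  define H where "H t = h (t * K)" for t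
  have MH: "if M t then X n w t 0 = H t \<and> H (Suc t) = X n w t 3 \<and> tag n w t \<in> live else H (Suc t) = H t" for t
  proof -
    have s: "H (Suc t) = h (t * K + K)" by (simp add: H_def add.commute)
    have "tag n w t \<in> live" if a: "M t"
    proof (cases t)
      case 0
      then show ?thesis using a m0 by (simp add: M_def)
    next
      case (Suc t')
      then obtain b where b: "t * K = Suc b" using K6 by (cases "t * K") auto
      then have "Suc b mod K = 0" by (metis mod_mult_self2_is_0)
      then show ?thesis using lv[of b] a b by (simp add: M_def tag_def)
    qed
    moreover have "X n w t 0 = H t" if "M t"
      using test[of "t * K"] that Xo[of 0 t] K6 by (simp add: M_def H_def)
    ultimately show ?thesis using hh[of K t] K6 s by (auto simp: M_def H_def)
  qed
  have infM: "\<exists>\<^sub>\<infinity>t. M t"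
  proof -
    have "\<exists>t\<ge>T. M t" for T
    proof -
      obtain b where b: "T * K \<le> b" "m b" using inf by (auto simp: INFM_nat_le)
      have "M (b div K)" using m[OF mod_K_less, of "b div K" b] b by (simp add: M_def)
      moreover have "T \<le> b div K" using b K6 by (simp add: less_eq_div_iff_mult_less_eq)
      ultimately show ?thesis by blast
    qed
    then show ?thesis by (simp add: INFM_nat_le)
  qed
  have H0: "H 0 = 0" and M0: "\<not> M 0" using h0 m0 by (simp_all add: H_def M_def)
  show ?thesis
    by (intro conjI exI[of _ M] exI[of _ H] allI) (fact ex H0 infM M0 MH)+
qed

section \<open>Accepting runs constructed from a branch\<close>

lemma ones_mono:
  assumes "exact n w" "i \<le> i'" "i' \<le> NN n b"
  shows "ones n w b i \<le> ones n w b i' \<and> i - ones n w b i \<le> i' - ones n w b i'"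
  using assms(2,3)
proof (induction i' rule: dec_induct)
  case (step k)
  have "w (bp n b + Suc k) < 2" using assms(1) step.prems by (auto simp: exact_def)
  moreover have "ones n w b k \<le> k" using ones_le[OF assms(1)] step.prems by simp
  ultimately show ?case using step by (auto simp: ones_Suc)
qed simp

definition cfg :: "nat \<Rightarrow> nat \<Rightarrow> nat \<Rightarrow> nat \<Rightarrow> nat" where
  "cfg j a N x = (if x = src j then a else if x = Suc (src j) then N - a else 0)"

text \<open>Of the \<open>i\<close> letters read so far, \<open>U\<close> were charged to the value
  counter of the source pair and \<open>U'\<close> credited to that of the target pair.\<close>

definition mid :: "nat \<Rightarrow> nat \<Rightarrow> nat \<Rightarrow> nat \<Rightarrow> nat \<Rightarrow> nat \<Rightarrow> nat \<Rightarrow> nat" where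
  "mid j a N U U' i x = (if x = src j then a - U else if x = Suc (src j) then N - a - (i - U)
     else if x = dst j then U' else if x = Suc (dst j) then i - U' else 0)"

lemma mid_step:
  assumes "h < 2" "h' < 2" "U \<le> i" "U' \<le> i" "U + (1 - h) \<le> a" "Suc i - (U + (1 - h)) \<le> N - a"
  shows "\<forall>x<4. int (mid j a N (U + (1 - h)) (U' + (1 - h')) (Suc i) x)
     = int (mid j a N U U' i x) + (e1 (dst j + h') x - e1 (src j + h) x)"
proof -
  have h: "h = 0 \<or> h = 1" "h' = 0 \<or> h' = 1" using assms(1,2) by auto
  show ?thesis unfolding all_less_4
  proof (cases "even j")
    case True
    then show "int (mid j a N (U + (1 - h)) (U' + (1 - h')) (Suc i) 0)
     = int (mid j a N U U' i 0) + (e1 (dst j + h') 0 - e1 (src j + h) 0) \<and>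
     int (mid j a N (U + (1 - h)) (U' + (1 - h')) (Suc i) 1)
     = int (mid j a N U U' i 1) + (e1 (dst j + h') 1 - e1 (src j + h) 1) \<and>
     int (mid j a N (U + (1 - h)) (U' + (1 - h')) (Suc i) 2)
     = int (mid j a N U U' i 2) + (e1 (dst j + h') 2 - e1 (src j + h) 2) \<and>
     int (mid j a N (U + (1 - h)) (U' + (1 - h')) (Suc i) 3)
     = int (mid j a N U U' i 3) + (e1 (dst j + h') 3 - e1 (src j + h) 3)"
      using h assms(3-) by (elim disjE) (auto simp: mid_def e1_def src_def dst_def)
  next
    case False
    then show "int (mid j a N (U + (1 - h)) (U' + (1 - h')) (Suc i) 0)
     = int (mid j a N U U' i 0) + (e1 (dst j + h') 0 - e1 (src j + h) 0) \<and>
     int (mid j a N (U + (1 - h)) (U' + (1 - h')) (Suc i) 1)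
     = int (mid j a N U U' i 1) + (e1 (dst j + h') 1 - e1 (src j + h) 1) \<and>
     int (mid j a N (U + (1 - h)) (U' + (1 - h')) (Suc i) 2)
     = int (mid j a N U U' i 2) + (e1 (dst j + h') 2 - e1 (src j + h) 2) \<and>
     int (mid j a N (U + (1 - h)) (U' + (1 - h')) (Suc i) 3)
     = int (mid j a N U U' i 3) + (e1 (dst j + h') 3 - e1 (src j + h) 3)"
      using h assms(3-) by (elim disjE) (auto simp: mid_def e1_def src_def dst_def)
  qed
qed

text \<open>In a copying block the run may spend the value counter first and the complement
  afterwards. In a test block the letters dictate the order, and the hypothesis on \<open>a\<close>
  ensures that both counters come out even.\<close>

lemma path_block:
  assumes ex: "exact n w" and j: "j = b mod K" and N: "N = NN n b" and a: "a \<le> N"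
    and t: "m \<and> j = 0 \<longrightarrow> a = ones n w b N"
    and a': "a' = (if m \<and> j = 3 then ones n w b N else a)"
  shows "reach n w (Suc (bp n b)) (Pa m j, cfg j a N) (bp n (Suc b)) (Pa m j, cfg (Suc j) a' N)"
proof -
  \<comment> \<open>\<open>u i\<close> units of the value counter are spent and \<open>u' i\<close>
    credited after \<open>i\<close> letters; they follow the letters where the block is tested or
    stored, and the order value before complement elsewhere.\<close>
  define u where "u i = (if m \<and> j = 0 then ones n w b i else min i a)" for i
  define u' where "u' i = (if m \<and> (j = 0 \<or> j = 3) then ones n w b i else min i a)" for i
  have ub: "u i \<le> i \<and> u' i \<le> i \<and> u i \<le> a \<and> i - u i \<le> N - a" if "i \<le> N" for i
  proof (cases "m \<and> j = 0")
    case True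
    then show ?thesis using ones_mono[OF ex that, of b] ones_le[OF ex, of i b] t that
      by (auto simp: u_def u'_def N)
  next
    case False
    then show ?thesis using ones_le[OF ex, of i b] that a
      by (auto simp: u_def u'_def N)
  qed
  have "i \<le> N \<Longrightarrow> reach n w (Suc (bp n b)) (Pa m j, cfg j a N) (bp n b + Suc i) (Pa m j, mid j a N (u i) (u' i) i)" for i
  proof (induction i)
    case 0
    have "cfg j a N = mid j a N (u 0) (u' 0) 0"
      by (rule ext) (auto simp: cfg_def mid_def u_def u'_def)
    then show ?case by (simp add: reach.refl)
  next
    case (Suc i)
    let ?b = "w (bp n b + Suc i)"
    have b2: "?b < 2" using ex Suc.prems by (auto simp: exact_def N)
    define h where "h = (if m \<and> j = 0 then 1 - ?b else if i < a then 0 else 1)"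
    define h' where "h' = (if m \<and> (j = 0 \<or> j = 3) then 1 - ?b else if i < a then 0 else 1)"
    have h: "h < 2" "h' < 2" by (auto simp: h_def h'_def)
    have uS: "u (Suc i) = u i + (1 - h)" "u' (Suc i) = u' i + (1 - h')"
      using b2 by (auto simp: u_def u'_def h_def h'_def ones_Suc)
    have pd: "padm m j ?b h h'" by (auto simp: padm_def h_def h'_def)
    have "tr n (Pa m j) ?b (Pa m j) (\<lambda>x. e1 (dst j + h') x - e1 (src j + h) x)"
      by (rule tr.Pab) (use j mod_K_less b2 h pd in auto)
    moreover have "\<forall>x<4. int (mid j a N (u (Suc i)) (u' (Suc i)) (Suc i) x)
       = int (mid j a N (u i) (u' i) i x) + (e1 (dst j + h') x - e1 (src j + h) x)"
      unfolding uS
      by (rule mid_step) (use h ub[of i] ub[of "Suc i"] uS Suc.prems in auto)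
    ultimately have "step n w (bp n b + Suc i) (Pa m j, mid j a N (u i) (u' i) i)
        (Pa m j, mid j a N (u (Suc i)) (u' (Suc i)) (Suc i))"
      unfolding step_def by (auto intro!: exI)
    then show ?case using Suc reach.step by fastforce
  qed
  from this[of N] have "reach n w (Suc (bp n b)) (Pa m j, cfg j a N) (bp n (Suc b)) (Pa m j, mid j a N (u N) (u' N) N)"
    by (simp add: bp_Suc N)
  moreover have "mid j a N (u N) (u' N) N = cfg (Suc j) a' N"
  proof -
    have "u N = a" using t a by (auto simp: u_def)
    moreover have "u' N = a'" using t a a' by (auto simp: u'_def)
    ultimately show ?thesis
      by (intro ext) (use src_dst[of j] in \<open>auto simp: mid_def cfg_def\<close>)
  qed
  ultimately show ?thesis by simp
qed

lemma path_sep: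
  assumes ex: "exact n w" and j: "j = b mod K" and j': "j' = Suc b mod K" and a: "a \<le> NN n b"
    and m: "j' \<noteq> 0 \<longrightarrow> m' = m" "j' = 0 \<and> m' \<longrightarrow> w (bp n (Suc b)) - 3 \<in> live"
  shows "step n w (bp n (Suc b)) (Pa m j, cfg (Suc j) a (NN n b)) (Pa m' j', cfg j' a (NN n (Suc b)))"
proof -
  have so: "sep_ok (Suc b) (w (bp n (Suc b)))" using ex by (simp add: exact_def)
  show ?thesis
  proof (cases "Suc j = K")
    case True
    then have j0: "j' = 0" "NN n (Suc b) = Suc (NN n b)" "j = K - 1"
      using j j' by (simp_all add: Suc_mod_K NN_Suc)
    have "tr n (Pa m (K - 1)) (w (bp n (Suc b))) (Pa m' 0) (e1 1)"
      by (rule tr.Pat) (use so j' j0 m in \<open>auto simp: sep_ok_def\<close>)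
    moreover have "src (Suc j) = 0" using even_K True by (simp add: src_def)
    ultimately show ?thesis using a unfolding step_def j0
      by (intro exI[of _ "e1 1"]) (auto simp: cfg_def e1_def src_def)
  next
    case False
    then have j0: "j' = Suc j" "NN n (Suc b) = NN n b" "Suc j < K"
      using j j' mod_K_less[of b] by (simp_all add: Suc_mod_K NN_Suc)
    have "tr n (Pa m j) 2 (Pa m (Suc j)) (\<lambda>_. 0)" by (rule tr.Pas) (use j0 in auto)
    then show ?thesis using so m(1) j0 j' unfolding step_def
      by (intro exI[of _ "\<lambda>_. 0"]) (auto simp: sep_ok_def)
  qed
qed

lemma path_record:
  assumes ex: "exact n w" and a: "a \<le> Suc n + t" and m: "m \<longrightarrow> X n w t 0 = a"
    and m': "m' \<longrightarrow> tag n w (Suc t) \<in> live"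
  shows "reach n w (Suc (bp n (t * K))) (Pa m 0, cfg 0 a (Suc n + t))
     (Suc (bp n (Suc t * K))) (Pa m' 0, cfg 0 (if m then X n w t 3 else a) (Suc n + Suc t))"
proof -
  define v where "v j = (if m \<and> 3 < j then X n w t 3 else a)" for j :: nat
  have X3: "X n w t 3 \<le> Suc n + t" using X_le[OF ex, of 3 t] K6 by simp
  have v: "v j \<le> Suc n + t" for j using X3 a by (simp add: v_def)
  have blk: "reach n w (Suc (bp n (t * K + j))) (Pa m j, cfg j (v j) (Suc n + t))
     (bp n (Suc (t * K + j))) (Pa m j, cfg (Suc j) (v (Suc j)) (Suc n + t))" if j: "j < K" for j
  proof (rule path_block[OF ex])
    show "j = (t * K + j) mod K" using j by simp
    show "Suc n + t = NN n (t * K + j)" using j by (simp add: NN_rec)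
    show "v j \<le> Suc n + t" by (rule v)
    show "m \<and> j = 0 \<longrightarrow> v j = ones n w (t * K + j) (Suc n + t)" using m by (simp add: v_def X_def)
    show "v (Suc j) = (if m \<and> j = 3 then ones n w (t * K + j) (Suc n + t) else v j)"
      by (auto simp: v_def X_def)
  qed
  have rec: "reach n w (Suc (bp n (t * K))) (Pa m 0, cfg 0 a (Suc n + t))
     (Suc (bp n (t * K + j))) (Pa m j, cfg j (v j) (Suc n + t))" if "j < K" for j
    using that
  proof (induction j)
    case 0
    then show ?case by (simp add: v_def reach.refl)
  next
    case (Suc j)
    then have j: "j < K" by simp
    have "step n w (bp n (Suc (t * K + j))) (Pa m j, cfg (Suc j) (v (Suc j)) (NN n (t * K + j)))
        (Pa m (Suc j), cfg (Suc j) (v (Suc j)) (NN n (Suc (t * K + j))))"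
      by (rule path_sep[OF ex]) (use Suc.prems j v in \<open>auto simp: NN_rec mod_Suc\<close>)
    moreover have "NN n (Suc (t * K + j)) = Suc n + t" using NN_rec[OF Suc.prems, of n t] by simp
    ultimately show ?case using reach_trans[OF Suc.IH[OF j] blk[OF j]] reach.step j
      by (fastforce simp: NN_rec)
  qed
  have K1: "K - 1 < K" "Suc (K - 1) = K" using K6 by auto
  have e: "Suc (t * K + (K - 1)) = Suc t * K" using K6 by simp
  have "step n w (bp n (Suc t * K)) (Pa m (K - 1), cfg K (v K) (Suc n + t))
      (Pa m' 0, cfg 0 (v K) (Suc n + Suc t))"
  proof -
    have "step n w (bp n (Suc (t * K + (K - 1)))) (Pa m (K - 1), cfg (Suc (K - 1)) (v K) (NN n (t * K + (K - 1))))
      (Pa m' 0, cfg 0 (v K) (NN n (Suc (t * K + (K - 1)))))"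
    proof (rule path_sep[OF ex])
      show "K - 1 = (t * K + (K - 1)) mod K" by (simp only: mod_mult_self3 mod_less[OF K1(1)])
      show "0 = Suc (t * K + (K - 1)) mod K" unfolding e by simp
      show "v K \<le> NN n (t * K + (K - 1))" using v NN_rec[OF K1(1)] by simp
      show "0 = 0 \<and> m' \<longrightarrow> w (bp n (Suc (t * K + (K - 1)))) - 3 \<in> live"
        unfolding e using m' by (simp add: tag_def)
    qed simp
    moreover have "NN n (Suc (t * K + (K - 1))) = Suc n + Suc t"
      unfolding e using NN_rec[of 0 n "Suc t"] K6 by simp
    moreover have "NN n (t * K + (K - 1)) = Suc n + t" by (rule NN_rec[OF K1(1)])
    ultimately show ?thesis by (simp only: e K1)
  qed
  moreover have "v K = (if m then X n w t 3 else a)" using K6 by (simp add: v_def)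
  ultimately show ?thesis
    using reach.step[OF reach_trans[OF rec[OF K1(1)] blk[OF K1(1)]]] unfolding e K1 by simp
qed

lemma chain_reach:
  assumes ex: "exact n w"
  shows "reach n w 0 init (Suc n) (Ch 0, \<lambda>x. if x = 1 then n else 0)"
proof -
  define c where "c i x = (if x = 1 then i else 0)" for i x :: nat
  have "i \<le> n \<Longrightarrow> reach n w 0 init (Suc i) (Ch (n - i), c i)" for i
  proof (induction i)
    case 0
    have "step n w 0 init (Ch n, c 0)" using ex unfolding step_def
      by (intro exI[of _ "\<lambda>_. 0"]) (auto simp: init_def c_def exact_def intro: tr.IniP)
    then show ?case by (simp add: reach_1)
  next
    case (Suc i)
    have "n - i = Suc (n - Suc i)" "n - Suc i < n" using Suc.prems by auto
    then have "tr n (Ch (n - i)) 0 (Ch (n - Suc i)) (e1 1)" using tr.Ch by simp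
    moreover have "w (Suc i) = 0" using ex Suc.prems by (simp add: exact_def)
    ultimately have "step n w (Suc i) (Ch (n - i), c i) (Ch (n - Suc i), c (Suc i))" unfolding step_def
      by (intro exI[of _ "e1 1"]) (auto simp: c_def e1_def)
    then show ?case using Suc reach.step by fastforce
  qed
  from this[of n] show ?thesis unfolding c_def by simp
qed

lemma path_start:
  assumes ex: "exact n w"
  shows "reach n w 0 init (Suc (bp n 0)) (Pa False 0, cfg 0 0 (Suc n))"
proof -
  have "sep_ok 0 (w (Suc n))" using ex[unfolded exact_def] by (metis bp.simps(1))
  then have "tr n (Ch 0) (w (Suc n)) (Pa False 0) (e1 1)" by (intro tr.ChPa) (auto simp: sep_ok_def)
  then have "step n w (Suc n) (Ch 0, \<lambda>x. if x = 1 then n else 0) (Pa False 0, cfg 0 0 (Suc n))"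
    unfolding step_def by (intro exI[of _ "e1 1"]) (auto simp: e1_def cfg_def src_def)
  then show ?thesis using reach.step[OF chain_reach[OF ex]] by simp
qed

text \<open>The mode matters at the first record only; the records between two nodes of the branch
  are crossed in mode \<open>False\<close>.\<close>

lemma path_skips:
  assumes ex: "exact n w" and a: "a \<le> Suc n + t" and m: "m \<longrightarrow> X n w t 0 = a"
    and m': "m' \<longrightarrow> tag n w (t + Suc d) \<in> live"
  shows "reach n w (Suc (bp n (t * K))) (Pa m 0, cfg 0 a (Suc n + t))
     (Suc (bp n ((t + Suc d) * K))) (Pa m' 0, cfg 0 (if m then X n w t 3 else a) (Suc n + (t + Suc d)))"
  using m'
proof (induction d arbitrary: m')
  case 0
  then show ?case using path_record[OF ex a m, of m'] by simp
next
  case (Suc d)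
  let ?a = "if m then X n w t 3 else a"
  have "X n w t 3 \<le> Suc n + t" using X_le[OF ex, of 3 t] K6 by simp
  then have "?a \<le> Suc n + (t + Suc d)" using a by simp
  from path_record[OF ex this, of False m'] Suc.prems
  have "reach n w (Suc (bp n ((t + Suc d) * K))) (Pa False 0, cfg 0 ?a (Suc n + (t + Suc d)))
     (Suc (bp n (Suc (t + Suc d) * K))) (Pa m' 0, cfg 0 ?a (Suc n + Suc (t + Suc d)))" by simp
  from reach_trans[OF Suc.IH[of False] this] show ?case by simp
qed

text \<open>\<open>f\<close> enumerates the records on the branch. At each of them the run is in the
  accepting state \<open>Pa True 0\<close>, and these are the checkpoints.\<close>

lemma path_run_complete:
  assumes ex: "exact n w" and f: "strict_mono f" "0 < f 0" and v0: "v 0 = 0"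
    and x: "\<And>k. X n w (f k) 0 = v k" "\<And>k. X n w (f k) 3 = v (Suc k)" "\<And>k. tag n w (f k) \<in> live"
  shows "accepted n w"
proof -
  define E where "E k = Suc (bp n (f k * K))" for k
  define \<Gamma> where "\<Gamma> k = (Pa True 0, cfg 0 (v k) (Suc n + f k))" for k
  have v: "v k \<le> Suc n + f k" for k using X_le[OF ex, of 0 "f k"] x(1)[of k] K6 by simp
  have st: "reach n w 0 init (E 0) (\<Gamma> 0)"
  proof -
    obtain d where d: "f 0 = 0 + Suc d" using f(2) by (metis add_0 gr0_implies_Suc)
    have "reach n w (Suc (bp n (0 * K))) (Pa False 0, cfg 0 0 (Suc n + 0)) (E 0) (\<Gamma> 0)"
      using path_skips[OF ex, where a = 0 and t = 0 and m = False and m' = True and d = d] x(3)[of 0] d v0 by (simp add: E_def \<Gamma>_def)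
    then show ?thesis using reach_trans[OF path_start[OF ex]] by simp
  qed
  have nx: "reach n w (E k) (\<Gamma> k) (E (Suc k)) (\<Gamma> (Suc k))" for k
  proof -
    have "f k < f (Suc k)" using f(1) by (simp add: strict_mono_Suc_iff)
    then obtain d where d: "f (Suc k) = f k + Suc d" by (metis less_natE add_Suc_right)
    show ?thesis
      using path_skips[OF ex v[of k], where m = True and m' = True and d = d] x(1,2)[of k] x(3)[of "Suc k"] d
      by (simp add: E_def \<Gamma>_def)
  qed
  have E: "E k < E (Suc k)" for k
  proof -
    have "f k * K < f (Suc k) * K" using f(1) K6 by (simp add: strict_mono_Suc_iff)
    then show ?thesis unfolding E_def using bp_less[of "f k * K" "f (Suc k) * K" n] by linarith
  qed
  show ?thesis
  proof (rule acceptedI[OF st, of "\<lambda>p \<gamma>. \<exists>k. p = E k \<and> \<gamma> = \<Gamma> k"])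
    show "\<exists>k. E 0 = E k \<and> \<Gamma> 0 = \<Gamma> k" by blast
    show "fst \<gamma> \<in> Acc" if "\<exists>k. p = E k \<and> \<gamma> = \<Gamma> k" for p \<gamma>
      using that by (auto simp: \<Gamma>_def Acc_def)
    show "\<exists>p'>p. \<exists>\<gamma>'. reach n w p \<gamma> p' \<gamma>' \<and> (\<exists>k. p' = E k \<and> \<gamma>' = \<Gamma> k)"
      if "\<exists>k. p = E k \<and> \<gamma> = \<Gamma> k" for p \<gamma>
      using that nx E by blast
  qed
qed

section \<open>Counter contents during an error check\<close>

definition sd :: "bool \<Rightarrow> bool \<Rightarrow> nat \<Rightarrow> (nat \<Rightarrow> nat) \<Rightarrow> nat \<Rightarrow> nat \<Rightarrow> nat" where
  "sd f1 f0 n w b i = (if f1 then ones n w b i else 0) + (if f0 then i - ones n w b i else 0)"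

definition LD :: "spec \<Rightarrow> nat \<Rightarrow> (nat \<Rightarrow> nat) \<Rightarrow> nat \<Rightarrow> nat \<Rightarrow> nat" where
  "LD e n w x t = (let c = cs e x in sd (c_l1 c) (c_l0 c) n w (t * K + c_lp c) (Suc n + t))"

definition UL :: "spec \<Rightarrow> nat \<Rightarrow> (nat \<Rightarrow> nat) \<Rightarrow> nat \<Rightarrow> nat \<Rightarrow> nat" where
  "UL e n w x t = (let c = cs e x in sd (c_u1 c) (c_u0 c) n w (t * K + c_up c) (Suc n + t))"

text \<open>The net change of counter \<open>x\<close> since the record began, when \<open>i\<close>
  letters of block \<open>j\<close> have been read; the minimum counts the separators charged so
  far.\<close>

definition prog :: "spec \<Rightarrow> nat \<Rightarrow> nat \<Rightarrow> (nat \<Rightarrow> nat) \<Rightarrow> nat \<Rightarrow> nat \<Rightarrow> nat \<Rightarrow> nat \<Rightarrow> int" where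
  "prog e ph n w t j i x = (let c = cs e x in
     (if loads ph x then (if c_lp c < j then int (LD e n w x t)
        else if c_lp c = j then int (sd (c_l1 c) (c_l0 c) n w (t * K + j) i) else 0) else 0)
   - (if unloads ph x then (if c_up c < j then int (UL e n w x t + min (c_c c) (j - c_up c))
        else if c_up c = j then int (sd (c_u1 c) (c_u0 c) n w (t * K + j) i) else 0) else 0))"

lemma sd_0 [simp]: "sd f1 f0 n w b 0 = 0" by (simp add: sd_def)

lemma sd_Suc:
  assumes "exact n w" "i < NN n b"
  shows "sd f1 f0 n w b (Suc i) = sd f1 f0 n w b i + (if (if w (bp n b + Suc i) = 1 then f1 else f0) then 1 else 0)"
proof -
  have "w (bp n b + Suc i) < 2" using assms by (auto simp: exact_def)
  then have "w (bp n b + Suc i) = 0 \<or> w (bp n b + Suc i) = 1" by auto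
  moreover have "ones n w b i \<le> i" using ones_le[OF assms(1)] assms(2) by simp
  ultimately show ?thesis by (auto simp: sd_def ones_Suc Suc_diff_le)
qed

lemma sd_mono:
  assumes "exact n w" "i \<le> NN n b"
  shows "sd f1 f0 n w b i \<le> sd f1 f0 n w b (NN n b)"
  using ones_mono[OF assms order_refl] by (auto simp: sd_def)

lemma prog_start [simp]: "prog e ph n w t 0 0 x = 0"
  by (simp add: prog_def Let_def)

lemma prog_letter:
  assumes "exact n w" "j < K" "i < Suc n + t"
  shows "prog e ph n w t j (Suc i) x = prog e ph n w t j i x + bdelta e ph j (w (bp n (t * K + j) + Suc i)) x"
proof -
  have s: "sd f1 f0 n w (t * K + j) (Suc i) = sd f1 f0 n w (t * K + j) i +
      (if (if w (bp n (t * K + j) + Suc i) = 1 then f1 else f0) then 1 else 0)" for f1 f0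
    by (rule sd_Suc[OF assms(1)]) (use assms in \<open>simp add: NN_rec\<close>)
  show ?thesis unfolding prog_def bdelta_def Let_def s
    by (cases "c_lp (cs e x) = j"; cases "c_up (cs e x) = j") simp_all
qed

lemma prog_sep:
  "prog e ph n w t (Suc j) 0 x = prog e ph n w t j (Suc n + t) x + sdelta e ph (Suc j) x"
proof -
  define c where "c = cs e x"
  have l: "(if c_lp c < Suc j then int (LD e n w x t) else if c_lp c = Suc j then 0 else 0) =
     (if c_lp c < j then int (LD e n w x t)
        else if c_lp c = j then int (sd (c_l1 c) (c_l0 c) n w (t * K + j) (Suc n + t)) else 0)"
    by (auto simp: LD_def c_def Let_def)
  have u: "(if c_up c < Suc j then int (UL e n w x t + min (c_c c) (Suc j - c_up c)) else if c_up c = Suc j then 0 else 0) =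
     (if c_up c < j then int (UL e n w x t + min (c_c c) (j - c_up c))
        else if c_up c = j then int (sd (c_u1 c) (c_u0 c) n w (t * K + j) (Suc n + t)) else 0)
     + (if c_up c < Suc j \<and> Suc j \<le> c_up c + c_c c then 1 else 0)"
  proof -
    consider "c_up c < j" | "c_up c = j" | "j < c_up c" by linarith
    then show ?thesis
    proof cases
      case 2
      have "int (UL e n w x t) = int (sd (c_u1 c) (c_u0 c) n w (t * K + j) (Suc n + t))"
        by (simp only: UL_def Let_def 2[symmetric] c_def)
      then show ?thesis using 2 by (auto simp: min_def)
    qed (auto simp: min_def)
  qed
  show ?thesis using l u unfolding prog_def sdelta_def Let_def c_def[symmetric] by auto
qed

lemma prog_end:
  assumes "wf_spec K e" "x < 4"
  shows "prog e ph n w t (K - 1) i x = (if loads ph x then int (LD e n w x t) else 0)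
    - (if unloads ph x then int (UL e n w x t + c_c (cs e x)) else 0)"
proof -
  have "c_lp (cs e x) < K - 1" "c_up (cs e x) < K - 1" "c_up (cs e x) + c_c (cs e x) \<le> K - 1"
    using assms by (auto simp: wf_spec_def)
  then show ?thesis by (auto simp: prog_def Let_def)
qed

definition chain_rel :: "nat \<Rightarrow> (nat \<Rightarrow> nat) \<Rightarrow> (nat \<times> nat) set" where
  "chain_rel n w = {(q, p). q < p \<and> X n w p 0 = X n w q 3}"

text \<open>The check started at record \<open>t'\<close>, passed its last link at \<open>q\<close>
  and has now arrived at \<open>t\<close>. Without a chain, \<open>q\<close> remains
  \<open>t'\<close>.\<close>

definition link :: "spec \<Rightarrow> nat \<Rightarrow> (nat \<Rightarrow> nat) \<Rightarrow> nat \<Rightarrow> nat \<Rightarrow> nat \<Rightarrow> bool" where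
  "link e n w t' q t \<longleftrightarrow> tag n w t' \<in> ltags e \<and> q < t \<and>
     (if chain e then (t', q) \<in> (chain_rel n w)\<^sup>* else q = t') \<and> (\<not> skips e \<longrightarrow> t = Suc q)"

text \<open>Counters 0 and 1 of a chain were last loaded at \<open>q\<close>, all others at
  \<open>t'\<close>; a gaining counter has received one unit per tag since then.\<close>

definition held :: "spec \<Rightarrow> nat \<Rightarrow> (nat \<Rightarrow> nat) \<Rightarrow> nat \<Rightarrow> nat \<Rightarrow> nat \<Rightarrow> nat \<Rightarrow> nat" where
  "held e n w t' q t x = (let o' = if chain e \<and> x < 2 then q else t' in
     LD e n w x o' + (if c_g (cs e x) then t - o' else 0))"

definition match :: "spec \<Rightarrow> nat \<Rightarrow> (nat \<Rightarrow> nat) \<Rightarrow> bool" where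
  "match e n w \<longleftrightarrow>
     (if two e then \<exists>t' q t. link e n w t' q t \<and> tag n w t \<in> utags e \<and>
        (\<forall>x<4. UL e n w x t + c_c (cs e x) \<le> held e n w t' q t x)
      else \<exists>t. tag n w t \<in> utags e \<and> (\<forall>x<4. UL e n w x t + c_c (cs e x) \<le> LD e n w x t))"

definition hist :: "spec \<Rightarrow> nat \<Rightarrow> (nat \<Rightarrow> nat) \<Rightarrow> nat \<Rightarrow> nat \<Rightarrow> (nat \<Rightarrow> nat) \<Rightarrow> bool" where
  "hist e n w ph t \<beta> \<longleftrightarrow>
     (if ph = 0 then \<not> two e \<and> tag n w t \<in> utags e \<and> (\<forall>x<4. \<beta> x = 0)
      else if ph = 1 then two e \<and> tag n w t \<in> ltags e \<and> (\<forall>x<4. \<beta> x = 0)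
      else two e \<and> (ph = 3 \<longrightarrow> chain e) \<and> (ph = 2 \<longrightarrow> skips e) \<and> (ph = 4 \<longrightarrow> tag n w t \<in> utags e) \<and>
        (\<exists>t' q. link e n w t' q t \<and> (\<forall>x<4. \<beta> x = held e n w t' q t x)))"

lemma chain_rel_le: "(t', q) \<in> (chain_rel n w)\<^sup>* \<Longrightarrow> t' \<le> q"
  by (induction rule: rtrancl_induct) (auto simp: chain_rel_def)

lemma link_le: "link e n w t' q t \<Longrightarrow> t' \<le> q \<and> q < t"
  using chain_rel_le by (auto simp: link_def split: if_splits)

lemma chain_values:
  assumes "wf_spec K e" "chain e" "exact n w"
  shows "LD e n w 0 t = X n w t 3" "LD e n w 1 t = Suc n + t - X n w t 3"
    "UL e n w 0 t = X n w t 0" "UL e n w 1 t = Suc n + t - X n w t 0"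
    "c_c (cs e 0) = 0" "c_c (cs e 1) = 0" "c_g (cs e 0) = False" "c_g (cs e 1) = True"
  using assms by (simp_all add: wf_spec_def LD_def UL_def Let_def sd_def X_def)

lemma X_3_le: "exact n w \<Longrightarrow> X n w t 3 \<le> Suc n + t" "exact n w \<Longrightarrow> X n w t 0 \<le> Suc n + t"
  using X_le K6 by simp_all

lemma held_chain:
  assumes "wf_spec K e" "chain e" "exact n w" "q < t"
  shows "held e n w t' q t 0 = X n w q 3" "held e n w t' q t 1 = Suc n + t - X n w q 3"
  using assms X_3_le(1)[OF assms(3), of q]
  by (simp_all add: held_def chain_values del: One_nat_def)

lemma held_Suc:
  assumes "wf_spec K e" "link e n w t' q t" "x < 4"
  shows "held e n w t' q (Suc t) x = held e n w t' q t x + (if c_g (cs e x) then 1 else 0)"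
  using link_le[OF assms(2)] by (auto simp: held_def Let_def)

lemma hist_next:
  assumes wf: "wf_spec K e" and ex: "exact n w" and h: "hist e n w ph t \<beta>" and ph: "ph \<in> {1, 2, 3}"
    and ph': "ph' \<in> {2, 3, 4}" "ph' = 2 \<longrightarrow> skips e" "ph' = 3 \<longrightarrow> chain e" "ph' = 4 \<longrightarrow> tag n w (Suc t) \<in> utags e"
    and c: "\<forall>x<4. int (c x) = int (\<beta> x) + prog e ph n w t (K - 1) i x"
    and ch: "ph = 3 \<longrightarrow> X n w t 0 \<le> \<beta> 0 \<and> Suc n + t - X n w t 0 \<le> \<beta> 1"
    and c': "\<forall>x<4. int (c' x) = int (c x) + tdelta e x"
  shows "hist e n w ph' (Suc t) c'"
proof -
  have cg: "c' x = c x + (if c_g (cs e x) then 1 else 0)" if "x < 4" for x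
    using c' that by (auto simp: tdelta_def split: if_splits)
  have two: "two e" using h ph by (auto simp: hist_def split: if_splits)
  have "\<exists>t' q. link e n w t' q (Suc t) \<and> (\<forall>x<4. c' x = held e n w t' q (Suc t) x)"
  proof -
    consider "ph = 1" | "ph = 2" | "ph = 3" using ph by blast
    then show ?thesis
    proof cases
      case 1
      have "c x = LD e n w x t" if "x < 4" for x
        using c that h 1 prog_end[OF wf that] by (auto simp: hist_def loads_def unloads_def)
      then have "\<forall>x<4. c' x = held e n w t t (Suc t) x"
        using cg by (auto simp: held_def Let_def)
      moreover have "link e n w t t (Suc t)" using h 1 by (auto simp: link_def hist_def)
      ultimately show ?thesis by blast
    next
      case 2
      then obtain t' q where l: "link e n w t' q t" "\<forall>x<4. \<beta> x = held e n w t' q t x" "skips e"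
        using h by (auto simp: hist_def)
      have "c x = \<beta> x" if "x < 4" for x
        using c that 2 prog_end[OF wf that] by (auto simp: loads_def unloads_def)
      then have "\<forall>x<4. c' x = held e n w t' q (Suc t) x"
        using cg l held_Suc[OF wf l(1)] by auto
      moreover have "link e n w t' q (Suc t)" using l by (auto simp: link_def)
      ultimately show ?thesis by blast
    next
      case 3
      then obtain t' q where l: "link e n w t' q t" "\<forall>x<4. \<beta> x = held e n w t' q t x" "chain e"
        using h by (auto simp: hist_def)
      have sk: "skips e" using wf l(3) by (simp add: wf_spec_def)
      have qt: "q < t" using link_le[OF l(1)] by simp
      note hc = held_chain[OF wf l(3) ex qt, of t']
      \<comment> \<open>Both the ones and the zeros of the parent field fit into the counters. Since
        the totals agree, this forces equality: a link is exact although only inequalities are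
        tested.\<close>
      have X: "X n w t 0 = X n w q 3"
        using ch 3 l(2) hc X_3_le[OF ex, of t] X_3_le[OF ex, of q] qt by auto
      have "(t', t) \<in> (chain_rel n w)\<^sup>*"
        using l(1,3) X qt by (auto simp: link_def chain_rel_def intro: rtrancl_into_rtrancl)
      then have lk: "link e n w t' t (Suc t)" using l(1,3) sk by (simp add: link_def)
      have "c x = LD e n w x t" if x: "x < 2" for x
      proof -
        have "x = 0 \<or> x = 1" using x by auto
        then show ?thesis
        proof
          assume x: "x = 0"
          have "int (c 0) = int (\<beta> 0) + prog e ph n w t (K - 1) i 0" using c by simp
          also have "prog e ph n w t (K - 1) i 0 = int (LD e n w 0 t) - int (UL e n w 0 t + c_c (cs e 0))"
            using prog_end[OF wf, of 0 ph n w t i] 3 by (simp add: loads_def unloads_def)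
          finally show ?thesis using l(2) hc chain_values[OF wf l(3) ex] X x by simp
        next
          assume x: "x = 1"
          have "int (c 1) = int (\<beta> 1) + prog e ph n w t (K - 1) i 1" using c by simp
          also have "prog e ph n w t (K - 1) i 1 = int (LD e n w 1 t) - int (UL e n w 1 t + c_c (cs e 1))"
            using prog_end[OF wf, of 1 ph n w t i] 3 by (simp add: loads_def unloads_def)
          finally show ?thesis using l(2) hc chain_values[OF wf l(3) ex] X x by simp
        qed
      qed
      moreover have "c x = \<beta> x" if "x < 4" "\<not> x < 2" for x
        using c that 3 prog_end[OF wf that(1)] by (auto simp: loads_def unloads_def)
      ultimately have "\<forall>x<4. c' x = held e n w t' t (Suc t) x"
        using cg l(2,3) link_le[OF l(1)] by (auto simp: held_def Let_def)
      then show ?thesis using lk by blast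
    qed
  qed
  then show ?thesis using two ph' by (auto simp: hist_def)
qed

lemma hist_match:
  assumes wf: "wf_spec K e" and h: "hist e n w ph t \<beta>" and ph: "ph \<in> {0, 4}"
    and c: "\<forall>x<4. int (c x) = int (\<beta> x) + prog e ph n w t (K - 1) i x"
  shows "match e n w"
proof -
  have p: "prog e ph n w t (K - 1) i x = (if ph = 0 then int (LD e n w x t) else 0)
      - int (UL e n w x t + c_c (cs e x))" if "x < 4" for x
    using prog_end[OF wf that, of ph n w t i] ph by (auto simp: loads_def unloads_def)
  have le: "UL e n w x t + c_c (cs e x) \<le> \<beta> x + (if ph = 0 then LD e n w x t else 0)" if "x < 4" for x
    using c[rule_format, OF that] p[OF that] by (auto split: if_splits)
  show ?thesis
  proof (cases "ph = 0")
    case True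
    then have "\<not> two e" "tag n w t \<in> utags e" "\<forall>x<4. \<beta> x = 0" using h by (simp_all add: hist_def)
    then show ?thesis using le True unfolding match_def by auto
  next
    case False
    then have "ph = 4" using ph by simp
    then obtain t' q where l: "two e" "tag n w t \<in> utags e" "link e n w t' q t"
        "\<forall>x<4. \<beta> x = held e n w t' q t x"
      using h by (auto simp: hist_def)
    have "\<forall>x<4. UL e n w x t + c_c (cs e x) \<le> held e n w t' q t x"
      using le l(4) False by auto
    then show ?thesis using l(1-3) unfolding match_def by auto
  qed
qed

text \<open>The invariant is false at \<open>Sink\<close>, so its preservation excludes
  \<open>Sink\<close>. In phase 3 the bounds on \<open>\<beta>\<close> are recorded once block 0 is
  over, because block 3 refills the counters and nonnegativity then no longer reveals them.\<close>

definition inv :: "nat \<Rightarrow> (nat \<Rightarrow> nat) \<Rightarrow> nat \<Rightarrow> st \<Rightarrow> (nat \<Rightarrow> nat) \<Rightarrow> bool" where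
  "inv n w p s c = (case s of
     Ini \<Rightarrow> p = 0 \<and> (\<forall>x<4. c x = 0)
   | Ch i \<Rightarrow> p + i = Suc n \<and> c 1 + i = n \<and> c 0 = 0 \<and> c 2 = 0 \<and> c 3 = 0
   | FC j \<Rightarrow> j < 4 \<and> (\<exists>i\<le>NN n j. p = bp n j + Suc i)
   | Pa m j \<Rightarrow> (\<exists>b i. p = bp n b + Suc i \<and> i \<le> NN n b \<and> j = b mod K \<and>
       c (src j) + c (Suc (src j)) + i = NN n b \<and> c (dst j) + c (Suc (dst j)) = i)
   | DSkip \<Rightarrow> 0 < p \<and> (\<forall>x<4. c x = 0)
   | D e ph j \<Rightarrow> e < length specs \<and> ph \<le> 4 \<and> j < K \<and> (\<exists>t i \<beta>. p = bp n (t * K + j) + Suc i \<and> i \<le> Suc n + t \<and>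
       hist (specs ! e) n w ph t \<beta> \<and> (\<forall>x<4. int (c x) = int (\<beta> x) + prog (specs ! e) ph n w t j i x) \<and>
       (ph = 3 \<and> 0 < j \<longrightarrow> X n w t 0 \<le> \<beta> 0 \<and> Suc n + t - X n w t 0 \<le> \<beta> 1))
   | Sink \<Rightarrow> False)"

lemma exact_letter:
  assumes "exact n w" "i \<le> NN n b"
  shows "(i < NN n b \<and> w (bp n b + Suc i) < 2) \<or>
    (i = NN n b \<and> sep_ok (Suc b) (w (bp n b + Suc i)) \<and> 2 \<le> w (bp n b + Suc i) \<and> bp n b + Suc i = bp n (Suc b))"
proof (cases "i < NN n b")
  case True
  then show ?thesis using assms by (auto simp: exact_def)
next
  case False
  then have "i = NN n b" using assms by simp
  moreover have "sep_ok (Suc b) (w (bp n (Suc b)))" using assms by (simp add: exact_def)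
  ultimately show ?thesis by (auto simp: bp_Suc sep_ok_def split: if_splits)
qed

lemma exact_tag_position:
  assumes "exact n w" "3 \<le> w p" shows "\<exists>t. p = bp n (t * K)"
proof -
  have "n < p" using assms by (cases "p = 0"; cases "p \<le> n") (auto simp: exact_def)
  then obtain b i where p: "p = bp n b + i" "i \<le> NN n b" using bp_cover by blast
  show ?thesis
  proof (cases i)
    case 0
    then have "sep_ok b (w p)" using assms p by (simp add: exact_def)
    then have "b mod K = 0" using assms by (auto simp: sep_ok_def split: if_splits)
    then obtain t where "b = t * K" by (metis dvd_def mod_0_imp_dvd mult.commute)
    then show ?thesis using p 0 by auto
  next
    case (Suc i')
    then have "w p < 2" using assms(1) p by (auto simp: exact_def)
    then show ?thesis using assms by simp
  qed
qed

lemma tr_Ch_cases: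
  "tr n (Ch i) b s' d \<Longrightarrow> (\<exists>i'. i = Suc i' \<and> s' = Ch i' \<and> d = e1 1) \<or>
    (i = 0 \<and> 3 \<le> b \<and> (s' = FC 0 \<or> s' = Pa False 0 \<and> d = e1 1))"
  by (erule tr_Ch) auto

lemma tr_FC_cases:
  "tr n (FC j) b s' d \<Longrightarrow> j < 4 \<and> (b = 0 \<and> s' = FC j \<or> b = 1 \<or> b = 2 \<and> Suc j < 4 \<and> s' = FC (Suc j))"
  by (erule tr_FC) auto

lemma tr_Pa_Sink_cases:
  "tr n (Pa m j) b Sink d \<Longrightarrow> 2 \<le> b \<and> (\<exists>h<2. d = (\<lambda>x. - e1 (src j + h) x))"
  by (erule tr_Pa) auto

lemma tr_DSkip_cases:
  "tr n DSkip b s' d \<Longrightarrow> d = (\<lambda>_. 0) \<and> (s' = DSkip \<or>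
     (\<exists>e ph. s' = D e ph 0 \<and> e < length specs \<and> 3 \<le> b \<and>
        (ph = 1 \<and> two (specs ! e) \<and> b - 3 \<in> ltags (specs ! e) \<or>
         ph = 0 \<and> \<not> two (specs ! e) \<and> b - 3 \<in> utags (specs ! e))))"
  by (erule tr_DSkip) auto

lemma tr_D_cases:
  "tr n (D e ph j) b s' d \<Longrightarrow> e < length specs \<and>
     (b < 2 \<and> s' = D e ph j \<and> d = bdelta (specs ! e) ph j b \<or>
      b = 2 \<and> Suc j < K \<and> s' = D e ph (Suc j) \<and> d = sdelta (specs ! e) ph (Suc j) \<or>
      3 \<le> b \<and> j = K - 1 \<and> ph \<in> {1, 2, 3} \<and> d = tdelta (specs ! e) \<and>
        (\<exists>ph'. s' = D e ph' 0 \<and> ph' \<in> {2, 3, 4} \<and> (ph' = 2 \<longrightarrow> skips (specs ! e)) \<and>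
          (ph' = 3 \<longrightarrow> chain (specs ! e)) \<and> (ph' = 4 \<longrightarrow> b - 3 \<in> utags (specs ! e))) \<or>
      s' = Sink \<and> j = K - 1 \<and> ph \<in> {0, 4})"
  by (erule tr_D) auto

lemma wf_nth: "e < length specs \<Longrightarrow> wf_spec K (specs ! e)"
  using wf_specs by simp

lemma inv_DI:
  assumes "e < length specs" "ph \<le> 4" "j < K" "p = bp n (t * K + j) + Suc i" "i \<le> Suc n + t"
    "hist (specs ! e) n w ph t \<beta>"
    "\<forall>x<4. int (c x) = int (\<beta> x) + prog (specs ! e) ph n w t j i x"
    "ph = 3 \<and> 0 < j \<longrightarrow> X n w t 0 \<le> \<beta> 0 \<and> Suc n + t - X n w t 0 \<le> \<beta> 1"
  shows "inv n w p (D e ph j) c"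
  unfolding inv_def st.case using assms by blast

lemma inv_PaI:
  assumes "p = bp n b + Suc i" "i \<le> NN n b" "j = b mod K"
    "c (src j) + c (Suc (src j)) + i = NN n b" "c (dst j) + c (Suc (dst j)) = i"
  shows "inv n w p (Pa m j) c"
  unfolding inv_def st.case using assms by blast

lemma inv_D_step:
  assumes ex: "exact n w" and nomatch: "\<And>e. e \<in> set specs \<Longrightarrow> \<not> match e n w"
    and iv: "inv n w p (D e ph j) c" and tr: "tr n (D e ph j) (w p) s' d"
    and c': "\<forall>x<4. int (c' x) = int (c x) + d x"
  shows "inv n w (Suc p) s' c'"
proof -
  let ?e = "specs ! e"
  obtain t i \<beta> where p: "p = bp n (t * K + j) + Suc i" "i \<le> Suc n + t" and h: "hist ?e n w ph t \<beta>"
    and c: "\<forall>x<4. int (c x) = int (\<beta> x) + prog ?e ph n w t j i x"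
    and ch: "ph = 3 \<and> 0 < j \<longrightarrow> X n w t 0 \<le> \<beta> 0 \<and> Suc n + t - X n w t 0 \<le> \<beta> 1"
    and e: "e < length specs" "ph \<le> 4" "j < K"
    using iv unfolding inv_def by auto
  note wf = wf_nth[OF e(1)]
  have N: "NN n (t * K + j) = Suc n + t" by (rule NN_rec[OF e(3)])
  note lt = exact_letter[OF ex, of i "t * K + j", unfolded N, OF p(2), folded p(1)]
  from tr_D_cases[OF tr] consider
      (letter) "w p < 2" "s' = D e ph j" "d = bdelta ?e ph j (w p)"
    | (sep) "w p = 2" "Suc j < K" "s' = D e ph (Suc j)" "d = sdelta ?e ph (Suc j)"
    | (tag) ph' where "3 \<le> w p" "j = K - 1" "ph \<in> {1, 2, 3}" "d = tdelta ?e" "s' = D e ph' 0"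
        "ph' \<in> {2, 3, 4}" "ph' = 2 \<longrightarrow> skips ?e" "ph' = 3 \<longrightarrow> chain ?e" "ph' = 4 \<longrightarrow> w p - 3 \<in> utags ?e"
    | (sink) "s' = Sink" "j = K - 1" "ph \<in> {0, 4}"
    by blast
  then show ?thesis
  proof cases
    case letter
    then have i: "i < Suc n + t" using lt by auto
    have "\<forall>x<4. int (c' x) = int (\<beta> x) + prog ?e ph n w t j (Suc i) x"
      using c c' prog_letter[OF ex e(3) i] letter(3) p(1) by auto
    then show ?thesis unfolding letter(2)
      by (intro inv_DI[of e ph j "Suc p" n t "Suc i" w \<beta>]) (use p i h ch e in auto)
  next
    case sep
    then have i: "i = Suc n + t" "p = bp n (t * K + Suc j)" using lt by auto
    have c2: "\<forall>x<4. int (c' x) = int (\<beta> x) + prog ?e ph n w t (Suc j) 0 x"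
      using c c' prog_sep[of ?e ph n w t j] sep(4) i(1) by auto
    \<comment> \<open>When block 0 ends, counters 0 and 1 have been unloaded but not yet reloaded,
      so their being nonnegative is exactly this pair of bounds.\<close>
    have "X n w t 0 \<le> \<beta> 0 \<and> Suc n + t - X n w t 0 \<le> \<beta> 1" if p3: "ph = 3"
    proof (cases "0 < j")
      case True
      then show ?thesis using ch p3 by simp
    next
      case False
      then have j: "j = 0" by simp
      have "chain ?e" using h p3 by (simp add: hist_def)
      then have cs: "cs ?e 0 = CSpec 3 True False False 0 True False 0" "cs ?e 1 = CSpec 3 False True True 0 False True 0"
        using wf by (simp_all add: wf_spec_def)
      have "int (c 0) = int (\<beta> 0) + prog ?e ph n w t j i 0" "int (c 1) = int (\<beta> 1) + prog ?e ph n w t j i 1"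
        using c by simp_all
      moreover have "prog ?e ph n w t j i 0 = - int (X n w t 0)"
        by (simp add: prog_def cs p3 j i(1) loads_def unloads_def sd_def X_def)
      moreover have "prog ?e ph n w t j i 1 = - int (Suc n + t - X n w t 0)"
        by (simp add: prog_def cs p3 j i(1) loads_def unloads_def sd_def X_def del: One_nat_def)
      ultimately show ?thesis by linarith
    qed
    then show ?thesis unfolding sep(3)
      by (intro inv_DI[of e ph "Suc j" "Suc p" n t 0 w \<beta>]) (use sep i c2 h e in auto)
  next
    case tag
    then have i0: "i = Suc n + t \<and> p = bp n (Suc (t * K + j))" using lt by linarith
    have eq: "Suc (t * K + j) = Suc t * K" using tag(2) K6 by simp
    have i: "i = Suc n + t" "p = bp n (Suc t * K)" using i0 by (simp_all only: eq)
    have tg: "tag n w (Suc t) = w p - 3" by (simp add: tag_def i(2))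
    have "hist ?e n w ph' (Suc t) c'"
    proof (rule hist_next[OF wf ex h tag(3,6,7,8)])
      show "ph' = 4 \<longrightarrow> tag n w (Suc t) \<in> utags ?e" using tag(9) tg by simp
      show "\<forall>x<4. int (c x) = int (\<beta> x) + prog ?e ph n w t (K - 1) i x" using c tag(2) by simp
      show "ph = 3 \<longrightarrow> X n w t 0 \<le> \<beta> 0 \<and> Suc n + t - X n w t 0 \<le> \<beta> 1" using ch tag(2) K6 by auto
      show "\<forall>x<4. int (c' x) = int (c x) + tdelta ?e x" using c' tag(4) by simp
    qed
    then show ?thesis unfolding tag(5)
      by (intro inv_DI[of e ph' 0 "Suc p" n "Suc t" 0 w c']) (use tag(6) e(1) K6 i(2) in auto)
  next
    case sink
    have "match ?e n w"
      by (rule hist_match[OF wf h sink(3), of c i]) (use c sink(2) in auto)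
    then show ?thesis using nomatch e(1) by auto
  qed
qed

lemma inv_step:
  assumes ex: "exact n w" and first: "\<And>j. j < 4 \<Longrightarrow> X n w 0 j = 0"
    and nomatch: "\<And>e. e \<in> set specs \<Longrightarrow> \<not> match e n w"
    and iv: "inv n w p s c" and tr: "tr n s (w p) s' d"
    and c': "\<forall>x<4. int (c' x) = int (c x) + d x"
  shows "inv n w (Suc p) s' c'"
proof (cases s)
  case Ini
  then have "p = 0" "\<forall>x<4. c x = 0" using iv by (auto simp: inv_def)
  then show ?thesis using tr c' unfolding Ini by (auto elim!: tr_Ini simp: inv_def)
next
  case (Ch i)
  then have p: "p + i = Suc n" "c 1 + i = n" "c 0 = 0" "c 2 = 0" "c 3 = 0" using iv by (auto simp: inv_def)
  from tr_Ch_cases[OF tr[unfolded Ch]] consider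
    (a) i' where "i = Suc i'" "s' = Ch i'" "d = e1 1" | (b) "i = 0" "s' = FC 0"
    | (c) "i = 0" "s' = Pa False 0" "d = e1 1" by blast
  then show ?thesis
  proof cases
    case a
    then show ?thesis using p c'[unfolded all_less_4] by (auto simp: inv_def e1_def)
  next
    case b
    then show ?thesis using p by (auto simp: inv_def intro!: exI[of _ "0::nat"])
  next
    case c
    have "c' 0 = 0" "c' 1 = Suc n" "c' 2 = 0" "c' 3 = 0"
      using p c(1,3) c'[unfolded all_less_4] by (auto simp: e1_def)
    then show ?thesis unfolding c(2)
      by (intro inv_PaI[of "Suc p" n 0 0])
        (use p c(1) in \<open>auto simp: src_def dst_def NN_def numeral_3_eq_3 numeral_2_eq_2\<close>)
  qed
next
  case (FC j)
  then obtain i where p: "j < 4" "i \<le> NN n j" "p = bp n j + Suc i" using iv by (auto simp: inv_def)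
  have jK: "j < K" using p K6 by simp
  then have N: "NN n j = Suc n" by (simp add: NN_def)
  note lt = exact_letter[OF ex p(2), folded p(3)]
  from tr_FC_cases[OF tr[unfolded FC]] consider (a) "w p = 0" "s' = FC j" | (b) "w p = 1"
    | (c) "w p = 2" "Suc j < 4" "s' = FC (Suc j)" by (elim conjE disjE) metis+
  then show ?thesis
  proof cases
    case a
    then show ?thesis using p lt by (auto simp: inv_def intro!: exI[of _ "Suc i"])
  next
    case b
    then have i: "i < NN n j" using lt by auto
    have "ones n w j (Suc i) \<le> ones n w j (NN n j)" using ones_mono[OF ex, of "Suc i" "NN n j" j] i by simp
    moreover have "ones n w j (Suc i) \<ge> 1" using b p(3) by (simp add: ones_Suc)
    moreover have "ones n w j (NN n j) = X n w 0 j" by (simp add: X_def N)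
    ultimately show ?thesis using first[OF p(1)] by simp
  next
    case c
    then have "p = bp n (Suc j)" using lt by auto
    then show ?thesis using c by (auto simp: inv_def intro!: exI[of _ "0::nat"])
  qed
next
  case (Pa m j)
  then obtain b i where p: "p = bp n b + Suc i" "i \<le> NN n b" "j = b mod K"
    "c (src j) + c (Suc (src j)) + i = NN n b" "c (dst j) + c (Suc (dst j)) = i"
    using iv by (auto simp: inv_def)
  note lt = exact_letter[OF ex p(2), folded p(1)]
  show ?thesis
  proof (cases "i < NN n b")
    case True
    then have "w p < 2" using lt by auto
    from tr_Pa_letter[OF tr[unfolded Pa] this] obtain h h' where h: "h < 2" "h' < 2" "s' = Pa m j"
      "d = (\<lambda>x. e1 (dst j + h') x - e1 (src j + h) x)" by blast
    note tc = transfer_counts[OF c'[unfolded h(4)] h(1,2)]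
    have "h = 0 \<or> h = 1" "h' = 0 \<or> h' = 1" using h by auto
    then have "c' (src j) + c' (Suc (src j)) + Suc i = NN n b" "c' (dst j) + c' (Suc (dst j)) = Suc i"
      using tc p(4,5) by auto
    then show ?thesis unfolding h(3)
      by (intro inv_PaI[of "Suc p" n b "Suc i"]) (use True p in auto)
  next
    case False
    then have i: "i = NN n b" "p = bp n (Suc b)" "2 \<le> w p" using lt by auto
    have z: "c (src j) = 0" "c (Suc (src j)) = 0" using p(4) i by auto
    have "s' \<noteq> Sink"
    proof
      assume "s' = Sink"
      from tr_Pa_Sink_cases[OF tr[unfolded Pa this]] obtain h where h: "h < 2" "d = (\<lambda>x. - e1 (src j + h) x)" by blast
      have "src j + h < 4" using h src_dst[of j] by auto
      moreover have "h = 0 \<or> h = 1" using h by auto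
      then have "c (src j + h) = 0" using z by auto
      ultimately show False using c'[rule_format, of "src j + h"] h by (simp add: e1_def)
    qed
    from tr_Pa_cases[OF tr[unfolded Pa] this] consider
      (a) h h' where "h < 2" "h' < 2" "d = (\<lambda>x. e1 (dst j + h') x - e1 (src j + h) x)"
      | (b) "Suc j < K" "s' = Pa m (Suc j)" "d = (\<lambda>_. 0)"
      | (c) m' where "j = K - 1" "d = e1 1" "s' = Pa m' 0" by blast
    then show ?thesis
    proof cases
      case a
      then show ?thesis using transfer_counts(5,6)[OF c'[unfolded a(3)] a(1,2)] z by auto
    next
      case b
      have "c' x = c x" if "x < 4" for x using c' b(3) that by auto
      moreover have "src j < 4" "Suc (src j) < 4" "dst j < 4" "Suc (dst j) < 4" using src_dst[of j] by auto
      ultimately have "c' (src j) = 0" "c' (Suc (src j)) = 0" "c' (dst j) + c' (Suc (dst j)) = NN n b"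
        using z p(5) i by auto
      moreover have "dst (Suc j) = src j" by (simp add: src_def dst_def)
      moreover have "Suc b mod K = Suc j" "NN n (Suc b) = NN n b" using b(1) p(3) by (auto simp: Suc_mod_K NN_Suc)
      ultimately show ?thesis unfolding b(2)
        by (intro inv_PaI[of "Suc p" n "Suc b" 0]) (use i in auto)
    next
      case c
      have sj: "Suc j = K" using c K6 by simp
      have j: "dst j = 0" "src j = 2" using c(1) dst_last src_dst[of j] by auto
      have "c' 0 = c 0" "c' 1 = Suc (c 1)" "c' 2 = c 2" "c' 3 = c 3"
        using c'[unfolded all_less_4 c(2)] by (auto simp: e1_def)
      moreover have "c 2 = 0" "c 3 = 0" "c 0 + c 1 = NN n b" using z p(5) i j by (auto simp: numeral_3_eq_3 numeral_2_eq_2)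
      moreover have "Suc b mod K = 0" "NN n (Suc b) = Suc (NN n b)" using sj p(3) by (auto simp: Suc_mod_K NN_Suc)
      ultimately show ?thesis unfolding c(3)
        by (intro inv_PaI[of "Suc p" n "Suc b" 0])
          (use i in \<open>auto simp: src_def dst_def numeral_3_eq_3 numeral_2_eq_2\<close>)
    qed
  qed
next
  case DSkip
  have z: "0 < p" "\<forall>x<4. c x = 0" using iv by (auto simp: inv_def DSkip)
  from tr_DSkip_cases[OF tr[unfolded DSkip]] consider (a) "s' = DSkip" "d = (\<lambda>_. 0)"
    | (b) e ph where "s' = D e ph 0" "d = (\<lambda>_. 0)" "e < length specs" "3 \<le> w p"
      "ph = 1 \<and> two (specs ! e) \<and> w p - 3 \<in> ltags (specs ! e) \<or>
         ph = 0 \<and> \<not> two (specs ! e) \<and> w p - 3 \<in> utags (specs ! e)" by blast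
  then show ?thesis
  proof cases
    case a
    then show ?thesis using z c' by (auto simp: inv_def)
  next
    case b
    obtain t where t: "p = bp n (t * K)" using exact_tag_position[OF ex b(4)] by blast
    have "hist (specs ! e) n w ph t c'" using b(2,5) z c' t by (auto simp: hist_def tag_def)
    then show ?thesis unfolding b(1)
      by (intro inv_DI[of e ph 0 "Suc p" n t 0 w c']) (use b K6 t in auto)
  qed
next
  case (D e ph j)
  then show ?thesis using inv_D_step[OF ex nomatch] iv tr c' by blast
next
  case Sink
  then show ?thesis using iv by (simp add: inv_def)
qed

text \<open>Each entrance to \<open>Sink\<close> requires a defect: a one among the first four
  fields, a separator met too early, or a completed check, which exhibits a match.\<close>

lemma no_error_no_Sink:
  assumes ex: "exact n w" and first: "\<And>j. j < 4 \<Longrightarrow> X n w 0 j = 0"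
    and nomatch: "\<And>e. e \<in> set specs \<Longrightarrow> \<not> match e n w"
    and r: "reach n w 0 init p \<gamma>"
  shows "fst \<gamma> \<noteq> Sink"
proof -
  have "inv n w p (fst \<gamma>) (snd \<gamma>)"
    using r
  proof (induction rule: reach.induct)
    case refl
    show ?case by (simp add: inv_def init_def)
  next
    case (step q \<gamma>' \<gamma>'')
    then show ?case unfolding step_def using inv_step[OF ex first nomatch] by blast
  qed
  then show ?thesis by (auto simp: inv_def)
qed

section \<open>Every error is certified by some run\<close>

lemma reach_DSkip:
  assumes w: "w \<in> topspace (cantor (3 + nt))" and w0: "w 0 = 2" and p: "0 < p"
  shows "reach n w 0 init p (DSkip, \<lambda>_. 0)"
  using p
proof (induction p)
  case (Suc p)
  have wk: "w q < 3 + nt" for q using w by (simp add: cantor_def PiE_def Pi_def)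
  show ?case
  proof (cases "p = 0")
    case True
    have "step n w 0 init (DSkip, \<lambda>_. 0)" using w0 unfolding step_def
      by (intro exI[of _ "\<lambda>_. 0"]) (auto simp: init_def intro: tr.IniD)
    then show ?thesis using True reach_1 by simp
  next
    case False
    have "step n w p (DSkip, \<lambda>_. 0) (DSkip, \<lambda>_. 0)" using wk[of p] unfolding step_def
      by (intro exI[of _ "\<lambda>_. 0"]) (auto intro: tr.DSk)
    then show ?thesis using Suc False reach.step by simp
  qed
qed simp

definition dcnt :: "spec \<Rightarrow> nat \<Rightarrow> nat \<Rightarrow> (nat \<Rightarrow> nat) \<Rightarrow> nat \<Rightarrow> nat \<Rightarrow> nat \<Rightarrow> (nat \<Rightarrow> nat) \<Rightarrow> nat \<Rightarrow> nat" where
  "dcnt e ph n w t j i \<beta> x = nat (int (\<beta> x) + prog e ph n w t j i x)"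

lemma dcnt_start [simp]: "dcnt e ph n w t 0 0 \<beta> = \<beta>"
  by (rule ext) (simp add: dcnt_def)

lemma D_record:
  assumes ex: "exact n w" and e: "e < length specs" "ph \<le> 4"
    and nn: "\<And>j i x. j < K \<Longrightarrow> i \<le> Suc n + t \<Longrightarrow> x < 4 \<Longrightarrow> 0 \<le> int (\<beta> x) + prog (specs ! e) ph n w t j i x"
    and j: "j < K" and i: "i \<le> Suc n + t"
  shows "reach n w (Suc (bp n (t * K))) (D e ph 0, \<beta>) (bp n (t * K + j) + Suc i)
     (D e ph j, dcnt (specs ! e) ph n w t j i \<beta>)"
proof -
  let ?e = "specs ! e"
  have dc: "int (dcnt ?e ph n w t j i \<beta> x) = int (\<beta> x) + prog ?e ph n w t j i x"
    if "j < K" "i \<le> Suc n + t" "x < 4" for j i x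
    using nn[OF that] by (simp add: dcnt_def)
  have blk: "i \<le> Suc n + t \<Longrightarrow> reach n w (bp n (t * K + j) + Suc 0) (D e ph j, dcnt ?e ph n w t j 0 \<beta>)
     (bp n (t * K + j) + Suc i) (D e ph j, dcnt ?e ph n w t j i \<beta>)" if j: "j < K" for j i
  proof (induction i)
    case 0
    show ?case by (rule reach.refl)
  next
    case (Suc i)
    let ?p = "bp n (t * K + j) + Suc i"
    have "w ?p < 2" using exact_letter[OF ex, of i "t * K + j"] Suc.prems NN_rec[OF j, of n t] by auto
    then have "tr n (D e ph j) (w ?p) (D e ph j) (bdelta ?e ph j (w ?p))"
      by (intro tr.Db) (use e j in auto)
    then have "step n w ?p (D e ph j, dcnt ?e ph n w t j i \<beta>) (D e ph j, dcnt ?e ph n w t j (Suc i) \<beta>)"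
      unfolding step_def
      using dc[OF j, of i] dc[OF j, of "Suc i"] prog_letter[OF ex j, of i t ?e ph] Suc.prems
      by (intro exI[of _ "bdelta ?e ph j (w ?p)"]) auto
    then show ?case using Suc reach.step by fastforce
  qed
  have "reach n w (Suc (bp n (t * K))) (D e ph 0, \<beta>) (bp n (t * K + j) + Suc 0)
     (D e ph j, dcnt ?e ph n w t j 0 \<beta>)"
    using j
  proof (induction j)
    case 0
    show ?case by (simp add: reach.refl)
  next
    case (Suc j)
    then have jK: "j < K" by simp
    let ?p = "bp n (t * K + j) + Suc (Suc n + t)"
    have N: "NN n (t * K + j) = Suc n + t" by (rule NN_rec[OF jK])
    have p: "?p = bp n (Suc (t * K + j))" by (simp add: bp_Suc N)
    have m: "(t * K + Suc j) mod K = Suc j" using Suc.prems by (simp del: add_Suc_right add_Suc)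
    have "sep_ok (t * K + Suc j) (w ?p)" using ex unfolding p exact_def by simp
    then have "w ?p = 2" using m by (simp add: sep_ok_def)
    then have "tr n (D e ph j) (w ?p) (D e ph (Suc j)) (sdelta ?e ph (Suc j))"
      using tr.Ds[OF e Suc.prems] by simp
    then have "step n w ?p (D e ph j, dcnt ?e ph n w t j (Suc n + t) \<beta>) (D e ph (Suc j), dcnt ?e ph n w t (Suc j) 0 \<beta>)"
      unfolding step_def
      using dc[OF jK, of "Suc n + t"] dc[OF Suc.prems, of 0] prog_sep[of ?e ph n w t j]
      by (intro exI[of _ "sdelta ?e ph (Suc j)"]) auto
    from reach.step[OF reach_trans[OF Suc.IH[OF jK] blk[OF jK order_refl]] this]
    show ?case unfolding p by simp
  qed
  then show ?thesis using blk[OF j i] reach_trans by blast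
qed

lemma sd_le_full:
  assumes "exact n w" "j < K" "i \<le> Suc n + t"
  shows "sd f1 f0 n w (t * K + j) i \<le> sd f1 f0 n w (t * K + j) (Suc n + t)"
  using sd_mono[OF assms(1), of i "t * K + j"] assms(2,3) by (simp add: NN_rec)

text \<open>A run that can pay the full amount never becomes negative on the way. In a single record
  loading comes before unloading; at a link and at the last record the counters already cover the
  payment.\<close>

lemma prog_nonneg:
  assumes wf: "wf_spec K e" and ex: "exact n w" and j: "j < K" and i: "i \<le> Suc n + t" and x: "x < 4"
    and ph: "ph = 0 \<and> \<not> two e \<and> UL e n w x t + c_c (cs e x) \<le> LD e n w x t \<or> ph = 1 \<or> ph = 2 \<or>
      ph = 3 \<and> chain e \<and> (x < 2 \<longrightarrow> UL e n w x t \<le> \<beta> x) \<or>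
      ph = 4 \<and> UL e n w x t + c_c (cs e x) \<le> \<beta> x"
  shows "0 \<le> int (\<beta> x) + prog e ph n w t j i x"
proof -
  let ?c = "cs e x"
  have u: "(if c_up ?c < j then int (UL e n w x t + min (c_c ?c) (j - c_up ?c))
        else if c_up ?c = j then int (sd (c_u1 ?c) (c_u0 ?c) n w (t * K + j) i) else 0)
     \<le> (if c_up ?c \<le> j then int (UL e n w x t + c_c ?c) else 0)"
    using sd_le_full[OF ex j i, of "c_u1 ?c" "c_u0 ?c"] by (auto simp: UL_def Let_def)
  have l: "0 \<le> (if c_lp ?c < j then int (LD e n w x t)
        else if c_lp ?c = j then int (sd (c_l1 ?c) (c_l0 ?c) n w (t * K + j) i) else 0)" by simp
  show ?thesis
  proof (cases "unloads ph x")
    case False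
    then show ?thesis using l by (simp add: prog_def Let_def)
  next
    case True
    then consider (0) "ph = 0" "\<not> two e" "UL e n w x t + c_c ?c \<le> LD e n w x t"
      | (3) "ph = 3" "chain e" "x < 2" "UL e n w x t \<le> \<beta> x"
      | (4) "ph = 4" "UL e n w x t + c_c ?c \<le> \<beta> x"
      using ph by (auto simp: unloads_def)
    then show ?thesis
    proof cases
      case 0
      have "c_lp ?c < c_up ?c" using wf 0 x by (simp add: wf_spec_def)
      then show ?thesis using 0 u by (auto simp: prog_def Let_def loads_def unloads_def split: if_splits)
    next
      case 3
      have "c_c ?c = 0" using wf 3 by (auto simp: wf_spec_def less_2_cases_iff)
      then show ?thesis using 3 u l by (auto simp: prog_def Let_def loads_def unloads_def split: if_splits)
    next
      case 4
      then show ?thesis using u by (auto simp: prog_def Let_def loads_def unloads_def split: if_splits)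
    qed
  qed
qed

text \<open>Steps constrain only the counters below 4, so contents are described on these
  alone.\<close>

definition at_end :: "nat \<Rightarrow> nat \<Rightarrow> (nat \<Rightarrow> nat) \<Rightarrow> nat \<Rightarrow> nat \<Rightarrow> (nat \<Rightarrow> nat) \<Rightarrow> bool" where
  "at_end e ph w n r \<beta> \<longleftrightarrow> (\<exists>\<gamma>. reach n w 0 init (bp n (Suc r * K)) (D e ph (K - 1), \<gamma>) \<and> (\<forall>x<4. \<gamma> x = \<beta> x))"

lemma D_record_end:
  assumes ex: "exact n w" and e: "e < length specs" "ph \<le> 4"
    and r: "reach n w 0 init (Suc (bp n (t * K))) (D e ph 0, \<beta>)"
    and ph: "\<And>x. x < 4 \<Longrightarrow> ph = 0 \<and> \<not> two (specs ! e) \<and> UL (specs ! e) n w x t + c_c (cs (specs ! e) x) \<le> LD (specs ! e) n w x t \<or>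
      ph = 1 \<or> ph = 2 \<or>
      ph = 3 \<and> chain (specs ! e) \<and> (x < 2 \<longrightarrow> UL (specs ! e) n w x t \<le> \<beta> x) \<or>
      ph = 4 \<and> UL (specs ! e) n w x t + c_c (cs (specs ! e) x) \<le> \<beta> x"
    and v: "\<And>x. x < 4 \<Longrightarrow> int (\<beta>' x) = int (\<beta> x) + (if loads ph x then int (LD (specs ! e) n w x t) else 0)
      - (if unloads ph x then int (UL (specs ! e) n w x t + c_c (cs (specs ! e) x)) else 0)"
  shows "at_end e ph w n t \<beta>'"
proof -
  let ?e = "specs ! e"
  note wf = wf_nth[OF e(1)]
  have K1: "K - 1 < K" using K6 by simp
  have nn: "0 \<le> int (\<beta> x) + prog ?e ph n w t j i x" if "j < K" "i \<le> Suc n + t" "x < 4" for j i x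
    using prog_nonneg[where ph = ph and \<beta> = \<beta>, OF wf ex that ph[OF that(3)]] .
  have eq: "Suc (t * K + (K - 1)) = Suc t * K" using K6 by simp
  have "bp n (t * K + (K - 1)) + Suc (Suc n + t) = bp n (Suc t * K)"
    using bp_Suc[of n "t * K + (K - 1)"] by (simp only: eq NN_rec[OF K1])
  then have "reach n w 0 init (bp n (Suc t * K)) (D e ph (K - 1), dcnt ?e ph n w t (K - 1) (Suc n + t) \<beta>)"
    using reach_trans[OF r D_record[OF ex e nn K1 order_refl]] by simp
  moreover have "dcnt ?e ph n w t (K - 1) (Suc n + t) \<beta> x = \<beta>' x" if x: "x < 4" for x
    using v[OF x] prog_end[OF wf x, of ph n w t "Suc n + t"] by (simp add: dcnt_def)
  ultimately show ?thesis unfolding at_end_def by blast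
qed

lemma exact_tag: "exact n w \<Longrightarrow> 3 \<le> w (bp n (t * K)) \<and> w (bp n (t * K)) < 3 + nt"
  unfolding exact_def sep_ok_def by (metis mod_mult_self2_is_0)

lemma at_end_next:
  assumes ex: "exact n w" and e: "e < length specs" and two: "two (specs ! e)" and a: "at_end e ph w n r \<beta>"
    and ph: "ph \<in> {1, 2, 3}" "ph' \<in> {2, 3, 4}" "ph' = 2 \<longrightarrow> skips (specs ! e)" "ph' = 3 \<longrightarrow> chain (specs ! e)"
      "ph' = 4 \<longrightarrow> tag n w (Suc r) \<in> utags (specs ! e)"
  shows "\<exists>\<gamma>. reach n w 0 init (Suc (bp n (Suc r * K))) (D e ph' 0, \<gamma>) \<and>
     (\<forall>x<4. \<gamma> x = \<beta> x + (if c_g (cs (specs ! e) x) then 1 else 0))"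
proof -
  obtain \<gamma> where g: "reach n w 0 init (bp n (Suc r * K)) (D e ph (K - 1), \<gamma>)" "\<forall>x<4. \<gamma> x = \<beta> x"
    using a unfolding at_end_def by blast
  let ?g = "\<lambda>x. \<gamma> x + (if c_g (cs (specs ! e) x) then 1 else 0)"
  have "tr n (D e ph (K - 1)) (w (bp n (Suc r * K))) (D e ph' 0) (tdelta (specs ! e))"
    by (rule tr.Dt) (use e two ph exact_tag[OF ex, of "Suc r"] in \<open>auto simp: tag_def\<close>)
  then have "step n w (bp n (Suc r * K)) (D e ph (K - 1), \<gamma>) (D e ph' 0, ?g)"
    unfolding step_def by (intro exI[of _ "tdelta (specs ! e)"]) (auto simp: tdelta_def)
  then show ?thesis using g reach.step by (intro exI[of _ ?g]) auto
qed

lemma at_end_Sink: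
  assumes ex: "exact n w" and e: "e < length specs" and a: "at_end e ph w n r \<beta>" and ph: "ph \<in> {0, 4}"
  shows "\<exists>p \<gamma>. reach n w 0 init p (Sink, \<gamma>)"
proof -
  obtain \<gamma> where g: "reach n w 0 init (bp n (Suc r * K)) (D e ph (K - 1), \<gamma>)"
    using a unfolding at_end_def by blast
  have "tr n (D e ph (K - 1)) (w (bp n (Suc r * K))) Sink (\<lambda>_. 0)"
    by (rule tr.Dx) (use e ph exact_tag[OF ex, of "Suc r"] in auto)
  then have "step n w (bp n (Suc r * K)) (D e ph (K - 1), \<gamma>) (Sink, \<gamma>)"
    unfolding step_def by (intro exI[of _ "\<lambda>_. 0"]) auto
  then show ?thesis using g reach.step by blast
qed

lemma at_end_skips:
  assumes ex: "exact n w" and e: "e < length specs" and two: "two (specs ! e)" and sk: "0 < d \<longrightarrow> skips (specs ! e)"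
    and a: "at_end e ph w n r \<beta>" "ph \<in> {1, 2, 3}"
  shows "\<exists>ph'\<in>{1, 2, 3}. at_end e ph' w n (r + d) (\<lambda>x. \<beta> x + (if c_g (cs (specs ! e) x) then d else 0))"
  using sk
proof (induction d)
  case 0
  then show ?case using a by (intro bexI[of _ ph]) (auto simp: at_end_def)
next
  case (Suc d)
  then obtain ph' where ph': "ph' \<in> {1, 2, 3}"
    "at_end e ph' w n (r + d) (\<lambda>x. \<beta> x + (if c_g (cs (specs ! e) x) then d else 0))" by auto
  from at_end_next[OF ex e two ph'(2,1), of 2] Suc.prems obtain \<gamma> where
    g: "reach n w 0 init (Suc (bp n (Suc (r + d) * K))) (D e 2 0, \<gamma>)"
      "\<forall>x<4. \<gamma> x = \<beta> x + (if c_g (cs (specs ! e) x) then d else 0) + (if c_g (cs (specs ! e) x) then 1 else 0)"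
    by auto
  have "at_end e 2 w n (Suc (r + d)) (\<lambda>x. \<beta> x + (if c_g (cs (specs ! e) x) then Suc d else 0))"
    by (rule D_record_end[OF ex e _ g(1)]) (use g(2) in \<open>auto simp: loads_def unloads_def\<close>)
  then show ?case by (intro bexI[of _ 2]) auto
qed

lemma reach_D_start:
  assumes ex: "exact n w" and nt: "0 < nt" and e: "e < length specs"
    and ph: "ph = 1 \<and> two (specs ! e) \<and> tag n w t \<in> ltags (specs ! e) \<or>
      ph = 0 \<and> \<not> two (specs ! e) \<and> tag n w t \<in> utags (specs ! e)"
  shows "reach n w 0 init (Suc (bp n (t * K))) (D e ph 0, \<lambda>_. 0)"
proof -
  have p: "0 < bp n (t * K)" using bp_mono[of 0 "t * K" n] by simp
  have "w 0 = 2" using ex by (simp add: exact_def)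
  from reach_DSkip[OF exact_in_topspace[OF ex nt] this p]
  have "reach n w 0 init (bp n (t * K)) (DSkip, \<lambda>_. 0)" .
  moreover have "tr n DSkip (w (bp n (t * K))) (D e ph 0) (\<lambda>_. 0)"
    using ph exact_tag[OF ex, of t] e by (auto simp: tag_def intro: tr.D0 tr.D1[unfolded One_nat_def])
  then have "step n w (bp n (t * K)) (DSkip, \<lambda>_. 0) (D e ph 0, \<lambda>_. 0)"
    unfolding step_def by (intro exI[of _ "\<lambda>_. 0"]) auto
  ultimately show ?thesis by (rule reach.step)
qed

lemma at_end_load:
  assumes ex: "exact n w" and nt: "0 < nt" and e: "e < length specs"
    and two: "two (specs ! e)" and t: "tag n w t \<in> ltags (specs ! e)"
  shows "at_end e 1 w n t (\<lambda>x. LD (specs ! e) n w x t)"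
proof -
  have r: "reach n w 0 init (Suc (bp n (t * K))) (D e 1 0, \<lambda>_. 0)"
    using reach_D_start[OF ex nt e] two t by blast
  show ?thesis by (rule D_record_end[OF ex e _ r]) (auto simp: loads_def unloads_def)
qed

lemma at_end_link:
  assumes ex: "exact n w" and nt: "0 < nt" and e: "e < length specs"
    and two: "two (specs ! e)" and l: "link (specs ! e) n w t' q (Suc r)"
  shows "\<exists>ph\<in>{1, 2, 3}. at_end e ph w n r (\<lambda>x. let o' = if chain (specs ! e) \<and> x < 2 then q else t' in
     LD (specs ! e) n w x o' + (if c_g (cs (specs ! e) x) then r - o' else 0))"
proof -
  let ?e = "specs ! e"
  note wf = wf_nth[OF e]
  define B where "B q r x = (let o' = if chain ?e \<and> x < 2 then q else t' in
     LD ?e n w x o' + (if c_g (cs ?e x) then r - o' else 0))" for q r x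
  have lt: "tag n w t' \<in> ltags ?e" using l by (simp add: link_def)
  have qr: "q \<le> r" using l by (simp add: link_def)
  have sk: "0 < r - q \<longrightarrow> skips ?e" using l by (auto simp: link_def)
  \<comment> \<open>Between two links every record is skipped, and only the gains change the
    counters.\<close>
  have gap: "\<exists>ph\<in>{1, 2, 3}. at_end e ph w n r (B q r)"
    if a: "\<exists>ph\<in>{1, 2, 3}. at_end e ph w n q (B q q)" and t'q: "t' \<le> q" "q \<le> r" and sk: "0 < r - q \<longrightarrow> skips ?e" for q r
  proof -
    obtain ph where ph: "ph \<in> {1, 2, 3}" "at_end e ph w n q (B q q)" using a by blast
    from at_end_skips[OF ex e two sk ph(2,1)] obtain ph' where p: "ph' \<in> {1, 2, 3}"
      "at_end e ph' w n (q + (r - q)) (\<lambda>x. B q q x + (if c_g (cs ?e x) then r - q else 0))" by blast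
    have "(\<lambda>x. B q q x + (if c_g (cs ?e x) then r - q else 0)) = B q r"
      by (rule ext) (use t'q in \<open>auto simp: B_def Let_def\<close>)
    then show ?thesis using p t'q by auto
  qed
  have "\<exists>ph\<in>{1, 2, 3}. at_end e ph w n q (B q q)"
  proof (cases "chain ?e")
    case False
    then have "q = t'" using l by (simp add: link_def)
    moreover have "B t' t' = (\<lambda>x. LD ?e n w x t')" by (rule ext) (simp add: B_def)
    ultimately show ?thesis using at_end_load[OF ex nt e two lt] by (intro bexI[of _ 1]) auto
  next
    case True
    then have "(t', q) \<in> (chain_rel n w)\<^sup>*" using l by (simp add: link_def)
    then show ?thesis
    proof (induction rule: rtrancl_induct)
      case base
      have "B t' t' = (\<lambda>x. LD ?e n w x t')" by (rule ext) (simp add: B_def)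
      then show ?case using at_end_load[OF ex nt e two lt] by (intro bexI[of _ 1]) auto
    next
      case (step q p)
      have qp: "q < p" "X n w p 0 = X n w q 3" using step(2) by (auto simp: chain_rel_def)
      have t'q: "t' \<le> q" by (rule chain_rel_le[OF step(1)])
      obtain r where r: "p = Suc r" "q \<le> r" using qp(1) by (cases p) auto
      have "skips ?e" using wf True by (simp add: wf_spec_def)
      then obtain ph where ph: "ph \<in> {1, 2, 3}" "at_end e ph w n r (B q r)"
        using gap[OF step.IH t'q r(2)] by blast
      from at_end_next[OF ex e two ph(2,1), of 3] True obtain \<gamma> where
        g: "reach n w 0 init (Suc (bp n (p * K))) (D e 3 0, \<gamma>)"
          "\<forall>x<4. \<gamma> x = B q r x + (if c_g (cs ?e x) then 1 else 0)" using r by auto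
      have g': "\<forall>x<4. \<gamma> x = B q p x"
        using g(2) r t'q by (auto simp: B_def Let_def)
      have h: "B q p x = held ?e n w t' q p x" for x by (simp add: B_def held_def)
      note hc = held_chain[OF wf True ex qp(1), of t']
      note cv = chain_values[OF wf True ex]
      have u: "UL ?e n w x p = \<gamma> x \<and> c_c (cs ?e x) = 0" if "x < 2" for x
      proof -
        have "x = 0 \<or> x = 1" using that by auto
        then show ?thesis using g' h hc cv qp(2) by (auto simp del: One_nat_def)
      qed
      \<comment> \<open>At the link the counters 0 and 1 are emptied exactly and refilled with the
        number of \<open>p\<close>, while 2 and 3 pass unchanged.\<close>
      have "at_end e 3 w n p (B p p)"
      proof (rule D_record_end[OF ex e _ g(1)])
        fix x :: nat assume x: "x < 4"
        show "int (B p p x) = int (\<gamma> x) + (if loads 3 x then int (LD ?e n w x p) else 0)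
          - (if unloads 3 x then int (UL ?e n w x p + c_c (cs ?e x)) else 0)"
        proof (cases "x < 2")
          case True
          then show ?thesis using u[OF True] \<open>chain ?e\<close> by (simp add: loads_def unloads_def B_def)
        next
          case False
          then show ?thesis using g' x by (simp add: loads_def unloads_def B_def)
        qed
      qed (use u True in auto)
      then show ?case by (intro bexI[of _ 3]) auto
    qed
  qed
  moreover have "t' \<le> q" using link_le[OF l] by simp
  ultimately have "\<exists>ph\<in>{1, 2, 3}. at_end e ph w n r (B q r)"
    by (rule gap[OF _ _ qr sk])
  then show ?thesis by (simp add: B_def[abs_def])
qed

lemma match_Sink:
  assumes ex: "exact n w" and nt: "0 < nt" and e: "e < length specs" and m: "match (specs ! e) n w"
  shows "\<exists>p \<gamma>. reach n w 0 init p (Sink, \<gamma>)"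
proof (cases "two (specs ! e)")
  case False
  let ?e = "specs ! e"
  obtain t where t: "tag n w t \<in> utags ?e" "\<forall>x<4. UL ?e n w x t + c_c (cs ?e x) \<le> LD ?e n w x t"
    using m False by (auto simp: match_def)
  have r: "reach n w 0 init (Suc (bp n (t * K))) (D e 0 0, \<lambda>_. 0)"
    using reach_D_start[OF ex nt e] False t by blast
  have "at_end e 0 w n t (\<lambda>x. LD ?e n w x t - (UL ?e n w x t + c_c (cs ?e x)))"
    by (rule D_record_end[OF ex e _ r]) (use t False in \<open>auto simp: loads_def unloads_def of_nat_diff\<close>)
  then show ?thesis using at_end_Sink[OF ex e] by blast
next
  case True
  let ?e = "specs ! e"
  obtain t' q t where t: "link ?e n w t' q t" "tag n w t \<in> utags ?e"
      "\<forall>x<4. UL ?e n w x t + c_c (cs ?e x) \<le> held ?e n w t' q t x"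
    using m True by (auto simp: match_def)
  obtain r where r: "t = Suc r" using t(1) by (cases t) (auto simp: link_def)
  from at_end_link[OF ex nt e True t(1)[unfolded r]] obtain ph where ph: "ph \<in> {1, 2, 3}"
    "at_end e ph w n r (\<lambda>x. let o' = if chain ?e \<and> x < 2 then q else t' in
     LD ?e n w x o' + (if c_g (cs ?e x) then r - o' else 0))" by blast
  from at_end_next[OF ex e True ph(2,1), of 4] t(2) r obtain \<gamma> where
    g: "reach n w 0 init (Suc (bp n (t * K))) (D e 4 0, \<gamma>)"
      "\<forall>x<4. \<gamma> x = (let o' = if chain ?e \<and> x < 2 then q else t' in
       LD ?e n w x o' + (if c_g (cs ?e x) then r - o' else 0)) + (if c_g (cs ?e x) then 1 else 0)" by auto
  have "\<forall>x<4. \<gamma> x = held ?e n w t' q t x"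
    using g(2) link_le[OF t(1)] r by (auto simp: held_def Let_def)
  then have le: "\<forall>x<4. UL ?e n w x t + c_c (cs ?e x) \<le> \<gamma> x" using t(3) by simp
  have "at_end e 4 w n t (\<lambda>x. \<gamma> x - (UL ?e n w x t + c_c (cs ?e x)))"
    by (rule D_record_end[OF ex e _ g(1)]) (use le in \<open>auto simp: loads_def unloads_def of_nat_diff\<close>)
  then show ?thesis using at_end_Sink[OF ex e] by blast
qed

text \<open>If \<open>Sink\<close> were out of reach, the \<open>FC\<close> run could go through all
  four blocks and would have read zeros only.\<close>

lemma first_record_Sink:
  assumes ex: "exact n w" and j: "j < 4" and X: "X n w 0 j \<noteq> 0"
  shows "\<exists>p \<gamma>. reach n w 0 init p (Sink, \<gamma>)"
proof (rule ccontr)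
  assume no: "\<not> ?thesis"
  define R where "R p s \<longleftrightarrow> (\<exists>\<gamma>. reach n w 0 init p (s, \<gamma>))" for p s
  have step: "R (Suc p) s'" if R: "R p s" "tr n s (w p) s' (\<lambda>_. 0)" for p s s'
  proof -
    obtain \<gamma> where g: "reach n w 0 init p (s, \<gamma>)" using R(1) by (auto simp: R_def)
    have "step n w p (s, \<gamma>) (s', \<gamma>)"
      unfolding step_def by (rule exI[of _ "\<lambda>_. 0"]) (use R(2) in simp)
    with g show ?thesis unfolding R_def by (blast intro: reach.step)
  qed
  have nS: "\<not> R p Sink" for p using no by (auto simp: R_def)
  have start: "R (Suc (bp n 0)) (FC 0)"
  proof -
    have "R (Suc n) (Ch 0)" using chain_reach[OF ex] by (auto simp: R_def)
    moreover have "tr n (Ch 0) (w (Suc n)) (FC 0) (\<lambda>_. 0)"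
      using exact_tag[OF ex, of 0] by (intro tr.ChFC) auto
    ultimately show ?thesis using step by simp
  qed
  have blk: "i \<le> Suc n \<Longrightarrow> R (bp n j + Suc i) (FC j) \<and> ones n w j i = 0" if R: "R (bp n j + Suc 0) (FC j)" and j: "j < 4" for j i
  proof (induction i)
    case 0
    then show ?case using R by simp
  next
    case (Suc i)
    have "NN n j = Suc n" using NN_rec[of j n 0] j K6 by simp
    then have "w (bp n j + Suc i) < 2" using exact_letter[OF ex, of i j] Suc.prems by auto
    then consider "w (bp n j + Suc i) = 0" | "w (bp n j + Suc i) = 1" by linarith
    then show ?case
    proof cases
      case 1
      then have "R (Suc (bp n j + Suc i)) (FC j)" using Suc step[of "bp n j + Suc i" "FC j"] tr.FC0[OF j] by auto
      then show ?thesis using Suc 1 by (simp add: ones_Suc)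
    next
      case 2
      then have "R (Suc (bp n j + Suc i)) Sink"
        using Suc step[of "bp n j + Suc i" "FC j"] tr.FC1[OF j] by auto
      then show ?thesis using nS by blast
    qed
  qed
  have "j < 4 \<Longrightarrow> R (bp n j + Suc 0) (FC j)" for j
  proof (induction j)
    case 0
    then show ?case using start by simp
  next
    case (Suc j)
    have N: "NN n j = Suc n" using NN_rec[of j n 0] Suc.prems K6 by simp
    have b: "R (bp n (Suc j)) (FC j)" using blk[of j "Suc n"] Suc N by (simp add: bp_Suc)
    have "Suc j mod K = Suc j" using Suc.prems K6 by simp
    then have "w (bp n (Suc j)) = 2" using ex unfolding exact_def sep_ok_def by (metis nat.distinct(1))
    then show ?case using step[OF b] tr.FCs[OF Suc.prems] by simp
  qed
  from blk[OF this[OF j] j, of "Suc n"] have "X n w 0 j = 0" by (simp add: X_def)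
  then show False using X by simp
qed

end

section \<open>Inequalities between fields as counter specifications\<close>

definition dummy :: cspec where "dummy = CSpec 0 False False False 1 False False 0"
text \<open>One unit is charged and nothing loaded, which is unsatisfiable.\<close>

definition never :: cspec where "never = CSpec 0 False False False 1 False False 1"
text \<open>In these names \<open>x\<close> stands for the ones, \<open>y\<close> for the zeros and
  \<open>n\<close> for the full length of a block; the first letter tells what is loaded, the second
  what is unloaded.\<close>

definition xx :: "nat \<Rightarrow> nat \<Rightarrow> nat \<Rightarrow> cspec" where "xx p q c = CSpec p True False False q True False c"
text \<open>Comparing zeros bounds a value from below: with the gain, which offsets the greater
  length of the later block, field \<open>p\<close> of the earlier record plus \<open>c\<close> is
  at most field \<open>q\<close> of the later one.\<close>

definition yy :: "nat \<Rightarrow> nat \<Rightarrow> nat \<Rightarrow> bool \<Rightarrow> cspec" where "yy p q c g = CSpec p False True g q False True c"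
definition ny :: "nat \<Rightarrow> nat \<Rightarrow> cspec" where "ny q c = CSpec 0 True True False q False True c"
definition yx :: "nat \<Rightarrow> nat \<Rightarrow> nat \<Rightarrow> cspec" where "yx p q c = CSpec p False True False q True False c"
definition xy :: "nat \<Rightarrow> nat \<Rightarrow> nat \<Rightarrow> cspec" where "xy p q c = CSpec p True False False q False True c"
text \<open>The unit charged at one separator demands at least one \<open>1\<close> in block
  1.\<close>

definition hd_pos :: cspec where "hd_pos = CSpec 1 True False False 2 False False 1"
text \<open>The zeros of the earlier block plus the gain must cover the entire later block; this
  happens only if the earlier block consists of zeros.\<close>

definition hd_zero :: cspec where "hd_zero = CSpec 1 False True True 1 True True 0"
text \<open>Within one record the block read first has to be the one that is loaded, which decides
  between comparing ones and comparing zeros.\<close>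

definition le :: "nat \<Rightarrow> nat \<Rightarrow> nat \<Rightarrow> cspec" where
  "le p q c = (if q < p then xx q p c else if p < q then yy p q c False else if c = 0 then dummy else never)"

definition cl :: "cspec list \<Rightarrow> nat \<Rightarrow> cspec" where
  "cl l x = (if x < length l then l ! x else dummy)"

definition same :: "nat set \<Rightarrow> cspec list \<Rightarrow> spec" where "same ut l = Spec False False False {} ut (cl l)"
definition consec :: "cspec list \<Rightarrow> spec" where "consec l = Spec True False False UNIV UNIV (cl l)"
definition ptr :: "nat set \<Rightarrow> nat set \<Rightarrow> cspec list \<Rightarrow> spec" where "ptr lt ut l = Spec True True False lt ut (cl l)"
definition chn :: "nat set \<Rightarrow> cspec list \<Rightarrow> spec" where
  "chn ut l = Spec True True True UNIV ut
     (cl ([CSpec 3 True False False 0 True False 0, CSpec 3 False True True 0 False True 0] @ l))"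

text \<open>The first two fields of consecutive records are compared through the successor function on pairs
  (\<open>prod_encode_Suc\<close>), the level is checked against the parent, and two nodes with bit \<open>1\<close>
  must not have the same parent.\<close>

definition base_specs :: "spec list" where
  "base_specs =
    [consec [xx 3 3 0], consec [yy 3 3 2 True],
     consec [hd_zero, ny 0 0], consec [hd_zero, xx 0 1 0], consec [hd_zero, yy 0 1 2 True],
     consec [hd_pos, xx 0 0 0], consec [hd_pos, yy 0 0 2 True],
     consec [hd_pos, yy 1 1 0 True], consec [hd_pos, xx 1 1 2],
     ptr UNIV UNIV [xx 3 0 0, yy 3 0 0 True, xx 2 2 0],
     ptr UNIV UNIV [xx 3 0 0, yy 3 0 0 True, yy 2 2 2 True],
     ptr {b. odd b} {b. odd b} [xx 0 0 0, yy 0 0 0 True]]"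

definition fpos :: "nat \<Rightarrow> nat" where "fpos j = (if j = 0 then 0 else if j = 1 then 1 else 2)"

text \<open>The errors are the ways in which an atom claimed by a tag in \<open>ut\<close> may fail.\<close>

fun atom_specs :: "nat set \<Rightarrow> atom \<Rightarrow> spec list" where
  "atom_specs ut (AZero a) = [same ut [ny (4 + a) 1]]"
| "atom_specs ut (ASuc a b) = [same ut [le (4 + b) (4 + a) 0], same ut [le (4 + a) (4 + b) 2]]"
| "atom_specs ut (ALt a b) = [same ut [le (4 + b) (4 + a) 0]]"
| "atom_specs ut (AN a) = [same ut [yx 3 (4 + a) 1], same ut [xy 3 (4 + a) 1]]"
| "atom_specs ut (AFld j a b) = [same ut [le 3 (4 + a) 0],
     ptr UNIV ut [xx 3 (4 + a) 0, yy 3 (4 + a) 0 True, xx (fpos j) (4 + b) 1],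
     ptr UNIV ut [xx 3 (4 + a) 0, yy 3 (4 + a) 0 True, yy (fpos j) (4 + b) 1 True]]"
| "atom_specs ut (ABit a) = [same ut [le 3 (4 + a) 0],
     ptr {b. even b} ut [xx 3 (4 + a) 0, yy 3 (4 + a) 0 True]]"
| "atom_specs ut (AAnc a) = [same ut [le 3 (4 + a) 0], same ut [le 0 (4 + a) 1],
     chn ut [yy 0 (4 + a) 1 True, xx 3 (4 + a) 1]]"

text \<open>A tag is a bit plus twice a verdict, where verdict \<open>0\<close> means alive and
  \<open>Suc i\<close> means killed by rule \<open>i\<close>.\<close>

definition kill_tags :: "nat \<Rightarrow> nat set" where "kill_tags i = {b. b div 2 = Suc i}"

definition rule_specs :: "atom list list \<Rightarrow> spec list" where
  "rule_specs rs = concat (map (\<lambda>i. concat (map (atom_specs (kill_tags i)) (rs ! i))) [0..<length rs])"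

section \<open>The errors of a record sequence\<close>

text \<open>The pairing function runs along diagonals. This local description is what consecutive
  records can verify, with increments of 1 and resets to 0.\<close>

lemma prod_encode_Suc:
  "Suc (prod_encode (a, b)) = (if b = 0 then prod_encode (0, Suc a) else prod_encode (Suc a, b - 1))"
  by (cases b) (auto simp: prod_encode_def)

lemma ptl_phd_Suc:
  "phd t = 0 \<Longrightarrow> ptl (Suc t) = 0 \<and> phd (Suc t) = Suc (ptl t)"
  "phd t \<noteq> 0 \<Longrightarrow> ptl (Suc t) = Suc (ptl t) \<and> phd (Suc t) = phd t - 1"
proof -
  have "Suc t = (if phd t = 0 then prod_encode (0, Suc (ptl t)) else prod_encode (Suc (ptl t), phd t - 1))"
    using prod_encode_Suc[of "ptl t" "phd t"] by simp
  then show "phd t = 0 \<Longrightarrow> ptl (Suc t) = 0 \<and> phd (Suc t) = Suc (ptl t)"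
    "phd t \<noteq> 0 \<Longrightarrow> ptl (Suc t) = Suc (ptl t) \<and> phd (Suc t) = phd t - 1"
    by simp_all
qed

lemma anc_le_ptl: "s \<in> anc t \<Longrightarrow> s \<le> ptl t"
  using anc_less[of s "ptl t"] by (cases "t = 0") (auto simp: anc_pos)

definition parent_rel :: "(nat \<times> nat) set" where "parent_rel = {(q, p). q < p \<and> ptl p = q}"

lemma parent_rel_le: "(q, p) \<in> parent_rel\<^sup>* \<Longrightarrow> q \<le> p"
  by (induction rule: rtrancl_induct) (auto simp: parent_rel_def)

text \<open>Numbers decrease towards the root, so the ancestors of \<open>t'\<close> are at most
  \<open>ptl t'\<close> and lie below \<open>s\<close>, while the nodes from \<open>t'\<close> on
  lie above it.\<close>

lemma not_anc_if_jumped: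
  assumes "(t', q) \<in> parent_rel\<^sup>*" "ptl t' < s" "s < t'"
  shows "s \<notin> anc q"
  using assms(1)
proof (induction rule: rtrancl_induct)
  case base
  then show ?case using anc_le_ptl assms by fastforce
next
  case (step q p)
  have "t' \<le> q" by (rule parent_rel_le[OF step(1)])
  then show ?case using step assms by (auto simp: parent_rel_def anc_pos)
qed

text \<open>That \<open>s\<close> is not an ancestor of \<open>t\<close> is witnessed by an edge from \<open>ptl t'\<close> to \<open>t'\<close> on the branch to \<open>t\<close> which
  jumps over \<open>s\<close>. This turns the negated atom \<open>AAnc\<close> into a chain of pointers.\<close>

lemma not_anc_iff:
  "s < t \<Longrightarrow> s \<notin> anc t \<longleftrightarrow> ptl t < s \<or> (\<exists>t'. (t', ptl t) \<in> parent_rel\<^sup>* \<and> ptl t < t \<and> ptl t' < s \<and> s < t')"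
proof (induction t rule: less_induct)
  case (less t)
  then have t: "0 < t" by simp
  let ?u = "ptl t"
  have u: "?u < t" by (rule ptl_less[OF t])
  show ?case
  proof
    assume s: "s \<notin> anc t"
    then have su: "s \<noteq> ?u" "s \<notin> anc ?u" using t by (auto simp: anc_pos)
    show "?u < s \<or> (\<exists>t'. (t', ?u) \<in> parent_rel\<^sup>* \<and> ?u < t \<and> ptl t' < s \<and> s < t')"
    proof (cases "?u < s")
      case False
      then have "s < ?u" using su by simp
      from less.IH[OF u this] su(2) consider "ptl ?u < s"
        | t' where "(t', ptl ?u) \<in> parent_rel\<^sup>*" "ptl ?u < ?u" "ptl t' < s" "s < t'" by blast
      then show ?thesis
      proof cases
        case 1
        then show ?thesis using \<open>s < ?u\<close> u by blast
      next
        case 2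
        then have "(t', ?u) \<in> parent_rel\<^sup>*"
          by (auto simp: parent_rel_def intro: rtrancl_into_rtrancl)
        then show ?thesis using 2 u by blast
      qed
    qed simp
  next
    assume "?u < s \<or> (\<exists>t'. (t', ?u) \<in> parent_rel\<^sup>* \<and> ?u < t \<and> ptl t' < s \<and> s < t')"
    then show "s \<notin> anc t"
    proof
      assume "?u < s"
      then show ?thesis using anc_le_ptl by fastforce
    next
      assume "\<exists>t'. (t', ?u) \<in> parent_rel\<^sup>* \<and> ?u < t \<and> ptl t' < s \<and> s < t'"
      then obtain t' where t': "(t', ?u) \<in> parent_rel\<^sup>*" "ptl t' < s" "s < t'" by blast
      then have "s \<notin> anc ?u" "s \<noteq> ?u" using not_anc_if_jumped parent_rel_le by fastforce+
      then show ?thesis using t by (simp add: anc_pos)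
    qed
  qed
qed

definition wfc :: "nat \<Rightarrow> cspec \<Rightarrow> bool" where
  "wfc K c \<longleftrightarrow> c_lp c < K - 1 \<and> c_up c < K - 1 \<and> c_up c + c_c c \<le> K - 1"

lemma wf_spec_simple:
  assumes "8 \<le> K" "\<forall>c\<in>set l. wfc K c"
  shows "wf_spec K (consec l)" "wf_spec K (ptr lt ut l)" "wf_spec K (chn ut l)"
    "\<forall>c\<in>set l. c_lp c < c_up c \<Longrightarrow> wf_spec K (same ut l)"
proof -
  have c: "wfc K (cl l x)" for x
    using assms by (auto simp: cl_def wfc_def dummy_def)
  have "wfc K (cl ([CSpec 3 True False False 0 True False 0, CSpec 3 False True True 0 False True 0] @ l) x)" for x
    using assms by (auto simp: cl_def wfc_def dummy_def nth_Cons split: nat.splits)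
  then show "wf_spec K (consec l)" "wf_spec K (ptr lt ut l)" "wf_spec K (chn ut l)"
    using c by (auto simp: wf_spec_def consec_def ptr_def chn_def wfc_def cl_def)
  assume "\<forall>c\<in>set l. c_lp c < c_up c"
  then have "c_lp (cl l x) < c_up (cl l x)" for x by (auto simp: cl_def dummy_def)
  then show "wf_spec K (same ut l)" using c by (auto simp: wf_spec_def same_def wfc_def)
qed

lemma wf_base_specs: "8 \<le> K \<Longrightarrow> e \<in> set base_specs \<Longrightarrow> wf_spec K e"
  unfolding base_specs_def
  by (auto intro!: wf_spec_simple simp: wfc_def xx_def yy_def ny_def hd_zero_def hd_pos_def)

lemma wfc_intros:
  "p < K - 1 \<Longrightarrow> q < K - 1 \<Longrightarrow> q + c \<le> K - 1 \<Longrightarrow> wfc K (xx p q c)"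
  "p < K - 1 \<Longrightarrow> q < K - 1 \<Longrightarrow> q + c \<le> K - 1 \<Longrightarrow> wfc K (yy p q c g)"
  "p < K - 1 \<Longrightarrow> q < K - 1 \<Longrightarrow> q + c \<le> K - 1 \<Longrightarrow> wfc K (yx p q c)"
  "p < K - 1 \<Longrightarrow> q < K - 1 \<Longrightarrow> q + c \<le> K - 1 \<Longrightarrow> wfc K (xy p q c)"
  "q < K - 1 \<Longrightarrow> q + c \<le> K - 1 \<Longrightarrow> wfc K (ny q c)"
  "p + c \<le> K - 1 \<Longrightarrow> q + c \<le> K - 1 \<Longrightarrow> p < K - 1 \<Longrightarrow> q < K - 1 \<Longrightarrow> 8 \<le> K \<Longrightarrow> wfc K (le p q c)"
  by (auto simp: wfc_def xx_def yy_def ny_def yx_def xy_def le_def dummy_def never_def)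

lemma c_lp_less:
  "c_lp (le p q c) < c_up (le p q c)" "0 < q \<Longrightarrow> c_lp (ny q c) < c_up (ny q c)"
  "p < q \<Longrightarrow> c_lp (yx p q c) < c_up (yx p q c)" "p < q \<Longrightarrow> c_lp (xy p q c) < c_up (xy p q c)"
  by (auto simp: xx_def yy_def ny_def yx_def xy_def le_def dummy_def never_def)

text \<open>The bound on \<open>K\<close> leaves room behind the block of the last variable for the
  two separators that may have to be charged.\<close>

lemma wf_atom_specs:
  assumes v: "avars x \<subseteq> {..<M}" and K: "M + 7 \<le> K" "8 \<le> K" and e: "e \<in> set (atom_specs ut x)"
  shows "wf_spec K e"
proof -
  have b: "4 + a < K - 1 \<and> 4 + a + 1 \<le> K - 1 \<and> 4 + a + 2 \<le> K - 1" if "a \<in> avars x" for a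
    using v K that by auto
  have f: "fpos j < K - 1" for j using K by (auto simp: fpos_def)
  have s: "wf_spec K (same ut l)" if "\<forall>c\<in>set l. wfc K c \<and> c_lp c < c_up c" for ut l
    using wf_spec_simple(4)[OF K(2)] that by blast
  note w = wf_spec_simple(2,3)[OF K(2)]
  show ?thesis
  proof (cases x)
    case (AZero a)
    show ?thesis using b[of a] K e unfolding AZero by (auto intro!: s wfc_intros c_lp_less)
  next
    case (ASuc a c)
    show ?thesis using b[of a] b[of c] K e unfolding ASuc by (auto intro!: s wfc_intros c_lp_less)
  next
    case (ALt a c)
    show ?thesis using b[of a] b[of c] K e unfolding ALt by (auto intro!: s wfc_intros c_lp_less)
  next
    case (AN a)
    show ?thesis using b[of a] K e unfolding AN by (auto intro!: s wfc_intros c_lp_less)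
  next
    case (AFld j a c)
    show ?thesis using b[of a] b[of c] f[of j] K e unfolding AFld by (auto intro!: s w wfc_intros c_lp_less)
  next
    case (ABit a)
    show ?thesis using b[of a] K e unfolding ABit by (auto intro!: s w wfc_intros c_lp_less)
  next
    case (AAnc a)
    show ?thesis using b[of a] K e unfolding AAnc by (auto intro!: s w wfc_intros c_lp_less)
  qed
qed

locale rule_automaton =
  fixes rs :: "atom list list" and M :: nat
  assumes vars: "\<And>r x. r \<in> set rs \<Longrightarrow> x \<in> set r \<Longrightarrow> avars x \<subseteq> {..<M}"
begin

text \<open>There are \<open>M + 4\<close> fields; \<open>2 * M + 8\<close> is even and leaves room
  behind them. The tags combine a bit with the verdict alive or one of the rules, and the live tags
  are the two without a rule.\<close>

sublocale automaton "2 * M + 8" "2 * Suc (length rs)" "base_specs @ rule_specs rs" "{0, 1}"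
proof
  fix e assume "e \<in> set (base_specs @ rule_specs rs)"
  then consider "e \<in> set base_specs" | "e \<in> set (rule_specs rs)" by auto
  then show "wf_spec (2 * M + 8) e"
  proof cases
    case 1
    then show ?thesis by (intro wf_base_specs) auto
  next
    case 2
    then obtain i x where i: "i < length rs" "x \<in> set (rs ! i)" "e \<in> set (atom_specs (kill_tags i) x)"
      by (auto simp: rule_specs_def)
    have "avars x \<subseteq> {..<M + 1}" using vars[OF nth_mem[OF i(1)] i(2)] by auto
    then show ?thesis by (rule wf_atom_specs[OF _ _ _ i(3)]) auto
  qed
qed auto

abbreviation "K \<equiv> 2 * M + 8"

definition csat :: "nat \<Rightarrow> (nat \<Rightarrow> nat) \<Rightarrow> nat \<Rightarrow> nat \<Rightarrow> cspec \<Rightarrow> bool" where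
  "csat n w t' t c \<longleftrightarrow> sd (c_u1 c) (c_u0 c) n w (t * K + c_up c) (Suc n + t) + c_c c
     \<le> sd (c_l1 c) (c_l0 c) n w (t' * K + c_lp c) (Suc n + t') + (if c_g c then t - t' else 0)"

lemma csat_dummy [simp]: "csat n w t' t dummy" by (simp add: csat_def dummy_def sd_def)

lemma ball_cl:
  "length l \<le> 4 \<Longrightarrow> (\<forall>x<4. csat n w t' t (cl l x)) \<longleftrightarrow> (\<forall>c\<in>set l. csat n w t' t c)"
  by (auto simp: cl_def in_set_conv_nth all_set_conv_all_nth)

lemma match_same:
  assumes "length l \<le> 4"
  shows "match (same ut l) n w \<longleftrightarrow> (\<exists>t. tag n w t \<in> ut \<and> (\<forall>c\<in>set l. csat n w t t c))"
proof -
  have "(\<forall>x<4. UL (same ut l) n w x t + c_c (cs (same ut l) x) \<le> LD (same ut l) n w x t)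
     \<longleftrightarrow> (\<forall>x<4. csat n w t t (cl l x))" for t
    by (simp add: same_def UL_def LD_def csat_def Let_def)
  then show ?thesis unfolding match_def by (simp add: ball_cl[OF assms]) (simp add: same_def)
qed

lemma match_consec:
  assumes "length l \<le> 4"
  shows "match (consec l) n w \<longleftrightarrow> (\<exists>t. \<forall>c\<in>set l. csat n w t (Suc t) c)"
proof -
  have "(\<forall>x<4. UL (consec l) n w x t + c_c (cs (consec l) x) \<le> held (consec l) n w t' q t x)
     \<longleftrightarrow> (\<forall>x<4. csat n w t' t (cl l x))" for t' q t
    by (simp add: consec_def UL_def LD_def csat_def held_def Let_def)
  moreover have "link (consec l) n w t' q t \<longleftrightarrow> q = t' \<and> t = Suc t'" for t' q t
    by (auto simp: link_def consec_def)
  ultimately show ?thesis unfolding match_def by (simp add: ball_cl[OF assms]) (simp add: consec_def)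
qed

lemma match_ptr:
  assumes "length l \<le> 4"
  shows "match (ptr lt ut l) n w \<longleftrightarrow> (\<exists>t' t. t' < t \<and> tag n w t' \<in> lt \<and> tag n w t \<in> ut \<and> (\<forall>c\<in>set l. csat n w t' t c))"
proof -
  have "(\<forall>x<4. UL (ptr lt ut l) n w x t + c_c (cs (ptr lt ut l) x) \<le> held (ptr lt ut l) n w t' q t x)
     \<longleftrightarrow> (\<forall>x<4. csat n w t' t (cl l x))" for t' q t
    by (simp add: ptr_def UL_def LD_def csat_def held_def Let_def)
  moreover have "link (ptr lt ut l) n w t' q t \<longleftrightarrow> q = t' \<and> t' < t \<and> tag n w t' \<in> lt" for t' q t
    by (auto simp: link_def ptr_def)
  ultimately show ?thesis unfolding match_def by (simp add: ball_cl[OF assms]) (auto simp add: ptr_def)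
qed

lemma sd_values:
  assumes "exact n w" "p < K"
  shows "sd True False n w (t * K + p) (Suc n + t) = X n w t p"
    "sd False True n w (t * K + p) (Suc n + t) = Suc n + t - X n w t p"
    "sd True True n w (t * K + p) (Suc n + t) = Suc n + t"
    "sd False False n w (t * K + p) (Suc n + t) = 0"
    "X n w t p \<le> Suc n + t"
  using X_le[OF assms, of t] by (simp_all add: sd_def X_def)

lemma csat_pq:
  assumes "exact n w" "p < K" "q < K"
  shows "csat n w t' t (xx p q c) \<longleftrightarrow> X n w t q + c \<le> X n w t' p"
    "t' \<le> t \<Longrightarrow> csat n w t' t (yy p q c True) \<longleftrightarrow> X n w t' p + c \<le> X n w t q"
    "csat n w t t (yx p q c) \<longleftrightarrow> X n w t q + c \<le> Suc n + t - X n w t p"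
    "csat n w t t (xy p q c) \<longleftrightarrow> Suc n + t - X n w t q + c \<le> X n w t p"
    "csat n w t t (le p q c) \<longleftrightarrow> X n w t p + c \<le> X n w t q"
proof -
  note p = sd_values[OF assms(1,2)] and q = sd_values[OF assms(1,3)]
  show "csat n w t' t (xx p q c) \<longleftrightarrow> X n w t q + c \<le> X n w t' p"
    using p(1)[of t'] q(1)[of t] by (simp add: csat_def xx_def)
  show "t' \<le> t \<Longrightarrow> csat n w t' t (yy p q c True) \<longleftrightarrow> X n w t' p + c \<le> X n w t q"
    using p(2,5)[of t'] q(2,5)[of t] by (auto simp: csat_def yy_def)
  show "csat n w t t (yx p q c) \<longleftrightarrow> X n w t q + c \<le> Suc n + t - X n w t p"
    using p(2)[of t] q(1)[of t] by (simp add: csat_def yx_def)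
  show "csat n w t t (xy p q c) \<longleftrightarrow> Suc n + t - X n w t q + c \<le> X n w t p"
    using p(1)[of t] q(2)[of t] by (simp add: csat_def xy_def)
  have "csat n w t t (xx q p c) \<longleftrightarrow> X n w t p + c \<le> X n w t q"
    using p(1)[of t] q(1)[of t] by (simp add: csat_def xx_def)
  moreover have "csat n w t t (yy p q c False) \<longleftrightarrow> X n w t p + c \<le> X n w t q"
    using p(2,5)[of t] q(2,5)[of t] by (auto simp: csat_def yy_def)
  moreover have "\<not> csat n w t t never" by (simp add: csat_def never_def sd_def)
  ultimately show "csat n w t t (le p q c) \<longleftrightarrow> X n w t p + c \<le> X n w t q"
    by (auto simp: le_def)
qed

text \<open>Across consecutive records \<open>ny q 0\<close> has no gain, so the later block exceeds
  the loaded amount by one letter; its zeros fit iff it contains a one.\<close>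

lemma csat_q:
  assumes "exact n w" "q < K"
  shows "csat n w t t (ny q c) \<longleftrightarrow> c \<le> X n w t q"
    "csat n w t (Suc t) (ny q 0) \<longleftrightarrow> X n w (Suc t) q \<noteq> 0"
proof -
  note v = sd_values[OF assms(1)]
  have le: "X n w t q \<le> Suc n + t" for t using v(5) assms by auto
  show "csat n w t t (ny q c) \<longleftrightarrow> c \<le> X n w t q"
    using le[of t] v(3)[of 0 t] v(2)[OF assms(2), of t] by (auto simp: csat_def ny_def)
  show "csat n w t (Suc t) (ny q 0) \<longleftrightarrow> X n w (Suc t) q \<noteq> 0"
    using le[of "Suc t"] v(3)[of 0 t] v(2)[OF assms(2), of "Suc t"] by (auto simp: csat_def ny_def)
qed

lemma csat_hd:
  assumes "exact n w"
  shows "csat n w t (Suc t) hd_zero \<longleftrightarrow> X n w t 1 = 0" "csat n w t' t hd_pos \<longleftrightarrow> X n w t' 1 \<noteq> 0"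
proof -
  note v = sd_values[OF assms(1)]
  show "csat n w t (Suc t) hd_zero \<longleftrightarrow> X n w t 1 = 0"
    using v(5)[of 1 t] v(2)[of 1 t] v(3)[of 1 "Suc t"] by (auto simp: csat_def hd_zero_def)
  show "csat n w t' t hd_pos \<longleftrightarrow> X n w t' 1 \<noteq> 0"
    using v(1)[of 1 t'] v(4)[of 2 t] by (auto simp: csat_def hd_pos_def)
qed

definition wellformed :: "nat \<Rightarrow> (nat \<Rightarrow> nat) \<Rightarrow> bool" where
  "wellformed n w \<longleftrightarrow> (\<forall>t. X n w t 0 = ptl t \<and> X n w t 1 = phd t \<and> X n w t 2 = lev t \<and> X n w t 3 = t) \<and>
     (\<forall>t' t. t' < t \<and> odd (tag n w t') \<and> odd (tag n w t) \<longrightarrow> ptl t' \<noteq> ptl t)"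

lemma base_specs_match_iff:
  assumes "exact n w"
  shows "(\<exists>e\<in>set base_specs. match e n w) \<longleftrightarrow>
    (\<exists>t. let X = X n w in X (Suc t) 3 \<noteq> Suc (X t 3) \<or>
       (X t 1 = 0 \<and> (X (Suc t) 0 \<noteq> 0 \<or> X (Suc t) 1 \<noteq> Suc (X t 0))) \<or>
       (X t 1 \<noteq> 0 \<and> (X (Suc t) 0 \<noteq> Suc (X t 0) \<or> Suc (X (Suc t) 1) \<noteq> X t 1))) \<or>
    (\<exists>t' t. t' < t \<and> X n w t' 3 = X n w t 0 \<and> X n w t 2 \<noteq> Suc (X n w t' 2)) \<or>
    (\<exists>t' t. t' < t \<and> odd (tag n w t') \<and> odd (tag n w t) \<and> X n w t' 0 = X n w t 0)"
proof -
  note v = csat_pq[OF assms] csat_q[OF assms] csat_hd[OF assms]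
  have 1: "match (consec [xx 3 3 0]) n w \<or> match (consec [yy 3 3 2 True]) n w \<longleftrightarrow> (\<exists>t. X n w (Suc t) 3 \<noteq> Suc (X n w t 3))"
  proof -
    have "match (consec [xx 3 3 0]) n w \<or> match (consec [yy 3 3 2 True]) n w \<longleftrightarrow>
        (\<exists>t. X n w (Suc t) 3 \<le> X n w t 3 \<or> X n w t 3 + 2 \<le> X n w (Suc t) 3)"
      by (auto simp: match_consec v)
    also have "\<dots> \<longleftrightarrow> (\<exists>t. X n w (Suc t) 3 \<noteq> Suc (X n w t 3))" by (intro ex_cong1) arith
    finally show ?thesis .
  qed
  have 2: "match (consec [hd_zero, ny 0 0]) n w \<or> match (consec [hd_zero, xx 0 1 0]) n w \<or> match (consec [hd_zero, yy 0 1 2 True]) n w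
    \<longleftrightarrow> (\<exists>t. X n w t 1 = 0 \<and> (X n w (Suc t) 0 \<noteq> 0 \<or> X n w (Suc t) 1 \<noteq> Suc (X n w t 0)))"
  proof -
    have "match (consec [hd_zero, ny 0 0]) n w \<or> match (consec [hd_zero, xx 0 1 0]) n w \<or> match (consec [hd_zero, yy 0 1 2 True]) n w
      \<longleftrightarrow> (\<exists>t. X n w t 1 = 0 \<and> (X n w (Suc t) 0 \<noteq> 0 \<or> X n w (Suc t) 1 \<le> X n w t 0 \<or> X n w t 0 + 2 \<le> X n w (Suc t) 1))"
      by (simp add: match_consec v del: One_nat_def) blast
    also have "\<dots> \<longleftrightarrow> (\<exists>t. X n w t 1 = 0 \<and> (X n w (Suc t) 0 \<noteq> 0 \<or> X n w (Suc t) 1 \<noteq> Suc (X n w t 0)))"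
      by (intro ex_cong1) arith
    finally show ?thesis .
  qed
  have 3: "match (consec [hd_pos, xx 0 0 0]) n w \<or> match (consec [hd_pos, yy 0 0 2 True]) n w \<or>
     match (consec [hd_pos, yy 1 1 0 True]) n w \<or> match (consec [hd_pos, xx 1 1 2]) n w
    \<longleftrightarrow> (\<exists>t. X n w t 1 \<noteq> 0 \<and> (X n w (Suc t) 0 \<noteq> Suc (X n w t 0) \<or> Suc (X n w (Suc t) 1) \<noteq> X n w t 1))"
  proof -
    have "match (consec [hd_pos, xx 0 0 0]) n w \<or> match (consec [hd_pos, yy 0 0 2 True]) n w \<or>
       match (consec [hd_pos, yy 1 1 0 True]) n w \<or> match (consec [hd_pos, xx 1 1 2]) n w
      \<longleftrightarrow> (\<exists>t. X n w t 1 \<noteq> 0 \<and> (X n w (Suc t) 0 \<le> X n w t 0 \<or> X n w t 0 + 2 \<le> X n w (Suc t) 0 \<or>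
           X n w t 1 \<le> X n w (Suc t) 1 \<or> X n w (Suc t) 1 + 2 \<le> X n w t 1))"
      by (simp add: match_consec v del: One_nat_def) blast
    also have "\<dots> \<longleftrightarrow> (\<exists>t. X n w t 1 \<noteq> 0 \<and> (X n w (Suc t) 0 \<noteq> Suc (X n w t 0) \<or> Suc (X n w (Suc t) 1) \<noteq> X n w t 1))"
      by (intro ex_cong1) arith
    finally show ?thesis .
  qed
  have 4: "match (ptr UNIV UNIV [xx 3 0 0, yy 3 0 0 True, xx 2 2 0]) n w \<or> match (ptr UNIV UNIV [xx 3 0 0, yy 3 0 0 True, yy 2 2 2 True]) n w
    \<longleftrightarrow> (\<exists>t' t. t' < t \<and> X n w t' 3 = X n w t 0 \<and> X n w t 2 \<noteq> Suc (X n w t' 2))"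
  proof -
    have "match (ptr UNIV UNIV [xx 3 0 0, yy 3 0 0 True, xx 2 2 0]) n w \<or> match (ptr UNIV UNIV [xx 3 0 0, yy 3 0 0 True, yy 2 2 2 True]) n w
      \<longleftrightarrow> (\<exists>t' t. t' < t \<and> X n w t 0 \<le> X n w t' 3 \<and> X n w t' 3 \<le> X n w t 0 \<and>
         (X n w t 2 \<le> X n w t' 2 \<or> X n w t' 2 + 2 \<le> X n w t 2))"
      by (simp add: match_ptr v cong: conj_cong) blast
    also have "\<dots> \<longleftrightarrow> (\<exists>t' t. t' < t \<and> X n w t' 3 = X n w t 0 \<and> X n w t 2 \<noteq> Suc (X n w t' 2))"
      by (intro ex_cong1) arith
    finally show ?thesis .
  qed
  have 5: "match (ptr {b. odd b} {b. odd b} [xx 0 0 0, yy 0 0 0 True]) n w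
    \<longleftrightarrow> (\<exists>t' t. t' < t \<and> odd (tag n w t') \<and> odd (tag n w t) \<and> X n w t' 0 = X n w t 0)"
  proof -
    have "match (ptr {b. odd b} {b. odd b} [xx 0 0 0, yy 0 0 0 True]) n w
      \<longleftrightarrow> (\<exists>t' t. t' < t \<and> odd (tag n w t') \<and> odd (tag n w t) \<and> X n w t 0 \<le> X n w t' 0 \<and> X n w t' 0 \<le> X n w t 0)"
      by (simp add: match_ptr v cong: conj_cong)
    also have "\<dots> \<longleftrightarrow> (\<exists>t' t. t' < t \<and> odd (tag n w t') \<and> odd (tag n w t) \<and> X n w t' 0 = X n w t 0)"
      by (intro ex_cong1) auto
    finally show ?thesis .
  qed
  have "(\<exists>e\<in>set base_specs. match e n w) \<longleftrightarrow>
    (match (consec [xx 3 3 0]) n w \<or> match (consec [yy 3 3 2 True]) n w) \<or>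
    (match (consec [hd_zero, ny 0 0]) n w \<or> match (consec [hd_zero, xx 0 1 0]) n w \<or> match (consec [hd_zero, yy 0 1 2 True]) n w) \<or>
    (match (consec [hd_pos, xx 0 0 0]) n w \<or> match (consec [hd_pos, yy 0 0 2 True]) n w \<or>
     match (consec [hd_pos, yy 1 1 0 True]) n w \<or> match (consec [hd_pos, xx 1 1 2]) n w) \<or>
    (match (ptr UNIV UNIV [xx 3 0 0, yy 3 0 0 True, xx 2 2 0]) n w \<or> match (ptr UNIV UNIV [xx 3 0 0, yy 3 0 0 True, yy 2 2 2 True]) n w) \<or>
    match (ptr {b. odd b} {b. odd b} [xx 0 0 0, yy 0 0 0 True]) n w"
    by (simp add: base_specs_def disj_assoc)
  then show ?thesis unfolding 1 2 3 4 5 Let_def by blast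
qed

text \<open>The first record is fixed and each record determines the number, parent and last entry
  of the next, so these follow by induction. The level follows by induction along parents.\<close>

lemma wellformed_iff:
  assumes "exact n w"
  shows "wellformed n w \<longleftrightarrow> (\<forall>j<4. X n w 0 j = 0) \<and> (\<forall>e\<in>set base_specs. \<not> match e n w)"
proof
  assume wf: "wellformed n w"
  then have x: "X n w t 0 = ptl t" "X n w t 1 = phd t" "X n w t 2 = lev t" "X n w t 3 = t" for t
    by (auto simp: wellformed_def)
  have "\<forall>j<4. X n w 0 j = 0" by (simp add: all_less_4 x del: One_nat_def)
  moreover have "\<not> (\<exists>e\<in>set base_specs. match e n w)"
    unfolding base_specs_match_iff[OF assms] Let_def x
    using ptl_phd_Suc wf unfolding wellformed_def by (auto simp: lev_pos)
  ultimately show "(\<forall>j<4. X n w 0 j = 0) \<and> (\<forall>e\<in>set base_specs. \<not> match e n w)" by blast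
next
  assume a: "(\<forall>j<4. X n w 0 j = 0) \<and> (\<forall>e\<in>set base_specs. \<not> match e n w)"
  have z: "X n w 0 0 = 0" "X n w 0 1 = 0" "X n w 0 2 = 0" "X n w 0 3 = 0"
    using a by (auto simp: all_less_4)
  have nm: "\<not> (\<exists>e\<in>set base_specs. match e n w)" using a by blast
  note nm = nm[unfolded base_specs_match_iff[OF assms] Let_def]
  have nm1: "X n w (Suc t) 3 = Suc (X n w t 3)" for t using nm by blast
  have nm2: "X n w (Suc t) 0 = 0 \<and> X n w (Suc t) 1 = Suc (X n w t 0)" if "X n w t 1 = 0" for t
    using nm that by blast
  have nm3: "X n w (Suc t) 0 = Suc (X n w t 0) \<and> Suc (X n w (Suc t) 1) = X n w t 1" if "X n w t 1 \<noteq> 0" for t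
    using nm that by blast
  have nm4: "X n w t 2 = Suc (X n w t' 2)" if "t' < t" "X n w t' 3 = X n w t 0" for t t'
    using nm that by blast
  have nm5: "X n w t' 0 \<noteq> X n w t 0" if "t' < t" "odd (tag n w t')" "odd (tag n w t)" for t t'
    using nm that by blast
  have idx: "X n w t 3 = t" for t
  proof (induction t)
    case (Suc t)
    then show ?case using nm1 by simp
  qed (simp add: z)
  have th: "X n w t 0 = ptl t \<and> X n w t 1 = phd t" for t
  proof (induction t)
    case (Suc t)
    show ?case
    proof (cases "phd t = 0")
      case True
      then show ?thesis using nm2[of t] Suc ptl_phd_Suc(1)[OF True] by simp
    next
      case False
      have "X n w (Suc t) 0 = Suc (X n w t 0) \<and> Suc (X n w (Suc t) 1) = X n w t 1"
        using nm3[of t] Suc False by simp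
      then show ?thesis using Suc ptl_phd_Suc(2)[OF False] by auto
    qed
  qed (simp add: z del: One_nat_def)
  have "X n w t 2 = lev t" for t
  proof (induction t rule: less_induct)
    case (less t)
    show ?case
    proof (cases "t = 0")
      case False
      then have "ptl t < t" using ptl_less by simp
      moreover have "X n w (ptl t) 3 = X n w t 0" using idx th by simp
      ultimately have "X n w t 2 = Suc (X n w (ptl t) 2)" by (rule nm4)
      then show ?thesis using less[OF \<open>ptl t < t\<close>] False by (simp add: lev_pos)
    qed (simp add: z)
  qed
  then show "wellformed n w" unfolding wellformed_def using idx th nm5 by auto
qed

end

context rule_automaton begin

lemma nt_pos: "0 < 2 * Suc (length rs)" by simp

definition vv :: "nat \<Rightarrow> (nat \<Rightarrow> nat) \<Rightarrow> nat \<Rightarrow> nat \<Rightarrow> nat" where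
  "vv n w t a = X n w t (4 + a)"

definition bits :: "nat \<Rightarrow> (nat \<Rightarrow> nat) \<Rightarrow> nat set" where
  "bits n w = {t. odd (tag n w t)}"

text \<open>On a well-formed word the links form a path of parents. The last record unloads its
  parent field like a link, which gives \<open>q = ptl t\<close>; counters 2 and 3 compare the
  variable with the two ends of the edge at \<open>t'\<close>.\<close>

lemma match_chn:
  assumes ex: "exact n w" and wf: "wellformed n w" and a: "a < M"
  shows "match (chn ut [yy 0 (4 + a) 1 True, xx 3 (4 + a) 1]) n w \<longleftrightarrow>
    (\<exists>t. tag n w t \<in> ut \<and> (\<exists>t'. (t', ptl t) \<in> parent_rel\<^sup>* \<and> ptl t < t \<and> ptl t' < vv n w t a \<and> vv n w t a < t'))"
proof -
  let ?l = "[yy 0 (4 + a) 1 True, xx 3 (4 + a) 1]"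
  let ?e = "chn ut ?l"
  have x: "X n w t 0 = ptl t" "X n w t 3 = t" for t using wf by (auto simp: wellformed_def)
  have cr: "chain_rel n w = parent_rel" by (auto simp: chain_rel_def parent_rel_def x)
  have ch: "chain ?e" "two ?e" "skips ?e" "ltags ?e = UNIV" "utags ?e = ut" by (simp_all add: chn_def)
  have wfe: "wf_spec K ?e"
    by (rule wf_spec_simple) (use a in \<open>auto intro!: wfc_intros\<close>)
  have lk: "link ?e n w t' q t \<longleftrightarrow> q < t \<and> (t', q) \<in> parent_rel\<^sup>*" for t' q t
    by (simp add: link_def ch cr del: One_nat_def)
  have cs2: "cs ?e 2 = yy 0 (4 + a) 1 True" "cs ?e 3 = xx 3 (4 + a) 1"
    by (simp_all add: chn_def cl_def)
  have v: "(\<forall>x<4. UL ?e n w x t + c_c (cs ?e x) \<le> held ?e n w t' q t x) \<longleftrightarrow>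
     q = ptl t \<and> ptl t' < vv n w t a \<and> vv n w t a < t'"
    if l: "q < t" "(t', q) \<in> parent_rel\<^sup>*" for t' q t
  proof -
    have tt: "t' \<le> t" using l parent_rel_le[OF l(2)] by simp
    have k: "4 + a < K" "0 < K" "3 < K" using a by auto
    have "UL ?e n w 2 t + c_c (cs ?e 2) \<le> held ?e n w t' q t 2 \<longleftrightarrow> csat n w t' t (cs ?e 2)"
      by (simp add: csat_def UL_def held_def LD_def Let_def)
    also have "\<dots> \<longleftrightarrow> ptl t' < vv n w t a"
      unfolding cs2 csat_pq(2)[OF ex k(2,1) tt] by (auto simp: x vv_def)
    finally have 2: "UL ?e n w 2 t + c_c (cs ?e 2) \<le> held ?e n w t' q t 2 \<longleftrightarrow> ptl t' < vv n w t a" .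
    have "UL ?e n w 3 t + c_c (cs ?e 3) \<le> held ?e n w t' q t 3 \<longleftrightarrow> csat n w t' t (cs ?e 3)"
      by (simp add: csat_def UL_def held_def LD_def Let_def)
    also have "\<dots> \<longleftrightarrow> vv n w t a < t'"
      unfolding cs2 csat_pq(1)[OF ex k(3,1)] by (auto simp: x vv_def)
    finally have 3: "UL ?e n w 3 t + c_c (cs ?e 3) \<le> held ?e n w t' q t 3 \<longleftrightarrow> vv n w t a < t'" .
    have qb: "q \<le> Suc n + t" "ptl t \<le> Suc n + t" using l X_3_le[OF ex, of t] x by auto
    show ?thesis unfolding all_less_4 2 3
      unfolding chain_values[OF wfe ch(1) ex] held_chain[OF wfe ch(1) ex l(1)] x
      using qb by auto
  qed
  have "match ?e n w \<longleftrightarrow> (\<exists>t' q t. (q < t \<and> (t', q) \<in> parent_rel\<^sup>*) \<and> tag n w t \<in> ut \<and>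
      (\<forall>x<4. UL ?e n w x t + c_c (cs ?e x) \<le> held ?e n w t' q t x))"
    by (simp add: match_def ch lk del: One_nat_def)
  also have "\<dots> \<longleftrightarrow> (\<exists>t' q t. (q < t \<and> (t', q) \<in> parent_rel\<^sup>*) \<and> tag n w t \<in> ut \<and>
      q = ptl t \<and> ptl t' < vv n w t a \<and> vv n w t a < t')"
    by (intro ex_cong1 conj_cong refl) (use v in blast)+
  finally show ?thesis by blast
qed

text \<open>The specifications of an atom exhaust its failures. For atoms with pointers the first
  one catches values that do not refer to an earlier record, and the others may assume that they
  do.\<close>

lemma atom_specs_match_iff:
  assumes ex: "exact n w" and wf: "wellformed n w" and a: "avars x \<subseteq> {..<M}"
  shows "(\<exists>e\<in>set (atom_specs ut x). match e n w) \<longleftrightarrow>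
    (\<exists>t. tag n w t \<in> ut \<and> \<not> holds n (bits n w) {..<t} (anc t) (vv n w t) x)"
proof -
  have x: "X n w t 0 = ptl t" "X n w t 1 = phd t" "X n w t 2 = lev t" "X n w t 3 = t" for t
    using wf by (auto simp: wellformed_def)
  have vv: "X n w t (4 + a) = vv n w t a" for t a by (simp add: vv_def)
  have vle: "vv n w t a \<le> Suc n + t" if "a < M" for t a
    unfolding vv_def by (rule X_le[OF ex]) (use that in auto)
  have f: "X n w t (fpos j) = fld j t" for t j by (auto simp: fpos_def fld_def x simp del: One_nat_def)
  have same1: "match (same ut [c]) n w \<longleftrightarrow> (\<exists>t. tag n w t \<in> ut \<and> csat n w t t c)" for ut c
    by (simp add: match_same)
  have ptrv: "match (ptr lt ut [xx 3 (4 + a) 0, yy 3 (4 + a) 0 True]) n w \<longleftrightarrow>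
      (\<exists>t. tag n w t \<in> ut \<and> vv n w t a < t \<and> tag n w (vv n w t a) \<in> lt)" if "a < M" for lt ut a
  proof -
    have "match (ptr lt ut [xx 3 (4 + a) 0, yy 3 (4 + a) 0 True]) n w \<longleftrightarrow>
      (\<exists>t' t. t' < t \<and> tag n w t' \<in> lt \<and> tag n w t \<in> ut \<and> vv n w t a \<le> t' \<and> t' \<le> vv n w t a)"
      using that by (simp add: match_ptr csat_pq[OF ex] x vv cong: conj_cong)
    also have "\<dots> \<longleftrightarrow> (\<exists>t. tag n w t \<in> ut \<and> vv n w t a < t \<and> tag n w (vv n w t a) \<in> lt)"
      using le_antisym by blast
    finally show ?thesis .
  qed
  have ptrf: "match (ptr UNIV ut [xx 3 (4 + a) 0, yy 3 (4 + a) 0 True, xx (fpos j) (4 + b) 1]) n w \<or>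
      match (ptr UNIV ut [xx 3 (4 + a) 0, yy 3 (4 + a) 0 True, yy (fpos j) (4 + b) 1 True]) n w \<longleftrightarrow>
      (\<exists>t. tag n w t \<in> ut \<and> vv n w t a < t \<and> fld j (vv n w t a) \<noteq> vv n w t b)" if ab: "a < M" "b < M" for ut a b j
  proof -
    have fp: "fpos j < K" by (auto simp: fpos_def)
    have "match (ptr UNIV ut [xx 3 (4 + a) 0, yy 3 (4 + a) 0 True, xx (fpos j) (4 + b) 1]) n w \<longleftrightarrow>
      (\<exists>t' t. t' < t \<and> tag n w t \<in> ut \<and> vv n w t a \<le> t' \<and> t' \<le> vv n w t a \<and> vv n w t b < fld j t')"
      using ab fp by (simp add: match_ptr csat_pq[OF ex] x vv f Suc_le_eq cong: conj_cong)
    moreover have "match (ptr UNIV ut [xx 3 (4 + a) 0, yy 3 (4 + a) 0 True, yy (fpos j) (4 + b) 1 True]) n w \<longleftrightarrow>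
      (\<exists>t' t. t' < t \<and> tag n w t \<in> ut \<and> vv n w t a \<le> t' \<and> t' \<le> vv n w t a \<and> fld j t' < vv n w t b)"
      using ab fp by (simp add: match_ptr csat_pq[OF ex] x vv f Suc_le_eq cong: conj_cong)
    ultimately show ?thesis unfolding nat_neq_iff using le_antisym by blast
  qed
  have lev: "csat n w t t (le 3 (4 + a) 0) \<longleftrightarrow> \<not> vv n w t a < t" if "a < M" for t a
    using csat_pq(5)[OF ex, of 3 "4 + a" t 0] that by (auto simp: x vv)
  show ?thesis
  proof (cases x)
    case (AZero b)
    have "b < M" using a AZero by simp
    then have "csat n w t t (ny (4 + b) 1) \<longleftrightarrow> \<not> vv n w t b = 0" for t
      using csat_q(1)[OF ex, of "4 + b" t 1] by (auto simp: vv)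
    then show ?thesis unfolding AZero by (simp add: same1)
  next
    case (ASuc b c)
    have bc: "b < M" "c < M" using a ASuc by auto
    have "csat n w t t (le (4 + c) (4 + b) 0) \<or> csat n w t t (le (4 + b) (4 + c) 2) \<longleftrightarrow> \<not> vv n w t c = Suc (vv n w t b)" for t
      using csat_pq(5)[OF ex, of "4 + c" "4 + b" t 0] csat_pq(5)[OF ex, of "4 + b" "4 + c" t 2] bc
      by (auto simp: vv)
    then show ?thesis unfolding ASuc atom_specs.simps holds.simps by (simp add: same1) blast
  next
    case (ALt b c)
    have bc: "b < M" "c < M" using a ALt by auto
    have "csat n w t t (le (4 + c) (4 + b) 0) \<longleftrightarrow> \<not> vv n w t b < vv n w t c" for t
      using csat_pq(5)[OF ex, of "4 + c" "4 + b" t 0] bc by (auto simp: vv)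
    then show ?thesis unfolding ALt by (simp add: same1)
  next
    case (AN b)
    have b: "b < M" using a AN by auto
    have "csat n w t t (yx 3 (4 + b) 1) \<or> csat n w t t (xy 3 (4 + b) 1) \<longleftrightarrow> \<not> vv n w t b = Suc n" for t
      using csat_pq(3)[OF ex, of 3 "4 + b" t 1] csat_pq(4)[OF ex, of 3 "4 + b" t 1] b vle[OF b, of t]
      by (auto simp: vv x)
    then show ?thesis unfolding AN atom_specs.simps holds.simps by (simp add: same1) blast
  next
    case (AFld j b c)
    have bc: "b < M" "c < M" using a AFld by auto
    have "(\<exists>e\<in>set (atom_specs ut x). match e n w) \<longleftrightarrow> match (same ut [le 3 (4 + b) 0]) n w \<or>
      (match (ptr UNIV ut [xx 3 (4 + b) 0, yy 3 (4 + b) 0 True, xx (fpos j) (4 + c) 1]) n w \<or>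
      match (ptr UNIV ut [xx 3 (4 + b) 0, yy 3 (4 + b) 0 True, yy (fpos j) (4 + c) 1 True]) n w)"
      unfolding AFld by simp
    also have "\<dots> \<longleftrightarrow> (\<exists>t. tag n w t \<in> ut \<and> \<not> holds n (bits n w) {..<t} (anc t) (vv n w t) x)"
      unfolding ptrf[OF bc] same1 lev[OF bc(1)] AFld holds.simps lessThan_iff by blast
    finally show ?thesis .
  next
    case (ABit b)
    have b: "b < M" using a ABit by auto
    have "(\<exists>e\<in>set (atom_specs ut x). match e n w) \<longleftrightarrow> match (same ut [le 3 (4 + b) 0]) n w \<or>
      match (ptr {b. even b} ut [xx 3 (4 + b) 0, yy 3 (4 + b) 0 True]) n w"
      unfolding ABit by simp
    also have "\<dots> \<longleftrightarrow> (\<exists>t. tag n w t \<in> ut \<and> \<not> holds n (bits n w) {..<t} (anc t) (vv n w t) x)"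
      unfolding ptrv[OF b] same1 lev[OF b] ABit holds.simps lessThan_iff bits_def mem_Collect_eq by blast
    finally show ?thesis .
  next
    case (AAnc b)
    have b: "b < M" using a AAnc by auto
    have l0: "csat n w t t (le 0 (4 + b) 1) \<longleftrightarrow> ptl t < vv n w t b" for t
      using csat_pq(5)[OF ex, of 0 "4 + b" t 1] b by (auto simp: x vv)
    \<comment> \<open>Ancestors are earlier records, so a value that is not one belongs to the
      failures.\<close>
    have na: "\<not> vv n w t b < t \<or> (ptl t < vv n w t b \<or> (\<exists>t'. (t', ptl t) \<in> parent_rel\<^sup>* \<and> ptl t < t \<and> ptl t' < vv n w t b \<and> vv n w t b < t'))
        \<longleftrightarrow> vv n w t b \<notin> anc t" for t
      using not_anc_iff[of "vv n w t b" t] anc_less[of "vv n w t b" t] by blast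
    have "(\<exists>e\<in>set (atom_specs ut x). match e n w) \<longleftrightarrow> match (same ut [le 3 (4 + b) 0]) n w \<or>
      match (same ut [le 0 (4 + b) 1]) n w \<or> match (chn ut [yy 0 (4 + b) 1 True, xx 3 (4 + b) 1]) n w"
      unfolding AAnc by simp
    also have "\<dots> \<longleftrightarrow> (\<exists>t. tag n w t \<in> ut \<and> (\<not> vv n w t b < t \<or> (ptl t < vv n w t b \<or>
        (\<exists>t'. (t', ptl t) \<in> parent_rel\<^sup>* \<and> ptl t < t \<and> ptl t' < vv n w t b \<and> vv n w t b < t'))))"
      unfolding same1 lev[OF b] l0 match_chn[OF ex wf b] by blast
    also have "\<dots> \<longleftrightarrow> (\<exists>t. tag n w t \<in> ut \<and> \<not> holds n (bits n w) {..<t} (anc t) (vv n w t) x)"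
      unfolding na AAnc holds.simps ..
    finally show ?thesis .
  qed
qed

definition justified :: "nat \<Rightarrow> (nat \<Rightarrow> nat) \<Rightarrow> bool" where
  "justified n w \<longleftrightarrow> (\<forall>t i. tag n w t div 2 = Suc i \<longrightarrow>
     (\<forall>x\<in>set (rs ! i). holds n (bits n w) {..<t} (anc t) (vv n w t) x))"

lemma tag_less:
  assumes "exact n w" shows "tag n w t < 2 * Suc (length rs)"
proof -
  note h = exact_tag[OF assms, of t]
  show ?thesis unfolding tag_def by (rule less_diff_conv2[OF conjunct1[OF h], THEN iffD2]) (use h in \<open>simp only: add.commute\<close>)
qed

lemma tag_rule_less:
  assumes "exact n w" "tag n w t div 2 = Suc i" shows "i < length rs"
  using less_mult_imp_div_less[of "tag n w t" "Suc (length rs)" 2] tag_less[OF assms(1), of t] assms(2)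
  by (simp add: mult.commute)

lemma rule_specs_match_iff:
  assumes ex: "exact n w" and wf: "wellformed n w"
  shows "(\<exists>e\<in>set (rule_specs rs). match e n w) \<longleftrightarrow> \<not> justified n w"
proof -
  have "(\<exists>e\<in>set (rule_specs rs). match e n w) \<longleftrightarrow>
     (\<exists>i<length rs. \<exists>x\<in>set (rs ! i). \<exists>e\<in>set (atom_specs (kill_tags i) x). match e n w)"
    by (auto simp: rule_specs_def Bex_def)
  also have "\<dots> \<longleftrightarrow> (\<exists>i<length rs. \<exists>x\<in>set (rs ! i). \<exists>t. tag n w t \<in> kill_tags i \<and>
      \<not> holds n (bits n w) {..<t} (anc t) (vv n w t) x)"
  proof -
    have "(\<exists>e\<in>set (atom_specs (kill_tags i) x). match e n w) \<longleftrightarrow> (\<exists>t. tag n w t \<in> kill_tags i \<and>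
      \<not> holds n (bits n w) {..<t} (anc t) (vv n w t) x)" if "i < length rs" "x \<in> set (rs ! i)" for i x
      by (rule atom_specs_match_iff[OF ex wf vars[OF nth_mem[OF that(1)] that(2)]])
    then show ?thesis by blast
  qed
  also have "\<dots> \<longleftrightarrow> \<not> justified n w"
  proof -
    have "i < length rs" if "tag n w t div 2 = Suc i" for t i
      by (rule tag_rule_less[OF ex that])
    then show ?thesis unfolding justified_def kill_tags_def by blast
  qed
  finally show ?thesis .
qed

lemma reach_Sink_iff:
  assumes ex: "exact n w"
  shows "(\<exists>p \<gamma>. reach n w 0 init p \<gamma> \<and> fst \<gamma> = Sink) \<longleftrightarrow> \<not> (wellformed n w \<and> justified n w)"
proof
  assume "\<exists>p \<gamma>. reach n w 0 init p \<gamma> \<and> fst \<gamma> = Sink"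
  then obtain p \<gamma> where r: "reach n w 0 init p \<gamma>" "fst \<gamma> = Sink" by blast
  show "\<not> (wellformed n w \<and> justified n w)"
  proof
    assume g: "wellformed n w \<and> justified n w"
    then have "\<forall>j<4. X n w 0 j = 0" "\<forall>e\<in>set base_specs. \<not> match e n w" "\<forall>e\<in>set (rule_specs rs). \<not> match e n w"
      using wellformed_iff[OF ex] rule_specs_match_iff[OF ex] by blast+
    then show False using no_error_no_Sink[OF ex _ _ r(1)] r(2) by auto
  qed
next
  assume g: "\<not> (wellformed n w \<and> justified n w)"
  have "(\<exists>j<4. X n w 0 j \<noteq> 0) \<or> (\<exists>e\<in>set (base_specs @ rule_specs rs). match e n w)"
    using g wellformed_iff[OF ex] rule_specs_match_iff[OF ex] by auto
  then show "\<exists>p \<gamma>. reach n w 0 init p \<gamma> \<and> fst \<gamma> = Sink"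
  proof
    assume "\<exists>j<4. X n w 0 j \<noteq> 0"
    then show ?thesis using first_record_Sink[OF ex] by fastforce
  next
    assume "\<exists>e\<in>set (base_specs @ rule_specs rs). match e n w"
    then obtain i where "i < length (base_specs @ rule_specs rs)" "match ((base_specs @ rule_specs rs) ! i) n w"
      by (metis in_set_conv_nth)
    from match_Sink[OF ex _ this] show ?thesis by fastforce
  qed
qed

text \<open>Atoms are positive in bits, records and ancestors. Hence a rule that holds at a node
  persists along the branch, and one that holds for a partial function persists for its
  extensions.\<close>

lemma holds_mono:
  assumes "holds n R Q A v x" "R \<subseteq> R'" "Q \<subseteq> Q'" "A \<subseteq> A'"
  shows "holds n R' Q' A' v x"
  using assms by (cases x) (simp_all only: holds.simps, blast+)

lemma accepted_if_branch:
  assumes ex: "exact n w" and wf: "wellformed n w" and g: "0 < g 0"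
    and live: "\<And>k. tag n w (code g (Suc k)) div 2 = 0"
  shows "accepted n w"
proof (rule path_run_complete[OF ex, where f = "\<lambda>k. code g (Suc k)" and v = "code g"])
  have x: "X n w t 0 = ptl t" "X n w t 3 = t" for t using wf by (auto simp: wellformed_def)
  show "strict_mono (\<lambda>k. code g (Suc k))"
    using strict_mono_code[of g, OF g] by (auto simp: strict_mono_def)
  show "0 < code g (Suc 0)" by (rule code_Suc_pos[of g, OF g])
  show "code g 0 = 0" by simp
  fix k
  show "X n w (code g (Suc k)) 0 = code g k" "X n w (code g (Suc k)) 3 = code g (Suc k)" by (simp_all add: x)
  show "tag n w (code g (Suc k)) \<in> {0, 1}" using live[of k] by auto
qed

text \<open>A justified kill on an unrefuted branch would persist in the limit and refute the
  branch. So that branch is alive in each exact word without errors, and every exact word is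
  accepted.\<close>

theorem lang_if_unrefutable:
  assumes H: "\<And>R. (\<And>z z'. z \<in> R \<Longrightarrow> z' \<in> R \<Longrightarrow> ptl z = ptl z' \<Longrightarrow> z = z') \<Longrightarrow>
     \<exists>g. 0 < g 0 \<and> \<not> matches rs n R UNIV (range (code g))"
  shows "lang n = {w \<in> topspace (cantor (3 + 2 * Suc (length rs))). \<exists>p \<gamma>. reach n w 0 init p \<gamma> \<and> fst \<gamma> = Sink}
     \<union> {w. exact n w}"
proof (intro equalityI subsetI)
  fix w assume w: "w \<in> lang n"
  show "w \<in> {w \<in> topspace (cantor (3 + 2 * Suc (length rs))). \<exists>p \<gamma>. reach n w 0 init p \<gamma> \<and> fst \<gamma> = Sink}
     \<union> {w. exact n w}"
  proof (cases "\<exists>p \<gamma>. reach n w 0 init p \<gamma> \<and> fst \<gamma> = Sink")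
    case True
    then show ?thesis using w unfolding lang_def by blast
  next
    case False
    then have "exact n w" using path_run_sound[of w n] w unfolding lang_def by blast
    then show ?thesis by simp
  qed
next
  fix w assume w: "w \<in> {w \<in> topspace (cantor (3 + 2 * Suc (length rs))). \<exists>p \<gamma>. reach n w 0 init p \<gamma> \<and> fst \<gamma> = Sink}
     \<union> {w. exact n w}"
  show "w \<in> lang n"
  proof (cases "\<exists>p \<gamma>. reach n w 0 init p \<gamma> \<and> fst \<gamma> = Sink")
    case True
    moreover have "w \<in> topspace (cantor (3 + 2 * Suc (length rs)))"
      using w exact_in_topspace[OF _ nt_pos, of n w] by blast
    ultimately show ?thesis using accepted_if_reach_Sink unfolding lang_def by blast
  next
    case False
    then have ex: "exact n w" using w by auto
    then have wj: "wellformed n w" "justified n w" using reach_Sink_iff False by blast+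
    have "z = z'" if "z \<in> bits n w" "z' \<in> bits n w" "ptl z = ptl z'" for z z'
      using wj(1) that unfolding wellformed_def bits_def by (metis mem_Collect_eq linorder_neqE_nat)
    from H[of "bits n w", OF this] obtain g where g: "0 < g 0" "\<not> matches rs n (bits n w) UNIV (range (code g))"
      by blast
    have "tag n w (code g (Suc k)) div 2 = 0" for k
    proof (rule ccontr)
      assume "tag n w (code g (Suc k)) div 2 \<noteq> 0"
      then obtain i where i: "tag n w (code g (Suc k)) div 2 = Suc i" using not0_implies_Suc by blast
      then have h: "\<forall>x\<in>set (rs ! i). holds n (bits n w) {..<code g (Suc k)} (anc (code g (Suc k))) (vv n w (code g (Suc k))) x"
        using wj(2) by (simp add: justified_def)
      have "anc (code g (Suc k)) \<subseteq> range (code g)" using anc_code[of g, OF g(1)] by auto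
      then have "\<forall>x\<in>set (rs ! i). holds n (bits n w) UNIV (range (code g)) (vv n w (code g (Suc k))) x"
        using h holds_mono[OF _ order_refl subset_UNIV] by blast
      moreover have "i < length rs" by (rule tag_rule_less[OF ex i])
      ultimately show False using g(2) nth_mem[of i rs] unfolding matches_def by blast
    qed
    then have "accepted n w" by (rule accepted_if_branch[where g = g, OF ex wj(1) g(1)])
    then show ?thesis using exact_in_topspace[OF ex nt_pos] unfolding lang_def by blast
  qed
qed

end

section \<open>Words that embed a tree\<close>

context automaton begin

definition block_of :: "nat \<Rightarrow> nat \<Rightarrow> nat \<times> nat" where
  "block_of n p = (THE bi. p = bp n (fst bi) + snd bi \<and> snd bi \<le> NN n (fst bi))"

lemma block_of: "i \<le> NN n b \<Longrightarrow> block_of n (bp n b + i) = (b, i)"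
  unfolding block_of_def
proof (rule the_equality)
  fix bi assume i: "i \<le> NN n b" and a: "bp n b + i = bp n (fst bi) + snd bi \<and> snd bi \<le> NN n (fst bi)"
  from bp_unique[OF conjunct1[OF a] i conjunct2[OF a]] show "bi = (b, i)" by (simp add: prod_eq_iff)
qed simp

definition word :: "nat \<Rightarrow> (nat \<Rightarrow> nat \<Rightarrow> nat) \<Rightarrow> (nat \<Rightarrow> nat) \<Rightarrow> nat \<Rightarrow> nat" where
  "word n Y \<tau> p = (if p = 0 then 2 else if p \<le> n then 0 else
     (case block_of n p of (b, i) \<Rightarrow>
       if i = 0 then (if b mod K = 0 then 3 + \<tau> (b div K) else 2)
       else if i \<le> Y (b div K) (b mod K) then 1 else 0))"

lemma word_block:
  "i \<le> NN n b \<Longrightarrow> word n Y \<tau> (bp n b + i) =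
     (if i = 0 then (if b mod K = 0 then 3 + \<tau> (b div K) else 2)
       else if i \<le> Y (b div K) (b mod K) then 1 else 0)"
  using block_of[of i n b] bp_mono[of 0 b n] by (simp add: word_def)

lemma exact_word:
  assumes "\<And>t. \<tau> t < nt"
  shows "exact n (word n Y \<tau>)"
  unfolding exact_def
proof (intro conjI allI impI)
  show "word n Y \<tau> 0 = 2" by (simp add: word_def)
  show "word n Y \<tau> p = 0" if "0 < p \<and> p \<le> n" for p using that by (simp add: word_def)
  show "sep_ok b (word n Y \<tau> (bp n b))" for b
    using word_block[of 0 n b Y \<tau>] assms by (simp add: sep_ok_def)
  show "word n Y \<tau> (bp n b + Suc i) < 2" if "i < NN n b" for b i
    using word_block[of "Suc i" n b Y \<tau>] that by simp
qed

lemma tag_word: "tag n (word n Y \<tau>) t = \<tau> t"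
  using word_block[of 0 n "t * K" Y \<tau>] K6 by (simp add: tag_def)

lemma X_word:
  assumes "j < K" "Y t j \<le> Suc n + t"
  shows "X n (word n Y \<tau>) t j = Y t j"
proof -
  have b: "(t * K + j) div K = t" "(t * K + j) mod K = j" using assms(1) by simp_all
  have "i \<le> Suc n + t \<Longrightarrow> ones n (word n Y \<tau>) (t * K + j) i = min i (Y t j)" for i
  proof (induction i)
    case (Suc i)
    have "Suc i \<le> NN n (t * K + j)" using NN_rec[OF assms(1), of n t] Suc.prems by simp
    from word_block[OF this, of Y \<tau>] show ?case using Suc b by (simp add: ones_Suc)
  qed simp
  from this[of "Suc n + t"] show ?thesis using assms by (simp add: X_def min_absorb2)
qed

end

function labels :: "nat \<Rightarrow> nat list" where
  "labels t = (if t = 0 then [] else labels (ptl t) @ [phd t])"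
  by auto
termination by (relation less_than) (simp_all add: ptl_less)
declare labels.simps [simp del]

lemma labels_code: "0 < g 0 \<Longrightarrow> labels (code g k) = map g [0..<k]"
proof (induction k)
  case 0
  show ?case by (simp add: labels.simps)
next
  case (Suc k)
  then show ?case using code_Suc_pos[of g k] by (subst labels.simps) simp
qed

text \<open>Nodes below a child \<open>\<ge> 2\<close> of the root may be refuted at will; this is where the
  words carry a tree of their own.\<close>

definition free_rule :: "atom list" where
  "free_rule = [AAnc 0, AZero 1, ASuc 1 2, AFld 2 0 2, AFld 1 0 3, ALt 2 3]"

lemma free_rule_match:
  assumes "0 < g 0" "\<forall>y\<in>set free_rule. holds n R Q (range (code g)) v y"
  shows "2 \<le> g 0"
proof -
  have h: "v 0 \<in> range (code g)" "v 1 = 0" "v 2 = Suc (v 1)" "lev (v 0) = v 2" "phd (v 0) = v 3" "v 2 < v 3"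
    using assms(2) by (auto simp: free_rule_def fld_def)
  then obtain k where "v 0 = code g k" by blast
  then have "v 0 = code g (Suc 0)" using h lev_code[of g, OF assms(1)] by auto
  then show ?thesis using h by simp
qed

text \<open>Two levels are spared. The first label selects the free subtree, and its node is a
  proper ancestor only from level 2 on; the condition for \<open>k = 0\<close> is therefore imposed
  at level 2, where the free rule is applicable.\<close>

definition alive :: "(nat \<Rightarrow> nat) \<Rightarrow> nat \<Rightarrow> bool" where
  "alive x t \<longleftrightarrow> (2 \<le> lev t \<longrightarrow>
     x (prod_encode (list_encode (map x [0..<lev t - 2]), list_encode (drop 2 (labels t)))) = 1)"

lemma alive_continuous: "\<exists>q. \<forall>y. (\<forall>i<q. y i = x i) \<longrightarrow> alive y t = alive x t"
proof -
  let ?q = "max (lev t) (Suc (prod_encode (list_encode (map x [0..<lev t - 2]), list_encode (drop 2 (labels t)))))"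
  have "alive y t = alive x t" if a: "\<forall>i<?q. y i = x i" for y
  proof -
    have m: "map y [0..<lev t - 2] = map x [0..<lev t - 2]" using a by auto
    show ?thesis unfolding alive_def m using a by simp
  qed
  then show ?thesis by blast
qed

section \<open>Words built from a counterexample to membership in \<open>B\<close>\<close>

locale diagonal_words = rule_automaton "free_rule # rs0" M for rs0 M +
  fixes n :: nat and R :: "nat set"
  assumes M: "4 \<le> M"
    and functional: "\<And>z z'. z \<in> R \<Longrightarrow> z' \<in> R \<Longrightarrow> ptl z = ptl z' \<Longrightarrow> z = z'"
    and refuted: "\<And>g. g 0 = 1 \<Longrightarrow> matches rs0 n R UNIV (range (code g))"
begin

abbreviation "rules \<equiv> free_rule # rs0"

text \<open>The free rule is claimed only where the embedded tree demands a dead node, the other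
  rules only below child \<open>1\<close> of the root. The valuation must fit into the blocks of
  record \<open>t\<close>, hence its bound.\<close>

definition kill :: "bool \<Rightarrow> nat \<Rightarrow> nat \<times> (nat \<Rightarrow> nat) \<Rightarrow> bool" where
  "kill al t iv \<longleftrightarrow> fst iv < length rules \<and> (\<forall>a<M. snd iv a \<le> Suc n + t) \<and>
     (\<forall>y\<in>set (rules ! fst iv). holds n R {..<t} (anc t) (snd iv) y) \<and>
     (if fst iv = 0 then \<not> al else hd (labels t) = 1)"

text \<open>The choice sees the embedded tree only through the truth value \<open>al\<close>, so
  record \<open>t\<close> varies only with the fate of its own node.\<close>

definition choice :: "bool \<Rightarrow> nat \<Rightarrow> nat \<times> (nat \<Rightarrow> nat)" where
  "choice al t = (SOME iv. kill al t iv)"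

definition \<tau> :: "(nat \<Rightarrow> bool) \<Rightarrow> nat \<Rightarrow> nat" where
  "\<tau> al t = (if t \<in> R then 1 else 0) + 2 * (if \<exists>iv. kill (al t) t iv then Suc (fst (choice (al t) t)) else 0)"

definition Y :: "(nat \<Rightarrow> bool) \<Rightarrow> nat \<Rightarrow> nat \<Rightarrow> nat" where
  "Y al t j = (if j = 0 then ptl t else if j = 1 then phd t else if j = 2 then lev t else if j = 3 then t
     else if j - 4 < M \<and> (\<exists>iv. kill (al t) t iv) then snd (choice (al t) t) (j - 4) else 0)"

definition dword :: "(nat \<Rightarrow> bool) \<Rightarrow> nat \<Rightarrow> nat" where
  "dword al = word n (Y al) (\<tau> al)"

lemma kill_choice: "kill al t iv \<Longrightarrow> kill al t (choice al t)"
  unfolding choice_def by (rule someI)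

lemma \<tau>_div: "\<tau> al t div 2 = (if \<exists>iv. kill (al t) t iv then Suc (fst (choice (al t) t)) else 0)"
  and \<tau>_odd: "odd (\<tau> al t) \<longleftrightarrow> t \<in> R"
  by (simp_all add: \<tau>_def)

lemma \<tau>_less: "\<tau> al t < 2 * Suc (length rules)"
proof -
  have "\<tau> al t div 2 \<le> length rules"
  proof (cases "\<exists>iv. kill (al t) t iv")
    case True
    then have "kill (al t) t (choice (al t) t)" using kill_choice by blast
    then have "fst (choice (al t) t) < length rules" unfolding kill_def by blast
    then show ?thesis using True by (simp add: \<tau>_div)
  qed (simp add: \<tau>_div)
  then show ?thesis by simp
qed

lemma exact_dword: "exact n (dword al)"
  unfolding dword_def by (rule exact_word[OF \<tau>_less])

lemma Y_le: "Y al t j \<le> Suc n + t"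
proof -
  have "ptl t \<le> t" using ptl_less[of t] by (cases "t = 0") auto
  moreover have "snd (choice (al t) t) (j - 4) \<le> Suc n + t" if "j - 4 < M" "kill (al t) t iv" for iv
    using kill_choice[OF that(2)] that(1) by (simp add: kill_def)
  ultimately show ?thesis using phd_le[of t] lev_le[of t] by (auto simp: Y_def)
qed

lemma X_dword: "j < K \<Longrightarrow> X n (dword al) t j = Y al t j"
  unfolding dword_def by (rule X_word[where Y = "Y al", OF _ Y_le])

lemma tag_dword: "tag n (dword al) t = \<tau> al t"
  unfolding dword_def by (rule tag_word)

lemma bits_dword: "bits n (dword al) = R"
  by (simp add: bits_def tag_dword \<tau>_odd)

lemma wellformed_dword: "wellformed n (dword al)"
  unfolding wellformed_def
proof (intro conjI allI impI)
  fix t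
  show "X n (dword al) t 0 = ptl t" "X n (dword al) t 1 = phd t" "X n (dword al) t 2 = lev t" "X n (dword al) t 3 = t"
    by (simp_all add: X_dword Y_def del: One_nat_def)
next
  fix t' t assume a: "t' < t \<and> odd (tag n (dword al) t') \<and> odd (tag n (dword al) t)"
  then have "t' \<in> R" "t \<in> R" by (simp_all add: tag_dword \<tau>_odd)
  then show "ptl t' \<noteq> ptl t" using functional[of t' t] a by auto
qed

lemma justified_dword: "justified n (dword al)"
  unfolding justified_def
proof (intro allI impI ballI)
  fix t i y assume i: "tag n (dword al) t div 2 = Suc i" and y: "y \<in> set (rules ! i)"
  then obtain iv where k: "kill (al t) t iv" and f: "fst (choice (al t) t) = i"
    by (auto simp: tag_dword \<tau>_div split: if_splits)
  note c = kill_choice[OF k]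
  have il: "i < length rules" using c f by (simp add: kill_def)
  have "holds n R {..<t} (anc t) (snd (choice (al t) t)) y" using c f y by (simp add: kill_def)
  moreover have "vv n (dword al) t a = snd (choice (al t) t) a" if "a \<in> avars y" for a
  proof -
    have "a < M" using vars[OF nth_mem[OF il] y] that by auto
    then have "X n (dword al) t (4 + a) = snd (choice (al t) t) a"
      using exI[of "kill (al t) t", OF k] by (subst X_dword) (simp_all add: Y_def del: split_paired_Ex)
    then show ?thesis by (simp add: vv_def)
  qed
  ultimately show "holds n (bits n (dword al)) {..<t} (anc t) (vv n (dword al) t) y"
    unfolding bits_dword using holds_cong[of y "vv n (dword al) t" "snd (choice (al t) t)"] by blast
qed

text \<open>Beyond the largest value of the valuation all pointers refer to earlier records and the
  branch nodes among them are proper ancestors, so a match in the limit is a match at the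
  node.\<close>

lemma branch_match:
  assumes g: "0 < g 0" and i: "i < length rules"
    and m: "\<forall>y\<in>set (rules ! i). holds n R UNIV (range (code g)) v y"
    and k: "\<And>a. a < M \<Longrightarrow> v a < code g k" and c: "if i = 0 then \<not> al else hd (labels (code g k)) = 1"
  shows "kill al (code g k) (i, v)"
proof -
  have "holds n R {..<code g k} (anc (code g k)) v y" if y: "y \<in> set (rules ! i)" for y
  proof -
    have "avars y \<subseteq> {..<M}" by (rule vars[OF nth_mem[OF i] y])
    then have b: "v a < code g k" if "a \<in> avars y" for a using k that by auto
    have h: "holds n R UNIV (range (code g)) v y" using m y by blast
    have "v a \<in> anc (code g k)" if "v a \<in> range (code g)" "a \<in> avars y" for a
    proof -
      obtain k' where k': "v a = code g k'" using \<open>v a \<in> range (code g)\<close> by blast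
      then have "k' < k" using b[OF that(2)] strict_mono_less[OF strict_mono_code[of g, OF g]] by simp
      then show ?thesis using k' anc_code[of g, OF g] by auto
    qed
    then show ?thesis using h b by (cases y) auto
  qed
  moreover have "v a \<le> Suc n + code g k" if "a < M" for a using k[OF that] by simp
  ultimately show ?thesis using i c by (simp add: kill_def)
qed

lemma eventually_large:
  assumes g: "0 < g 0"
  shows "\<exists>k>0. \<forall>a<M. v a < code g k"
proof -
  define k where "k = Suc (\<Sum>a<M. v a)"
  have "k \<le> code g k" by (rule strict_mono_imp_increasing[OF strict_mono_code[of g, OF g]])
  moreover have "v a < k" if "a < M" for a
    using member_le_sum[of a "{..<M}" v] that by (simp add: k_def)
  ultimately show ?thesis by (intro exI[of _ k]) (fastforce simp: k_def)
qed

text \<open>An accepting run yields a branch without kills. It cannot begin with \<open>1\<close>,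
  where each branch is killed eventually, so it runs through the free part, where escaping the free
  rule forces \<open>alive\<close>; its labels from the third on are the witness.\<close>

lemma dword_in_lang_iff:
  "dword (alive x) \<in> lang n \<longleftrightarrow> (\<exists>g. \<forall>k. x (prod_encode (list_encode (map x [0..<k]), list_encode (map g [0..<k]))) = 1)"
    (is "_ \<longleftrightarrow> ?D")
proof
  let ?w = "dword (alive x)"
  note ex = exact_dword[of "alive x"] and wf = wellformed_dword[of "alive x"]
  assume "?w \<in> lang n"
  then have acc: "accepted n ?w" "?w \<in> topspace (cantor (3 + 2 * Suc (length rules)))"
    unfolding lang_def by blast+
  have ns: "\<And>p \<gamma>. reach n ?w 0 init p \<gamma> \<Longrightarrow> fst \<gamma> \<noteq> Sink"
    using reach_Sink_iff[OF ex] wf justified_dword[of "alive x"] by blast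
  from path_run_sound[OF acc(2) _ acc(1)] ns obtain m H where
    H0: "H 0 = 0" and inf: "\<exists>\<^sub>\<infinity>t. m t" and m0: "\<not> m 0"
    and mH: "\<And>t. if m t then X n ?w t 0 = H t \<and> H (Suc t) = X n ?w t 3 \<and> tag n ?w t \<in> {0, 1} else H (Suc t) = H t"
    by blast
  have X: "X n ?w t 0 = ptl t" "X n ?w t 3 = t" for t using wf by (auto simp: wellformed_def)
  \<comment> \<open>The records taken in mode \<open>True\<close>. Between two of them the held node
    does not change, so in increasing order each is the parent of the next.\<close>
  define S where "S = {t. m t}"
  have infS: "infinite S" using inf by (simp add: S_def INFM_iff_infinite)
  define f where "f = enumerate S"
  have fS: "m (f k)" for k using enumerate_in_set[OF infS] by (simp add: f_def S_def)
  have sm: "strict_mono f" using strict_mono_enumerate[OF infS] by (simp add: f_def)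
  have gap: "\<not> m t" if "f k < t" "t < f (Suc k)" for t k
  proof
    assume "m t"
    then have "f (Suc k) \<le> t"
      unfolding f_def enumerate_Suc''[OF infS] using that(1) by (intro Least_le) (simp add: S_def f_def)
    then show False using that by simp
  qed
  have gap0: "\<not> m t" if "t < f 0" for t
    using not_less_Least[of t "\<lambda>n. n \<in> S"] that by (auto simp: f_def enumerate_0 S_def)
  have Hconst: "H t' = H t" if "t \<le> t'" "\<And>u. t \<le> u \<Longrightarrow> u < t' \<Longrightarrow> \<not> m u" for t t'
    using that
  proof (induction t' rule: dec_induct)
    case (step u)
    then show ?case using mH[of u] by auto
  qed simp
  define g where "g k = phd (f k)" for k
  have p0: "ptl (f 0) = 0" using mH[of "f 0"] fS[of 0] X Hconst[of 0 "f 0"] gap0 H0 by auto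
  have pS: "ptl (f (Suc k)) = f k" for k
  proof -
    have "f k < f (Suc k)" using sm by (simp add: strict_mono_Suc_iff)
    then have "H (f (Suc k)) = H (Suc (f k))" by (intro Hconst) (use gap[of k] in \<open>auto simp: Suc_le_eq\<close>)
    then show ?thesis using mH[of "f k"] mH[of "f (Suc k)"] fS X by auto
  qed
  have code: "code g (Suc k) = f k" for k
  proof (induction k)
    case 0
    have "code g (Suc 0) = prod_encode (ptl (f 0), phd (f 0))" by (simp add: code.simps g_def p0)
    then show ?case by simp
  next
    case (Suc k)
    have "code g (Suc (Suc k)) = prod_encode (ptl (f (Suc k)), phd (f (Suc k)))"
      by (subst code.simps) (simp add: Suc pS g_def)
    then show ?case by simp
  qed
  have "f 0 \<noteq> 0" using fS[of 0] m0 by metis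
  then have g: "0 < g 0" using code[of 0] by (cases "g 0") (simp_all add: code.simps)
  have nk: "\<not> kill (alive x (code g (Suc k))) (code g (Suc k)) iv" for k iv
  proof
    assume k: "kill (alive x (code g (Suc k))) (code g (Suc k)) iv"
    have "tag n ?w (code g (Suc k)) \<in> {0, 1}" using mH[of "f k"] fS[of k] code[of k] by auto
    then have "\<tau> (alive x) (code g (Suc k)) div 2 = 0" by (auto simp: tag_dword)
    then show False using exI[of "kill _ _", OF k] by (simp add: \<tau>_div del: split_paired_Ex)
  qed
  have "g 0 \<noteq> 1"
  proof
    assume g1: "g 0 = 1"
    from refuted[of g, OF g1] obtain r v where rv: "r \<in> set rs0" "\<forall>y\<in>set r. holds n R UNIV (range (code g)) v y"
      unfolding matches_def by blast
    then obtain i where i: "i < length rs0" "rs0 ! i = r" by (metis in_set_conv_nth)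
    obtain k where k: "0 < k" "\<forall>a<M. v a < code g k" using eventually_large[of g v, OF g] by blast
    then obtain k' where k': "k = Suc k'" by (cases k) auto
    have "hd (labels (code g k)) = 1" using labels_code[of g k, OF g] g1 k(1) by (simp add: hd_map)
    then have "kill (alive x (code g k)) (code g k) (Suc i, v)"
      using branch_match[of g "Suc i" v k "alive x (code g k)", OF g] i rv k by simp
    then show False using nk k' by blast
  qed
  then have g2: "2 \<le> g 0" using g by simp
  have al: "alive x (code g (k + 2))" for k
  proof (rule ccontr)
    assume na: "\<not> alive x (code g (k + 2))"
    \<comment> \<open>The witness for the free rule: the ancestor at level 1, the numbers 0 and 1,
      and the label of that ancestor.\<close>
    define v where "v a = (if a = 0 then code g 1 else if a = 1 then 0 else if a = 2 then 1 else if a = 3 then g 0 else 0)" for a :: nat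
    have c1: "code g 1 < code g (k + 2)" using strict_mono_code[of g, OF g] by (simp add: strict_mono_def)
    moreover have "g 0 \<le> code g 1" by (metis phd_le phd_code One_nat_def)
    ultimately have lt: "v a < code g (k + 2)" for a using g2 by (auto simp: v_def)
    have "\<forall>y\<in>set (rules ! 0). holds n R UNIV (range (code g)) v y"
      using g2 lev_code[of g 1, OF g] by (simp add: free_rule_def v_def fld_def)
    from branch_match[of g 0 v "k + 2" "alive x (code g (k + 2))", OF g _ this] lt na
    have "kill (alive x (code g (k + 2))) (code g (k + 2)) (0, v)" by simp
    then show False using nk[of "Suc k"] by simp
  qed
  show ?D
  proof (rule exI[of _ "\<lambda>i. g (i + 2)"], rule allI)
    fix k
    have l: "lev (code g (k + 2)) = k + 2" by (rule lev_code[of g, OF g])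
    have lb: "labels (code g (k + 2)) = map g [0..<k + 2]" by (rule labels_code[of g, OF g])
    have "drop 2 (map g [0..<k + 2]) = map (\<lambda>i. g (i + 2)) [0..<k]"
    proof -
      have "map (\<lambda>i. g (i + 2)) [0..<k] = map g (map (\<lambda>i. i + 2) [0..<k])" by simp
      also have "\<dots> = drop 2 (map g [0..<k + 2])" unfolding map_add_upt drop_map drop_upt by (simp only: add_0)
      finally show ?thesis by (rule sym)
    qed
    then show "x (prod_encode (list_encode (map x [0..<k]), list_encode (map (\<lambda>i. g (i + 2)) [0..<k]))) = 1"
      using al[of k] unfolding alive_def l lb by simp
  qed
next
  let ?w = "dword (alive x)"
  note ex = exact_dword[of "alive x"] and wf = wellformed_dword[of "alive x"]
  assume ?D
  then obtain g' where g': "\<And>k. x (prod_encode (list_encode (map x [0..<k]), list_encode (map g' [0..<k]))) = 1" by blast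
  \<comment> \<open>The first \<open>2\<close> enters the free part, the second fills the spared
    level.\<close>
  define g where "g i = (if i < 2 then 2 else g' (i - 2))" for i :: nat
  have g: "0 < g 0" by (simp add: g_def)
  have al: "alive x (code g k)" for k
  proof -
    have l: "lev (code g k) = k" by (rule lev_code[of g, OF g])
    have lb: "labels (code g k) = map g [0..<k]" by (rule labels_code[of g, OF g])
    have "drop 2 (map g [0..<k]) = map g' [0..<k - 2]"
      by (rule nth_equalityI) (auto simp: g_def)
    then show ?thesis unfolding alive_def l lb using g'[of "k - 2"] by simp
  qed
  have nk: "\<not> kill True (code g (Suc k)) iv" for k iv
  proof
    assume "kill True (code g (Suc k)) iv"
    then have "hd (labels (code g (Suc k))) = 1" by (auto simp: kill_def split: if_splits)
    then show False using labels_code[of g "Suc k", OF g] by (simp add: hd_map g_def upt_rec)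
  qed
  have "tag n ?w (code g (Suc k)) div 2 = 0" for k
    using nk[of k] al[of "Suc k"] by (simp add: tag_dword \<tau>_div)
  then have "accepted n ?w" by (rule accepted_if_branch[where g = g, OF ex wf g])
  then show "?w \<in> lang n" using exact_in_topspace[OF ex nt_pos] unfolding lang_def by blast
qed

theorem lang_not_borel: "lang n \<notin> borel_cantor (3 + 2 * Suc (length rules))"
proof (rule not_borel_if_diagonal_reducible[where \<Phi> = "\<lambda>x. dword (alive x)"])
  fix x assume x: "x \<in> topspace (cantor 2)"
  show "dword (alive x) \<in> topspace (cantor (3 + 2 * Suc (length rules)))"
    by (rule exact_in_topspace[OF exact_dword nt_pos])
  show "dword (alive x) \<in> lang n \<longleftrightarrow> x \<in> diagonal_analytic"
    unfolding dword_in_lang_iff diagonal_analytic_def using x by blast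
  fix p
  \<comment> \<open>The record containing position \<open>p\<close>; its contents depend on
    \<open>x\<close> only through \<open>alive x ?t\<close>.\<close>
  let ?t = "fst (block_of n p) div K"
  obtain q where q: "\<forall>y. (\<forall>i<q. y i = x i) \<longrightarrow> alive y ?t = alive x ?t" using alive_continuous by blast
  have "dword (alive y) p = dword (alive x) p" if "alive y ?t = alive x ?t" for y
  proof -
    have "Y (alive y) ?t = Y (alive x) ?t" "\<tau> (alive y) ?t = \<tau> (alive x) ?t"
      unfolding Y_def \<tau>_def that by (simp_all only:)
    then show ?thesis unfolding dword_def word_def by (cases "block_of n p") simp
  qed
  then show "\<exists>q. \<forall>y\<in>topspace (cantor 2). (\<forall>i<q. y i = x i) \<longrightarrow> dword (alive y) p = dword (alive x) p"
    using q by blast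
qed

end

section \<open>The reduction\<close>

text \<open>An open set is the union of the closed sets \<open>C V p\<close> of points whose
  cylinder of length \<open>p\<close> lies inside. So open union closed is an F-sigma set, and so is
  its complement, an open set minus an open set.\<close>

lemma open_Un_closed:
  fixes k :: nat
  assumes r: "Well_order r" "a \<in> Field r" "\<exists>b\<in>spred r a. spred r b \<noteq> {}"
    and U: "openin (cantor k) U" and E: "E \<subseteq> topspace (cantor k)" "openin (cantor k) (topspace (cantor k) - E)"
  shows "bsig r k a (U \<union> E) \<and> bpi r k a (U \<union> E)"
proof
  let ?T = "topspace (cantor k)"
  define C where "C V p = {x \<in> ?T. \<forall>y\<in>?T. (\<forall>i<p. y i = x i) \<longrightarrow> y \<in> V}" for V and p :: nat
  have C: "openin (cantor k) (?T - C V p)" for V p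
  proof -
    have "y \<in> ?T - C V p" if "x \<in> ?T - C V p" "y \<in> ?T" "\<forall>i<p. y i = x i" for x y
      using that by (force simp: C_def)
    then show ?thesis unfolding openin_cantor_iff by blast
  qed
  have CU: "(\<Union>p. C V p) = V" if "openin (cantor k) V" for V
  proof -
    have "C V p \<subseteq> V" for p by (auto simp: C_def)
    moreover have "\<exists>p. x \<in> C V p" if x: "x \<in> V" for x
    proof -
      obtain p where "\<forall>y\<in>?T. (\<forall>i<p. y i = x i) \<longrightarrow> y \<in> V" "V \<subseteq> ?T"
        using \<open>openin (cantor k) V\<close> x unfolding openin_cantor_iff by blast
      then have "x \<in> C V p" using x by (auto simp: C_def)
      then show ?thesis by blast
    qed
    ultimately show ?thesis by blast
  qed
  have CT: "C V p \<subseteq> ?T" for V p by (auto simp: C_def)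
  have UT: "U \<subseteq> ?T" using U by (rule openin_subset)
  have "bsig r k a (\<Union>p. C U p \<union> E)"
  proof (rule bsig_Fsigma[OF r])
    show "C U p \<union> E \<subseteq> ?T" for p using CT E by blast
    have "?T - (C U p \<union> E) = (?T - C U p) \<inter> (?T - E)" for p by blast
    then show "openin (cantor k) (?T - (C U p \<union> E))" for p
      using openin_Int[OF C E(2)] by simp
  qed
  moreover have "(\<Union>p. C U p \<union> E) = U \<union> E" using CU[OF U] by auto
  ultimately show "bsig r k a (U \<union> E)" by simp
  have "bsig r k a (\<Union>p. C (?T - E) p - U)"
  proof (rule bsig_Fsigma[OF r])
    show "C (?T - E) p - U \<subseteq> ?T" for p using CT by blast
    have "?T - (C (?T - E) p - U) = (?T - C (?T - E) p) \<union> U" for p using UT by blast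
    then show "openin (cantor k) (?T - (C (?T - E) p - U))" for p
      using openin_Un[OF C U] by simp
  qed
  moreover have "(\<Union>p. C (?T - E) p - U) = ?T - (U \<union> E)" using CU[OF E(2)] by auto
  ultimately show "bpi r k a (U \<union> E)" using UT E(1) by (auto simp: bpi_def)
qed

section \<open>Coding the automaton by a number, recursively in \<open>n\<close>\<close>

instance st :: countable by countable_datatype

text \<open>The codes of the states \<open>Ch i\<close> must be computable from \<open>i\<close>,
  and doubling is available as addition. Only finitely many other states occur in transitions, so
  these may have arbitrary odd codes.\<close>

fun enc :: "st \<Rightarrow> nat" where
  "enc (Ch i) = i + i"
| "enc s = Suc (2 * to_nat s)"

lemma inj_enc: "inj enc"
proof (rule injI)
  have e: "even (enc s) \<longleftrightarrow> (\<exists>i. s = Ch i)" for s by (cases s) auto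
  fix s s' assume h: "enc s = enc s'"
  show "s = s'"
  proof (cases "\<exists>i. s = Ch i")
    case True
    then show ?thesis using h e[of s] e[of s'] by auto
  next
    case False
    then have "\<not> (\<exists>i. s' = Ch i)" using h e[of s] e[of s'] by simp
    then have "enc s' = Suc (2 * to_nat s')" by (cases s') auto
    moreover have "enc s = Suc (2 * to_nat s)" using False by (cases s) auto
    ultimately show ?thesis using h by simp
  qed
qed

declare enc.simps(2-) [simp del]

text \<open>The increments, shifted by one, are the ternary digits that \<open>upd\<close>
  extracts.\<close>

definition ucode :: "(nat \<Rightarrow> int) \<Rightarrow> nat" where
  "ucode d = nat (d 0 + 1) + 3 * (nat (d 1 + 1) + 3 * (nat (d 2 + 1) + 3 * nat (d 3 + 1)))"

lemma digits:
  fixes a b c e :: nat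
  assumes "a < 3" "b < 3" "c < 3" "e < 3"
  shows "(a + 3 * (b + 3 * (c + 3 * e))) div 3 ^ 0 mod 3 = a" "(a + 3 * (b + 3 * (c + 3 * e))) div 3 ^ 1 mod 3 = b"
    "(a + 3 * (b + 3 * (c + 3 * e))) div 3 ^ 2 mod 3 = c" "(a + 3 * (b + 3 * (c + 3 * e))) div 3 ^ 3 mod 3 = e"
    "a + 3 * (b + 3 * (c + 3 * e)) < 81"
proof -
  define Z where "Z = c + 3 * e"
  define Y where "Y = b + 3 * Z"
  define u where "u = a + 3 * Y"
  have q: "u div 3 = Y" "Y div 3 = Z" "Z div 3 = e" "u mod 3 = a" "Y mod 3 = b" "Z mod 3 = c"
    unfolding u_def Y_def Z_def mod_mult_self2 using assms by simp_all
  have "u div (3 * 3) = Z" "u div (3 * 3 * 3) = e" unfolding div_mult2_eq q by (rule refl)+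
  then have "u div 3 ^ 0 mod 3 = a" "u div 3 ^ 1 mod 3 = b" "u div 3 ^ 2 mod 3 = c" "u div 3 ^ 3 mod 3 = e"
    using q assms by simp_all
  then show "(a + 3 * (b + 3 * (c + 3 * e))) div 3 ^ 0 mod 3 = a" "(a + 3 * (b + 3 * (c + 3 * e))) div 3 ^ 1 mod 3 = b"
    "(a + 3 * (b + 3 * (c + 3 * e))) div 3 ^ 2 mod 3 = c" "(a + 3 * (b + 3 * (c + 3 * e))) div 3 ^ 3 mod 3 = e"
    unfolding u_def Y_def Z_def by blast+
  show "a + 3 * (b + 3 * (c + 3 * e)) < 81"
  proof -
    have "c + 3 * e \<le> 8" using assms by linarith
    then have "b + 3 * (c + 3 * e) \<le> 26" using assms(2) by presburger
    then show ?thesis using assms(1) by presburger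
  qed
qed

context
  fixes d :: "nat \<Rightarrow> int"
  assumes d: "\<And>i. d i \<in> {-1, 0, 1}"
begin

lemma nat_digit: "nat (d i + 1) < 3" "int (nat (d i + 1)) = d i + 1"
  using d[of i] by auto

lemma upd_ucode: "i < 4 \<Longrightarrow> upd (ucode d) i = d i"
proof -
  note D = digits[of "nat (d 0 + 1)" "nat (d 1 + 1)" "nat (d 2 + 1)" "nat (d 3 + 1)", OF nat_digit(1) nat_digit(1) nat_digit(1) nat_digit(1)]
  have "\<forall>i<4. upd (ucode d) i = d i"
    unfolding all_less_4 upd_def ucode_def D(1-4) nat_digit(2) by simp
  then show "i < 4 \<Longrightarrow> upd (ucode d) i = d i" by blast
qed

lemma ucode_less: "ucode d < 81"
  unfolding ucode_def by (rule digits(5)) (rule nat_digit(1))+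

end

definition tcode :: "nat \<times> nat \<times> nat \<times> nat \<Rightarrow> nat" where
  "tcode t = (case t of (q, b, q', u) \<Rightarrow> prod_encode (q, prod_encode (b, prod_encode (q', u))))"

lemma decode_tcode [simp]: "decode_trans (tcode t) = t"
  by (simp add: decode_trans_def tcode_def split: prod.splits)

context automaton begin

lemma tr_delta: "tr n s b s' d \<Longrightarrow> d x \<in> {-1, 0, 1}"
  by (erule tr.cases) (auto simp: e1_def bdelta_def sdelta_def tdelta_def src_def dst_def Let_def)

text \<open>Isolates what depends on \<open>n\<close>: the entrance to \<open>Ch n\<close> and the
  descent to \<open>Ch 0\<close>. For \<open>n = 0\<close> the entrance leads to
  \<open>Ch 0\<close>, so excluding that target leaves exactly the common part.\<close>

lemma tr_split:
  "tr n s b s' d \<longleftrightarrow> s = Ini \<and> b = 2 \<and> s' = Ch n \<and> d = (\<lambda>_. 0) \<or>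
     (\<exists>i<n. s = Ch (Suc i) \<and> b = 0 \<and> s' = Ch i \<and> d = e1 1) \<or> tr 0 s b s' d \<and> s' \<noteq> Ch 0"
proof
  assume "tr n s b s' d"
  then show "s = Ini \<and> b = 2 \<and> s' = Ch n \<and> d = (\<lambda>_. 0) \<or>
     (\<exists>i<n. s = Ch (Suc i) \<and> b = 0 \<and> s' = Ch i \<and> d = e1 1) \<or> tr 0 s b s' d \<and> s' \<noteq> Ch 0"
    by (induction rule: tr.induct) ((simp; fail) | (intro disjI2 conjI, (rule tr.intros; assumption), simp))+
next
  have "tr 0 s b s' d \<Longrightarrow> s' \<noteq> Ch 0 \<longrightarrow> tr n s b s' d"
    by (induction rule: tr.induct) ((simp; fail) | (rule impI, (rule tr.intros; assumption)))+
  then show "s = Ini \<and> b = 2 \<and> s' = Ch n \<and> d = (\<lambda>_. 0) \<or>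
     (\<exists>i<n. s = Ch (Suc i) \<and> b = 0 \<and> s' = Ch i \<and> d = e1 1) \<or> tr 0 s b s' d \<and> s' \<noteq> Ch 0 \<Longrightarrow> tr n s b s' d"
    by (blast intro: tr.IniP tr.Ch)
qed

definition base_transitions :: "(nat \<times> nat \<times> nat \<times> nat) set" where
  "base_transitions = {(enc s, b, enc s', ucode d) | s b s' d. tr 0 s b s' d \<and> s' \<noteq> Ch 0}"

lemma finite_base_transitions: "finite base_transitions"
proof -
  define S where "S = {Ini, Ch 0, DSkip, Sink} \<union> FC ` {..<4} \<union> (\<lambda>(m, j). Pa m j) ` (UNIV \<times> {..<K})
    \<union> (\<lambda>(e, ph, j). D e ph j) ` ({..<length specs} \<times> {..4} \<times> {..<K})"
  have P: "m < K \<Longrightarrow> Pa b m \<in> S" for m b unfolding S_def by force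
  have D: "e < length specs \<Longrightarrow> ph \<le> 4 \<Longrightarrow> j < K \<Longrightarrow> D e ph j \<in> S" for e ph j unfolding S_def by force
  have F: "j < 4 \<Longrightarrow> FC j \<in> S" for j unfolding S_def by force
  have o: "Ini \<in> S" "Ch 0 \<in> S" "DSkip \<in> S" "Sink \<in> S" unfolding S_def by blast+
  have K: "0 < K" "K - 1 < K" using K6 by simp_all
  have "tr 0 s b s' d \<Longrightarrow> s \<in> S \<and> s' \<in> S \<and> b < 3 + nt" for s b s' d
    by (induction rule: tr.induct) (use K in \<open>auto intro!: P D F o\<close>)
  moreover have "ucode d < 81" if "tr 0 s b s' d" for s b s' d
    by (rule ucode_less) (rule tr_delta[OF that])
  ultimately have "base_transitions \<subseteq> enc ` S \<times> {..<3 + nt} \<times> enc ` S \<times> {..<81}"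
    unfolding base_transitions_def by blast
  moreover have "finite S" unfolding S_def by simp
  ultimately show ?thesis by (meson finite_SigmaI finite_imageI finite_lessThan finite_subset)
qed

text \<open>An arbitrary enumeration suffices: its code is one number independent of
  \<open>n\<close>, and constants are recursive.\<close>

definition base_list :: "(nat \<times> nat \<times> nat \<times> nat) list" where
  "base_list = (SOME xs. set xs = base_transitions)"

lemma set_base_list: "set base_list = base_transitions"
  unfolding base_list_def by (rule someI_ex[OF finite_list[OF finite_base_transitions]])

definition chain_codes :: "nat \<Rightarrow> nat" where
  "chain_codes n = rec_nat (list_encode (map tcode base_list))
     (\<lambda>i y. Suc (prod_encode (tcode (Suc i + Suc i, 0, i + i, ucode (e1 1)), y))) n"

lemma chain_codes:
  "set (map decode_trans (list_decode (chain_codes n))) =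
     {(enc (Ch (Suc i)), 0, enc (Ch i), ucode (e1 1)) | i. i < n} \<union> base_transitions"
proof (induction n)
  case 0
  show ?case by (simp add: chain_codes_def o_def set_base_list)
next
  case (Suc n)
  have "chain_codes (Suc n) = Suc (prod_encode (tcode (Suc n + Suc n, 0, n + n, ucode (e1 1)), chain_codes n))"
    by (simp add: chain_codes_def)
  then have "set (map decode_trans (list_decode (chain_codes (Suc n)))) =
    insert (enc (Ch (Suc n)), 0, enc (Ch n), ucode (e1 1)) (set (map decode_trans (list_decode (chain_codes n))))"
    by simp
  then show ?case unfolding Suc by (auto simp: less_Suc_eq)
qed

definition automaton_code :: "nat \<Rightarrow> nat" where
  "automaton_code n = prod_encode (3 + nt, prod_encode (enc Ini, prod_encode (list_encode [enc Sink, enc (Pa True 0)],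
     Suc (prod_encode (tcode (enc Ini, 2, n + n, ucode (\<lambda>_. 0)), chain_codes n)))))"

lemma total_recursive_automaton_code: "total_recursive automaton_code"
  unfolding total_recursive_iff automaton_code_def chain_codes_def tcode_def prod.case
  by (intro recursive_fn_intros) auto

lemma P_automaton_code:
  obtains ts where "P (automaton_code n) = (3 + nt, enc Ini, [enc Sink, enc (Pa True 0)], ts)"
    "set ts = {(enc s, b, enc s', ucode d) | s b s' d. tr n s b s' d}"
proof
  let ?ts = "(enc Ini, 2, enc (Ch n), ucode (\<lambda>_. 0)) # map decode_trans (list_decode (chain_codes n))"
  show "P (automaton_code n) = (3 + nt, enc Ini, [enc Sink, enc (Pa True 0)], ?ts)"
    by (simp add: P_def automaton_code_def del: list_encode.simps)
  have "(\<exists>s b s' d. t = (enc s, b, enc s', ucode d) \<and> tr n s b s' d) \<longleftrightarrow> t \<in> set ?ts" for t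
    unfolding set_simps chain_codes base_transitions_def tr_split[of n] by blast
  then show "set ?ts = {(enc s, b, enc s', ucode d) | s b s' d. tr n s b s' d}" by blast
qed

lemma bca_alph_automaton_code: "bca_alph (P (automaton_code n)) = 3 + nt"
  by (rule P_automaton_code[of n]) (simp add: bca_alph_def)

lemma bca_lang_automaton_code: "bca_lang (P (automaton_code n)) = lang n"
proof -
  obtain ts where ts: "P (automaton_code n) = (3 + nt, enc Ini, [enc Sink, enc (Pa True 0)], ts)"
    "set ts = {(enc s, b, enc s', ucode d) | s b s' d. tr n s b s' d}" by (rule P_automaton_code)
  let ?acc = "\<lambda>w. \<exists>(s :: nat \<Rightarrow> nat) (c :: nat \<Rightarrow> nat \<Rightarrow> nat).
        s 0 = enc Ini \<and> (\<forall>i. c 0 i = 0) \<and>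
        (\<forall>n. \<exists>u. (s n, w n, s (Suc n), u) \<in> set ts \<and> (\<forall>i<4. int (c (Suc n) i) = int (c n i) + upd u i)) \<and>
        (\<exists>\<^sub>\<infinity>n. s n \<in> set [enc Sink, enc (Pa True 0)])"
  have acc: "enc s \<in> set [enc Sink, enc (Pa True 0)] \<longleftrightarrow> s \<in> Acc" for s
    using inj_eq[OF inj_enc] by (simp add: Acc_def del: enc.simps)
  have "?acc w \<longleftrightarrow> accepted n w" for w
  proof
    assume "?acc w"
    then obtain s c where h: "s 0 = enc Ini" "\<forall>i. c 0 i = 0"
      "\<And>p. \<exists>u. (s p, w p, s (Suc p), u) \<in> set ts \<and> (\<forall>i<4. int (c (Suc p) i) = int (c p i) + upd u i)"
      "\<exists>\<^sub>\<infinity>p. s p \<in> set [enc Sink, enc (Pa True 0)]" by blast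
    \<comment> \<open>Each state of the numerical run is the source of a transition and hence a
      code.\<close>
    have "\<exists>q. s p = enc q" for p using h(3)[of p] unfolding ts(2) by blast
    then obtain q where q: "\<And>p. s p = enc (q p)" by metis
    let ?run = "\<lambda>p. (q p, c p)"
    have "step n w p (?run p) (?run (Suc p))" for p
    proof -
      obtain u where u: "(enc (q p), w p, enc (q (Suc p)), u) \<in> set ts" "\<forall>i<4. int (c (Suc p) i) = int (c p i) + upd u i"
        using h(3)[of p] unfolding q by blast
      then obtain d where d: "tr n (q p) (w p) (q (Suc p)) d" "u = ucode d"
        unfolding ts(2) using inj_eq[OF inj_enc] by auto
      then show ?thesis unfolding step_def using u(2) upd_ucode[OF tr_delta[OF d(1)]] by auto
    qed
    moreover have "?run 0 = init" using h(1,2) inj_eq[OF inj_enc] unfolding q init_def by auto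
    moreover have "\<exists>\<^sub>\<infinity>p. fst (?run p) \<in> Acc" using h(4) unfolding q acc by simp
    ultimately show "accepted n w" unfolding accepted_def by (intro exI[of _ ?run]) blast
  next
    assume "accepted n w"
    then obtain run where run: "run 0 = init" "\<And>p. step n w p (run p) (run (Suc p))" "\<exists>\<^sub>\<infinity>p. fst (run p) \<in> Acc"
      unfolding accepted_def by blast
    have "\<exists>u. (enc (fst (run p)), w p, enc (fst (run (Suc p))), u) \<in> set ts \<and>
        (\<forall>i<4. int (snd (run (Suc p)) i) = int (snd (run p) i) + upd u i)" for p
    proof -
      obtain d where d: "tr n (fst (run p)) (w p) (fst (run (Suc p))) d"
        "\<forall>x<4. int (snd (run (Suc p)) x) = int (snd (run p) x) + d x"
        using run(2)[of p] unfolding step_def by blast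
      then show ?thesis
        unfolding ts(2) using upd_ucode[OF tr_delta[OF d(1)]] by (intro exI[of _ "ucode d"]) auto
    qed
    then show "?acc w"
      using run(1,3) by (intro exI[of _ "\<lambda>p. enc (fst (run p))"] exI[of _ "\<lambda>p. snd (run p)"])
        (simp only: acc init_def, simp)
  qed
  then show ?thesis unfolding bca_lang_def ts(1) lang_def by simp
qed

lemma reach_cong: "reach n w p \<gamma> q \<gamma>' \<Longrightarrow> (\<And>i. i < q \<Longrightarrow> w' i = w i) \<Longrightarrow> reach n w' p \<gamma> q \<gamma>'"
proof (induction rule: reach.induct)
  case (step q \<gamma>' \<gamma>'')
  then have "step n w' q \<gamma>' \<gamma>''" by (simp add: step_def)
  then show ?case using step by (auto intro: reach.step)
qed (rule reach.refl)

lemma open_reach_Sink: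
  "openin (cantor (3 + nt)) {w \<in> topspace (cantor (3 + nt)). \<exists>p \<gamma>. reach n w 0 init p \<gamma> \<and> fst \<gamma> = Sink}"
  unfolding openin_cantor_iff
proof (intro conjI ballI)
  fix w assume "w \<in> {w \<in> topspace (cantor (3 + nt)). \<exists>p \<gamma>. reach n w 0 init p \<gamma> \<and> fst \<gamma> = Sink}"
  then obtain p \<gamma> where "reach n w 0 init p \<gamma>" "fst \<gamma> = Sink" by blast
  then show "\<exists>p. \<forall>y\<in>topspace (cantor (3 + nt)). (\<forall>i<p. y i = w i) \<longrightarrow>
      y \<in> {w \<in> topspace (cantor (3 + nt)). \<exists>p \<gamma>. reach n w 0 init p \<gamma> \<and> fst \<gamma> = Sink}"
    using reach_cong[of n w 0 init p \<gamma>] by blast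
qed blast

text \<open>Exactness is decided letter by letter: a word which at each position agrees with some
  exact word is exact.\<close>

lemma open_not_exact: "openin (cantor k) (topspace (cantor k) - {w. exact n w})"
  unfolding openin_cantor_iff
proof (intro conjI ballI, blast, rule ccontr)
  fix w assume w: "w \<in> topspace (cantor k) - {w. exact n w}"
    and "\<nexists>p. \<forall>y\<in>topspace (cantor k). (\<forall>i<p. y i = w i) \<longrightarrow> y \<in> topspace (cantor k) - {w. exact n w}"
  then have y: "\<exists>y. exact n y \<and> y p = w p" for p by blast
  have "exact n w" unfolding exact_def
  proof (intro conjI allI impI)
    show "w 0 = 2" using y[of 0] by (auto simp: exact_def)
    show "w p = 0" if "0 < p \<and> p \<le> n" for p using y[of p] that by (auto simp: exact_def)
    show "sep_ok b (w (bp n b))" for b using y[of "bp n b"] unfolding exact_def by metis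
    show "w (bp n b + Suc i) < 2" if "i < NN n b" for b i
      using y[of "bp n b + Suc i"] that unfolding exact_def by metis
  qed
  then show False using w by blast
qed

end

text \<open>The alphabet is the same for all \<open>n\<close> because the rules, and with them the
  tags, depend on the defining formula only.\<close>

lemma hard_instance:
  assumes "Pi12 B"
  shows "\<exists>k f L. total_recursive f \<and> (\<forall>n. bca_alph (P (f n)) = k \<and> bca_lang (P (f n)) = L n) \<and>
    (\<forall>n. n \<in> B \<longrightarrow> (\<exists>U E. L n = U \<union> E \<and> openin (cantor k) U \<and> E \<subseteq> topspace (cantor k) \<and>
        openin (cantor k) (topspace (cantor k) - E))) \<and>
    (\<forall>n. n \<notin> B \<longrightarrow> L n \<notin> borel_cantor k)"
proof -
  obtain \<phi> where B: "\<And>n. n \<in> B \<longleftrightarrow> (\<forall>F. \<exists>G. fsat (\<lambda>i. if i = 0 then n else 0) F G \<phi>)"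
    using assms unfolding Pi12_def by blast
  define rs0 where "rs0 = map (\<lambda>r. flat_rule r 5) (sentence_rules \<phi>)"
  have NF: "n \<in> B \<longleftrightarrow> (\<forall>F. \<exists>g. g 0 = 1 \<and> \<not> matches rs0 n (graph F) UNIV (range (code g)))" for n
  proof -
    have "(\<exists>g. g 0 = 1 \<and> \<not> matches rs0 n (graph F) UNIV (range (code g))) \<longleftrightarrow>
      (\<exists>g. g 0 = 1 \<and> \<not> refutes (sentence_rules \<phi>) g n (graph F))" for F
      unfolding rs0_def using matches_flat_rule[OF _ lvars_sentence_rules] by (metis zero_less_one)
    then show ?thesis unfolding B normal_form by blast
  qed
  have "finite (\<Union>r\<in>set (free_rule # rs0). \<Union>x\<in>set r. avars x)"
    by (intro finite_UN_I finite_set finite_avars)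
  then obtain M where M: "(\<Union>r\<in>set (free_rule # rs0). \<Union>x\<in>set r. avars x) \<subseteq> {..<M}"
    using finite_nat_iff_bounded by blast
  have M4: "4 \<le> M" using M by (force simp: free_rule_def)
  interpret rule_automaton "free_rule # rs0" M
  proof unfold_locales
    fix r x assume "r \<in> set (free_rule # rs0)" "x \<in> set r"
    then have "avars x \<subseteq> (\<Union>r\<in>set (free_rule # rs0). \<Union>x\<in>set r. avars x)" by blast
    then show "avars x \<subseteq> {..<M}" using M by (rule order_trans)
  qed
  let ?k = "3 + 2 * Suc (length (free_rule # rs0))"
  have "\<exists>U E. lang n = U \<union> E \<and> openin (cantor ?k) U \<and> E \<subseteq> topspace (cantor ?k) \<and>
        openin (cantor ?k) (topspace (cantor ?k) - E)" if n: "n \<in> B" for n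
  proof (intro exI conjI)
    show "lang n = {w \<in> topspace (cantor ?k). \<exists>p \<gamma>. reach n w 0 init p \<gamma> \<and> fst \<gamma> = Sink} \<union> {w. exact n w}"
    proof (rule lang_if_unrefutable)
      fix R :: "nat set" assume f: "\<And>z z'. z \<in> R \<Longrightarrow> z' \<in> R \<Longrightarrow> ptl z = ptl z' \<Longrightarrow> z = z'"
      \<comment> \<open>The bits may describe a partial function; \<open>F\<close> extends it, with
        some value wherever no pair is present.\<close>
      define F where "F i a = (SOME b. prod_encode (prod_encode (i, a), b) \<in> R)" for i a
      have R: "R \<subseteq> graph F"
      proof
        fix z assume z: "z \<in> R"
        obtain i a b where e: "z = prod_encode (prod_encode (i, a), b)"
          by (metis prod_decode_inverse surj_pair)
        have "prod_encode (prod_encode (i, a), F i a) \<in> R"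
          unfolding F_def by (rule someI[of _ b]) (use z e in simp)
        then have "b = F i a" using f[OF z] e by fastforce
        then show "z \<in> graph F" using e by simp
      qed
      obtain g where g: "g 0 = 1" "\<not> matches rs0 n (graph F) UNIV (range (code g))"
        using n unfolding NF by blast
      have "\<not> matches (free_rule # rs0) n R UNIV (range (code g))"
      proof
        assume "matches (free_rule # rs0) n R UNIV (range (code g))"
        then obtain r v where r: "r \<in> set (free_rule # rs0)" "\<forall>x\<in>set r. holds n R UNIV (range (code g)) v x"
          unfolding matches_def by blast
        \<comment> \<open>The branch starts with \<open>1\<close>, whereas the free rule requires a
          first entry of at least 2.\<close>
        have "r \<noteq> free_rule" using free_rule_match[of g n R UNIV v] r(2) g(1) by auto
        then have "r \<in> set rs0" using r(1) by simp
        moreover have "\<forall>x\<in>set r. holds n (graph F) UNIV (range (code g)) v x"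
          using r(2) holds_mono[OF _ R order_refl order_refl] by blast
        ultimately show False using g(2) unfolding matches_def by blast
      qed
      then show "\<exists>g. 0 < g 0 \<and> \<not> matches (free_rule # rs0) n R UNIV (range (code g))"
        using g(1) by (intro exI[of _ g]) simp
    qed
    show "openin (cantor ?k) {w \<in> topspace (cantor ?k). \<exists>p \<gamma>. reach n w 0 init p \<gamma> \<and> fst \<gamma> = Sink}"
      by (rule open_reach_Sink)
    show "{w. exact n w} \<subseteq> topspace (cantor ?k)" using exact_in_topspace[OF _ nt_pos] by blast
    show "openin (cantor ?k) (topspace (cantor ?k) - {w. exact n w})" by (rule open_not_exact)
  qed
  moreover have "lang n \<notin> borel_cantor ?k" if n: "n \<notin> B" for n
  proof -
    obtain F where F: "\<And>g. g 0 = 1 \<Longrightarrow> matches rs0 n (graph F) UNIV (range (code g))"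
      using n unfolding NF by blast
    interpret d: diagonal_words rs0 M n "graph F"
    proof unfold_locales
      show "z = z'" if "z \<in> graph F" "z' \<in> graph F" "ptl z = ptl z'" for z z'
        using that by (auto simp: graph_def)
      show "4 \<le> M" by (rule M4)
      show "matches rs0 n (graph F) UNIV (range (code g))" if "g 0 = 1" for g :: "nat \<Rightarrow> nat"
        using that by (rule F)
    qed
    show ?thesis by (rule d.lang_not_borel)
  qed
  ultimately show ?thesis
    by (intro exI[of _ ?k] exI[of _ automaton_code] exI[of _ lang] conjI allI impI total_recursive_automaton_code bca_alph_automaton_code bca_lang_automaton_code)
qed

theorem mainTheorem6:
  fixes r :: "(nat \<times> nat) set" and a :: nat
  assumes "Well_order r" and "a \<in> Field r"
    and "\<exists>b\<in>spred r a. spred r b \<noteq> {}"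
  shows "Pi12_hard {z. bsig r (bca_alph (P z)) a (bca_lang (P z))}
       \<and> Pi12_hard {z. bpi r (bca_alph (P z)) a (bca_lang (P z))}
       \<and> Pi12_hard {z. bca_lang (P z) \<in> borel_cantor (bca_alph (P z))}"
proof -
  have "many_one_reducible B {z. bsig r (bca_alph (P z)) a (bca_lang (P z))}
      \<and> many_one_reducible B {z. bpi r (bca_alph (P z)) a (bca_lang (P z))}
      \<and> many_one_reducible B {z. bca_lang (P z) \<in> borel_cantor (bca_alph (P z))}" if B: "Pi12 B" for B
  proof -
    obtain k f L where f: "total_recursive f" "\<And>n. bca_alph (P (f n)) = k" "\<And>n. bca_lang (P (f n)) = L n"
      and p: "\<And>n. n \<in> B \<Longrightarrow> \<exists>U E. L n = U \<union> E \<and> openin (cantor k) U \<and> E \<subseteq> topspace (cantor k) \<and>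
          openin (cantor k) (topspace (cantor k) - E)"
      and q: "\<And>n. n \<notin> B \<Longrightarrow> L n \<notin> borel_cantor k"
      using hard_instance[OF B] by metis
    have "bsig r k a (L n) \<and> bpi r k a (L n)" if "n \<in> B" for n
      using p[OF that] open_Un_closed[OF assms] by metis
    \<comment> \<open>Membership in \<open>B\<close> yields both classes, and each of them consists
      of Borel sets; non-membership excludes Borel sets and thereby all three.\<close>
    then have "n \<in> B \<longleftrightarrow> bsig r k a (L n)" "n \<in> B \<longleftrightarrow> bpi r k a (L n)" "n \<in> B \<longleftrightarrow> L n \<in> borel_cantor k" for n
      using q bsig_imp_borel bpi_imp_borel by blast+
    then show ?thesis unfolding many_one_reducible_def using f by auto
  qed
  then show ?thesis unfolding Pi12_hard_def by blast
qed

end
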